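(* Let $p$ be an odd prime and $\alpha,\beta,\gamma,\delta,\epsilon\in\mathbb Z_p$. Suppose that (i) $\langle-\beta\rangle_p<\langle-\alpha\rangle_p\leq\min\{\langle-\gamma\rangle_p, \langle-\delta\rangle_p, \langle-\epsilon\rangle_p\}$; (ii) $p+\langle-\alpha\rangle_p>\max\{\langle-\gamma\rangle_p+\langle-\epsilon\rangle_p,\ \langle-\delta\rangle_p+\langle-\epsilon\rangle_p,\ \langle-\beta\rangle_p+\langle-\gamma\rangle_p+\langle-\delta\rangle_p\}$; (iii) $\langle-\alpha\rangle_p/\alpha=\langle-\beta\rangle_p/\beta$; (iv) $(\alpha-\beta+1)_{p-1}$, $(\alpha-\gamma+1)_{p-1}$, $(\alpha-\delta+1)_{p-1}$, $(\alpha-\epsilon+1)_{p-1}$, $(\beta+\gamma+\delta-\alpha)_{p-1}$ are not divisible by $p^2$. Then $$ {}_7F_6\bigg[\begin{matrix}\alpha&\alpha&1+\frac12\alpha&\beta&\gamma&\delta&\epsilon\\&1&\frac12\alpha&\alpha-\beta+1&\alpha-\gamma+1&\alpha-\delta+1&\alpha-\epsilon+1\end{matrix}\bigg|\,1\bigg]_{p-1} \equiv\frac{\langle-\alpha\rangle_p}{\langle-\alpha\rangle_p-\langle-\beta\rangle_p}\cdot\frac{\Gamma_p(\alpha-\beta+1)\Gamma_p(\alpha-\gamma+1)\Gamma_p(\alpha-\delta+1)\Gamma_p(\alpha-\beta-\gamma-\delta+1)}{\Gamma_p(\alpha+1)\Gamma_p(\alpha-\beta-\gamma+1)\Gamma_p(\alpha-\beta-\delta+1)\Gamma_p(\alpha-\gamma-\delta+1)}\cdot{}_4F_3\bigg[\begin{matrix}1-\epsilon&\beta&\gamma&\delta\\&1&\alpha-\epsilon+1&\beta+\gamma+\delta-\alpha\end{matrix}\bigg|\,1\bigg]_{p-1}\pmod{p^2}.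 $$
   Context: $\mathbb Z_p$ denotes the $p$-adic integers. For $\alpha\in\mathbb Z_p$, $\langle\alpha\rangle_p$ is the unique integer in $\{0,1,\ldots,p-1\}$ congruent to $\alpha$ modulo $p$. Pochhammer symbol: $(x)_0=1$, $(x)_k=x(x+1)\cdots(x+k-1)$. For $n\ge 0$ the truncated hypergeometric series is ${}_{m+1}F_m\Big[\begin{matrix}\alpha_0&\alpha_1&\ldots&\alpha_m\\&\beta_1&\ldots&\beta_m\end{matrix}\Big|\,z\Big]_n=\sum_{k=0}^{n}\frac{(\alpha_0)_k\cdots(\alpha_m)_k}{(\beta_1)_k\cdots(\beta_m)_k}\cdot\frac{z^k}{k!}$ (so in the ${}_7F_6$ the ratio $(1+\frac12\alpha)_k/(\frac12\alpha)_k$ equals $(\frac12\alpha+k)/(\frac12\alpha)$). $\Gamma_p$ is Morita's $p$-adic gamma function: $\Gamma_p(n)=(-1)^n\prod_{1\le j<n,\ p\nmid j}j$ for integers $n\ge1$, $\Gamma_p(0)=1$, extended to $\mathbb Z_p$ by continuity. For $x,y\in\mathbb Q_p$, $x\equiv y\pmod{p^2}$ means $x-y\in p^2\mathbb Z_p$. *)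

theory Defs
  imports
    "HOL-Number_Theory.Number_Theory"
    "HOL-Computational_Algebra.Polynomial_Factorial"
    "Berlekamp_Zassenhaus.Finite_Field"
begin

section \<open>The ring of $p$-adic integers\<close>

text \<open>
  The prime \<open>p\<close> is the cardinality of the index type \<open>'p\<close>.  A \<open>p\<close>-adic integer is an element
  of the inverse limit of the rings \<open>\<int>/p\<^sup>n\<int>\<close>, each residue class being represented by
  its least nonnegative member.
\<close>

typedef ('p :: prime_card) padic_int =
  "{x :: nat \<Rightarrow> int. \<forall>n. x n \<in> {0..<int CARD('p) ^ n} \<and> x (Suc n) mod int CARD('p) ^ n = x n}"
  morphisms padic_trunc Abs_padic_int
  by (rule exI[of _ "\<lambda>_. 0"]) (auto simp: prime_gt_0_nat[OF prime_card])

setup_lifting type_definition_padic_int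

lemma mod_power_Suc_mod: "(a mod (P::int) ^ Suc n) mod P ^ n = a mod P ^ n"
  by (rule mod_mod_cancel) (simp add: le_imp_power_dvd)

lemma card_pos_int [simp]: "int CARD('p :: prime_card) > 0"
  using prime_gt_0_nat[OF prime_card[where 'a = 'p]] by simp

lemma coherent_op:
  fixes f :: "int \<Rightarrow> int \<Rightarrow> int" and x y :: "nat \<Rightarrow> int"
  assumes f: "\<And>a b m. f (a mod m) (b mod m) mod m = f a b mod m"
  assumes x: "\<And>n. x n \<in> {0..<int CARD('p :: prime_card) ^ n} \<and> x (Suc n) mod int CARD('p) ^ n = x n"
  assumes y: "\<And>n. y n \<in> {0..<int CARD('p) ^ n} \<and> y (Suc n) mod int CARD('p) ^ n = y n"
  shows "f (x n) (y n) mod int CARD('p) ^ n \<in> {0..<int CARD('p) ^ n} \<and>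
         (f (x (Suc n)) (y (Suc n)) mod int CARD('p) ^ Suc n) mod int CARD('p) ^ n =
         f (x n) (y n) mod int CARD('p) ^ n"
proof
  show "f (x n) (y n) mod int CARD('p) ^ n \<in> {0..<int CARD('p) ^ n}" by simp
  have "f (x (Suc n)) (y (Suc n)) mod int CARD('p) ^ n = f (x n) (y n) mod int CARD('p) ^ n"
    using f[of "x (Suc n)" "int CARD('p) ^ n" "y (Suc n)"] x[of n] y[of n] by simp
  thus "(f (x (Suc n)) (y (Suc n)) mod int CARD('p) ^ Suc n) mod int CARD('p) ^ n =
          f (x n) (y n) mod int CARD('p) ^ n"
    unfolding mod_power_Suc_mod .
qed

instantiation padic_int :: (prime_card) comm_ring_1
begin

lift_definition zero_padic_int :: "'a padic_int" is "\<lambda>_. 0"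
  by (auto simp: prime_gt_0_nat[OF prime_card])

lift_definition one_padic_int :: "'a padic_int" is "\<lambda>n. 1 mod int CARD('a) ^ n"
  by (auto simp: mod_power_Suc_mod simp del: power_Suc)

lift_definition plus_padic_int :: "'a padic_int \<Rightarrow> 'a padic_int \<Rightarrow> 'a padic_int"
  is "\<lambda>x y n. (x n + y n) mod int CARD('a) ^ n"
  by (rule coherent_op[where f = "\<lambda>a b. a + b"]) (simp_all only: mod_simps)

lift_definition minus_padic_int :: "'a padic_int \<Rightarrow> 'a padic_int \<Rightarrow> 'a padic_int"
  is "\<lambda>x y n. (x n - y n) mod int CARD('a) ^ n"
  by (rule coherent_op[where f = "\<lambda>a b. a - b"]) (simp_all only: mod_simps)

lift_definition uminus_padic_int :: "'a padic_int \<Rightarrow> 'a padic_int"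
  is "\<lambda>x n. (- x n) mod int CARD('a) ^ n"
  by (rule coherent_op[where f = "\<lambda>a b. - a" and y = "\<lambda>_. 0"]) (simp_all only: mod_simps, auto)

lift_definition times_padic_int :: "'a padic_int \<Rightarrow> 'a padic_int \<Rightarrow> 'a padic_int"
  is "\<lambda>x y n. (x n * y n) mod int CARD('a) ^ n"
  by (rule coherent_op[where f = "\<lambda>a b. a * b"]) (simp_all only: mod_simps)

instance
proof
  fix a b c :: "'a padic_int"
  show "a * b * c = a * (b * c)"
    by transfer (auto simp: mod_simps mult.assoc)
  show "a * b = b * a"
    by transfer (auto simp: mult.commute)
  show "1 * a = a"
    by transfer (auto simp: mod_simps fun_eq_iff)
  show "a + b + c = a + (b + c)"
    by transfer (auto simp: mod_simps add.assoc)
  show "a + b = b + a"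
    by transfer (auto simp: add.commute)
  show "0 + a = a"
    by transfer (auto simp: fun_eq_iff)
  show "- a + a = 0"
    by transfer (auto simp: mod_simps fun_eq_iff)
  show "a - b = a + - b"
    by transfer (auto simp: mod_simps)
  show "(a + b) * c = a * c + b * c"
    by transfer (auto simp: mod_simps distrib_right)
  show "(0 :: 'a padic_int) \<noteq> 1"
  proof
    assume "(0 :: 'a padic_int) = 1"
    hence "padic_trunc (0 :: 'a padic_int) 1 = padic_trunc (1 :: 'a padic_int) 1" by simp
    thus False
      using prime_gt_1_nat[OF prime_card[where 'a = 'a]]
      by (simp add: zero_padic_int.rep_eq one_padic_int.rep_eq)
  qed
qed

end

lemma padic_trunc_bounds: "padic_trunc (x :: 'p :: prime_card padic_int) n \<in> {0..<int CARD('p) ^ n}"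
  and padic_trunc_Suc: "padic_trunc x (Suc n) mod int CARD('p) ^ n = padic_trunc x n"
  using padic_trunc[of x] by auto

lemma padic_trunc_add_mod:
  "padic_trunc (x :: 'p :: prime_card padic_int) (n + k) mod int CARD('p) ^ n = padic_trunc x n"
proof (induction k)
  case 0
  thus ?case using padic_trunc_bounds[of x n] by simp
next
  case (Suc k)
  have "padic_trunc x (n + Suc k) mod int CARD('p) ^ n
      = (padic_trunc x (Suc (n + k)) mod int CARD('p) ^ (n + k)) mod int CARD('p) ^ n"
    by (simp add: mod_mod_cancel le_imp_power_dvd)
  thus ?case using Suc by (simp add: padic_trunc_Suc)
qed

lemma padic_trunc_of_nat: "padic_trunc (of_nat m :: 'p :: prime_card padic_int) n = int m mod int CARD('p) ^ n"
  by (induction m)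
     (auto simp: zero_padic_int.rep_eq one_padic_int.rep_eq plus_padic_int.rep_eq mod_simps)

lemma padic_trunc_of_int: "padic_trunc (of_int m :: 'p :: prime_card padic_int) n = m mod int CARD('p) ^ n"
  by (cases m rule: int_cases2)
     (auto simp: padic_trunc_of_nat uminus_padic_int.rep_eq mod_simps)

lemma padic_int_eqI: "(\<And>n. padic_trunc x n = padic_trunc y n) \<Longrightarrow> x = y"
  by (simp add: padic_trunc_inject[symmetric] fun_eq_iff)

lemma power_p_dvd_iff:
  fixes x :: "'p :: prime_card padic_int"
  shows "of_nat CARD('p) ^ n dvd x \<longleftrightarrow> padic_trunc x n = 0"
proof
  assume "of_nat CARD('p) ^ n dvd x"
  then obtain y where y: "x = of_nat (CARD('p) ^ n) * y" by auto
  show "padic_trunc x n = 0"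
    unfolding y times_padic_int.rep_eq padic_trunc_of_nat by simp
next
  let ?P = "int CARD('p)"
  assume 0: "padic_trunc x n = 0"
  define f where "f k = padic_trunc x (n + k) div ?P ^ n" for k
  have dvd: "?P ^ n dvd padic_trunc x (n + k)" for k
    using padic_trunc_add_mod[of x n k] 0 by auto
  have f: "padic_trunc x (n + k) = ?P ^ n * f k" for k
    using dvd[of k] by (simp add: f_def)
  have bounds: "f k \<in> {0..<?P ^ k}" for k
  proof -
    have pos: "?P ^ n > 0" by simp
    have "0 \<le> ?P ^ n * f k" "?P ^ n * f k < ?P ^ n * ?P ^ k"
      using padic_trunc_bounds[of x "n + k"] unfolding f power_add by auto
    thus ?thesis
      using mult_le_cancel_left_pos[OF pos, of 0 "f k"] mult_less_cancel_left_pos[OF pos, of "f k" "?P ^ k"]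
      by simp
  qed
  have coh: "f (Suc k) mod ?P ^ k = f k" for k
  proof -
    have "?P ^ n * (f (Suc k) mod ?P ^ k) = (?P ^ n * f (Suc k)) mod ?P ^ (n + k)"
      by (simp only: mult_mod_right power_add)
    also have "\<dots> = ?P ^ n * f k"
      using padic_trunc_Suc[of x "n + k"] by (simp only: f[symmetric] add_Suc_right)
    finally have "?P ^ n * (f (Suc k) mod ?P ^ k) = ?P ^ n * f k" .
    moreover have "?P ^ n \<noteq> 0" by simp
    ultimately show ?thesis using mult_left_cancel by blast
  qed
  define y :: "'p padic_int" where "y = Abs_padic_int f"
  have y: "padic_trunc y = f"
    unfolding y_def by (rule Abs_padic_int_inverse) (use bounds coh in auto)
  have "x = of_nat (CARD('p) ^ n) * y"
  proof (rule padic_int_eqI)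
    fix k
    have "padic_trunc x k = padic_trunc x (k + n) mod ?P ^ k"
      by (simp add: padic_trunc_add_mod)
    also have "\<dots> = (?P ^ n * f k) mod ?P ^ k"
      using f[of k] by (simp add: add.commute)
    finally show "padic_trunc x k = padic_trunc (of_nat (CARD('p) ^ n) * y) k"
      by (simp add: times_padic_int.rep_eq padic_trunc_of_nat y mod_simps del: of_nat_power)
         (simp add: mod_simps)
  qed
  thus "of_nat CARD('p) ^ n dvd x" by simp
qed

instance padic_int :: (prime_card) idom
proof
  fix x y :: "'a padic_int"
  let ?P = "int CARD('a)"
  assume "x \<noteq> 0" "y \<noteq> 0"
  then obtain n m where n: "padic_trunc x n \<noteq> 0" and m: "padic_trunc y m \<noteq> 0"
    using padic_int_eqI[of x 0] padic_int_eqI[of y 0] by (auto simp: zero_padic_int.rep_eq)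
  have *: "\<not> ?P ^ n dvd padic_trunc x (n + m)" "\<not> ?P ^ m dvd padic_trunc y (n + m)"
    using padic_trunc_add_mod[of x n m] padic_trunc_add_mod[of y m n] n m
    by (auto simp: dvd_eq_mod_eq_0 add.commute)
  have "\<not> ?P ^ (n + m) dvd padic_trunc x (n + m) * padic_trunc y (n + m)"
    (is "\<not> _ dvd ?a * ?b")
  proof
    assume d: "?P ^ (n + m) dvd ?a * ?b"
    have pr: "prime ?P" using prime_card[where 'a = 'a] by simp
    have nz: "?a \<noteq> 0" "?b \<noteq> 0" using * by auto
    have "n + m \<le> multiplicity ?P (?a * ?b)"
      using d nz pr by (intro multiplicity_geI) auto
    also have "\<dots> = multiplicity ?P ?a + multiplicity ?P ?b"
      using pr nz by (intro prime_elem_multiplicity_mult_distrib) auto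
    finally have "n \<le> multiplicity ?P ?a \<or> m \<le> multiplicity ?P ?b" by linarith
    thus False using * multiplicity_dvd' by blast
  qed
  hence "padic_trunc (x * y) (n + m) \<noteq> 0"
    by (simp add: times_padic_int.rep_eq dvd_eq_mod_eq_0)
  thus "x * y \<noteq> 0" by (auto simp: zero_padic_int.rep_eq)
qed

instance padic_int :: (prime_card) ring_char_0
proof
  show "inj (of_nat :: nat \<Rightarrow> 'a padic_int)"
  proof (rule injI)
    fix m n :: nat
    assume eq: "(of_nat m :: 'a padic_int) = of_nat n"
    define k where "k = m + n"
    have "CARD('a) \<ge> 2" using prime_ge_2_nat[OF prime_card[where 'a = 'a]] .
    hence "k < CARD('a) ^ k" by (intro power_gt_expt) auto
    hence "int m < int CARD('a) ^ k" "int n < int CARD('a) ^ k"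
      by (simp_all add: k_def flip: of_nat_power)
    hence "padic_trunc (of_nat m :: 'a padic_int) k = int m"
          "padic_trunc (of_nat n :: 'a padic_int) k = int n"
      by (simp_all only: padic_trunc_of_nat mod_pos_pos_trivial of_nat_0_le_iff)
    thus "m = n" unfolding eq by simp
  qed
qed

text \<open>\<open>\<langle>x\<rangle>\<^sub>p\<close>: the representative of \<open>x\<close> modulo \<open>p\<close> in \<open>{0,\<dots>,p-1}\<close>.\<close>

definition padic_residue :: "'p :: prime_card padic_int \<Rightarrow> int" where
  "padic_residue x = (THE r. r \<in> {0..<int CARD('p)} \<and> of_nat CARD('p) dvd x - of_int r)"

lemma padic_residue_ex1:
  "\<exists>!r. r \<in> {0..<int CARD('p)} \<and> of_nat CARD('p) dvd (x :: 'p :: prime_card padic_int) - of_int r"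
proof -
  have *: "of_nat CARD('p) dvd x - of_int r \<longleftrightarrow> padic_trunc x 1 = r" if "r \<in> {0..<int CARD('p)}" for r
  proof -
    have "of_nat CARD('p) dvd x - of_int r \<longleftrightarrow> (padic_trunc x 1 - r) mod int CARD('p) = 0"
      using power_p_dvd_iff[of 1 "x - of_int r"]
      by (simp add: minus_padic_int.rep_eq padic_trunc_of_int mod_simps)
    also have "\<dots> \<longleftrightarrow> padic_trunc x 1 mod int CARD('p) = r mod int CARD('p)"
      by (metis mod_eq_dvd_iff dvd_eq_mod_eq_0)
    finally show ?thesis using padic_trunc_bounds[of x 1] that by simp
  qed
  show ?thesis
    using padic_trunc_bounds[of x 1] * by (intro ex1I[of _ "padic_trunc x 1"]) auto
qed

section \<open>The $p$-adic topology and Morita's gamma function\<close>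

instantiation padic_int :: (prime_card) t2_space
begin

definition open_padic_int :: "'a padic_int set \<Rightarrow> bool" where
  "open_padic_int U \<longleftrightarrow> (\<forall>x\<in>U. \<exists>n. \<forall>y. of_nat CARD('a) ^ n dvd y - x \<longrightarrow> y \<in> U)"

instance
proof
  show "open (UNIV :: 'a padic_int set)"
    by (simp add: open_padic_int_def)
  show "open (S \<inter> T)" if "open S" "open T" for S T :: "'a padic_int set"
    unfolding open_padic_int_def
  proof
    fix x assume "x \<in> S \<inter> T"
    then obtain n m where
      "\<And>y. of_nat CARD('a) ^ n dvd y - x \<Longrightarrow> y \<in> S" "\<And>y. of_nat CARD('a) ^ m dvd y - x \<Longrightarrow> y \<in> T"
      using \<open>open S\<close> \<open>open T\<close> unfolding open_padic_int_def by blast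
    thus "\<exists>n. \<forall>y. of_nat CARD('a) ^ n dvd y - x \<longrightarrow> y \<in> S \<inter> T"
      by (intro exI[of _ "max n m"]) (meson IntI dvd_trans le_imp_power_dvd max.cobounded1 max.cobounded2)
  qed
  show "open (\<Union>K)" if "\<forall>S\<in>K. open S" for K :: "'a padic_int set set"
    unfolding open_padic_int_def
  proof
    fix x assume "x \<in> \<Union>K"
    then obtain S where S: "S \<in> K" "x \<in> S" by blast
    with that have "\<exists>n. \<forall>y. of_nat CARD('a) ^ n dvd y - x \<longrightarrow> y \<in> S"
      unfolding open_padic_int_def by blast
    thus "\<exists>n. \<forall>y. of_nat CARD('a) ^ n dvd y - x \<longrightarrow> y \<in> \<Union>K" using S by blast
  qed
  show "\<exists>U V. open U \<and> open V \<and> x \<in> U \<and> y \<in> V \<and> U \<inter> V = {}" if "x \<noteq> y" for x y :: "'a padic_int"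
  proof -
    have "\<exists>n. padic_trunc x n \<noteq> padic_trunc y n"
      using that padic_int_eqI[of x y] by blast
    then obtain n where n: "padic_trunc x n \<noteq> padic_trunc y n" ..
    define B where "B z = {w :: 'a padic_int. of_nat CARD('a) ^ n dvd w - z}" for z
    have "open (B z)" for z
      unfolding open_padic_int_def
    proof
      fix w assume w: "w \<in> B z"
      show "\<exists>n. \<forall>y. of_nat CARD('a) ^ n dvd y - w \<longrightarrow> y \<in> B z"
      proof (intro exI[of _ n] allI impI)
        fix y assume "of_nat CARD('a) ^ n dvd y - w"
        hence "of_nat CARD('a) ^ n dvd (y - w) + (w - z)"
          using w unfolding B_def by (intro dvd_add) auto
        thus "y \<in> B z" by (simp add: B_def)
      qed
    qed
    moreover have "B x \<inter> B y = {}"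
    proof (rule ccontr)
      assume "B x \<inter> B y \<noteq> {}"
      then obtain w where "of_nat CARD('a) ^ n dvd w - x" "of_nat CARD('a) ^ n dvd w - y"
        by (auto simp: B_def)
      hence "of_nat CARD('a) ^ n dvd (w - y) - (w - x)" by (rule dvd_diff[rotated])
      hence "of_nat CARD('a) ^ n dvd x - y" by simp
      hence "(padic_trunc x n - padic_trunc y n) mod int CARD('a) ^ n = 0"
        by (simp add: power_p_dvd_iff minus_padic_int.rep_eq)
      hence "padic_trunc x n mod int CARD('a) ^ n = padic_trunc y n mod int CARD('a) ^ n"
        by (metis mod_eq_dvd_iff dvd_eq_mod_eq_0)
      thus False using n padic_trunc_bounds[of x n] padic_trunc_bounds[of y n] by simp
    qed
    moreover have "z \<in> B z" for z by (simp add: B_def)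
    ultimately show ?thesis by (intro exI[of _ "B x"] exI[of _ "B y"] conjI)
  qed
qed

end

text \<open>
  The continuous extension is unique because the natural numbers are dense, and it exists
  for odd \<open>p\<close> by Wilson's theorem modulo prime powers; both are proved below.
\<close>

definition morita_nat :: "nat \<Rightarrow> nat \<Rightarrow> int" where
  "morita_nat p n = (-1) ^ n * (\<Prod>j | 1 \<le> j \<and> j < n \<and> \<not> p dvd j. int j)"

definition unit_factor_nat :: "nat \<Rightarrow> nat \<Rightarrow> int" where
  "unit_factor_nat p j = (if p dvd j then 1 else int j)"

lemma morita_nat_Suc: "morita_nat p (Suc n) = - unit_factor_nat p n * morita_nat p n"
proof (cases "p dvd n")
  case True
  hence "{j. 1 \<le> j \<and> j < Suc n \<and> \<not> p dvd j} = {j. 1 \<le> j \<and> j < n \<and> \<not> p dvd j}"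
    by (auto simp: less_Suc_eq)
  thus ?thesis using True by (simp add: morita_nat_def unit_factor_nat_def)
next
  case False
  hence "n > 0" by (cases "n = 0") auto
  hence "{j. 1 \<le> j \<and> j < Suc n \<and> \<not> p dvd j} = insert n {j. 1 \<le> j \<and> j < n \<and> \<not> p dvd j}"
    using False by (auto simp: less_Suc_eq)
  thus ?thesis using False by (simp add: morita_nat_def unit_factor_nat_def)
qed

lemma morita_nat_add:
  "morita_nat p (n + k) = (-1) ^ k * (\<Prod>j\<in>{n..<n + k}. unit_factor_nat p j) * morita_nat p n"
proof (induction k)
  case (Suc k)
  have "(\<Prod>j\<in>{n..<n + Suc k}. unit_factor_nat p j)
      = (\<Prod>j\<in>{n..<n + k}. unit_factor_nat p j) * unit_factor_nat p (n + k)"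
    by simp
  thus ?case using Suc by (simp only: add_Suc_right morita_nat_Suc power_Suc) simp
qed simp

lemma wilson_prime_power:
  assumes p: "prime p" "odd p" and m: "m > 0"
  shows "[(\<Prod>k\<in>totatives (p ^ m). int k) = -1] (mod int (p ^ m))"
proof -
  define q where "q = p ^ m"
  have p2: "p > 2" using p prime_ge_2_nat[of p] by (cases "p = 2") auto
  have q2: "q > 2"
    unfolding q_def using p2 m self_le_power[of p m] by linarith
  obtain g where "\<forall>k>0. residue_primroot (p ^ k) g"
    using residue_primroot_odd_prime_power_exists[OF p] by blast
  hence g: "residue_primroot q g" using m by (simp add: q_def)
  have ord: "ord q g = totient q" using g by (simp add: residue_primroot_def)
  obtain h where h: "totient q = 2 * h" using totient_even[OF q2] by (auto elim: evenE)
  have h0: "h > 0" using h q2 totient_gt_0_iff[of q] by (cases h) auto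
  define t where "t = int g ^ h"
  have "[g ^ (2 * h) = 1] (mod q)" using ord h ord_divides[of g "2 * h" q] by simp
  hence "[int (g ^ (2 * h)) = int 1] (mod int q)" by (simp only: cong_int_iff)
  hence "[t * t = 1] (mod int q)" by (simp add: t_def mult_2 power_add)
  hence dvd: "int q dvd (t - 1) * (t + 1)"
    by (simp add: cong_iff_dvd_diff algebra_simps)
  have "\<not> [g ^ h = 1] (mod q)" using ord h h0 ord_minimal[of h q g] by simp
  hence "\<not> [int (g ^ h) = int 1] (mod int q)" by (simp only: cong_int_iff not_False_eq_True)
  hence ndvd: "\<not> int q dvd t - 1" by (simp add: t_def cong_iff_dvd_diff)
  have pr: "prime (int p)" using p by simp
  have "\<not> int p dvd t - 1"
  proof
    assume d1: "int p dvd t - 1"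
    have "\<not> int p dvd t + 1"
    proof
      assume "int p dvd t + 1"
      hence "int p dvd (t + 1) - (t - 1)" using d1 by (rule dvd_diff)
      hence "int p dvd 2" by simp
      hence "int p \<le> 2" by (rule zdvd_imp_le) simp
      thus False using p2 by simp
    qed
    hence "coprime (int q) (t + 1)"
      using pr by (simp add: q_def prime_imp_coprime)
    hence "int q dvd t - 1" using dvd by (simp add: coprime_dvd_mult_left_iff)
    thus False using ndvd by blast
  qed
  hence "coprime (int q) (t - 1)"
    using pr by (simp add: q_def prime_imp_coprime)
  hence "int q dvd t + 1" using dvd by (simp add: coprime_dvd_mult_right_iff)
  hence t: "[t = -1] (mod int q)" by (simp add: cong_iff_dvd_diff)
  have "[(\<Prod>k\<in>totatives q. int k) = (\<Prod>i<totient q. int (g ^ i mod q))] (mod int q)"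
    using prod.reindex_bij_betw[OF residue_primroot_is_generator[OF _ g], of int] q2 by simp
  also have "[(\<Prod>i<totient q. int (g ^ i mod q)) = (\<Prod>i<totient q. int g ^ i)] (mod int q)"
    by (rule cong_prod) (simp add: cong_def zmod_int)
  also have "(\<Prod>i<totient q. int g ^ i) = int g ^ (\<Sum>i<totient q. i)"
    by (simp add: power_sum)
  also have "(\<Sum>i<totient q. i) = h * (2 * h - 1)"
    unfolding h by (simp add: Sum_Ico_nat lessThan_atLeast0)
  also have "int g ^ \<dots> = t ^ (2 * h - 1)" by (simp add: t_def power_mult)
  also have "[\<dots> = (-1) ^ (2 * h - 1)] (mod int q)" by (intro cong_pow t)
  also have "(-1 :: int) ^ (2 * h - 1) = -1" using h0 by simp
  finally show ?thesis by (simp add: q_def)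
qed

lemma prod_unit_factor_cong:
  assumes p: "prime p" "odd p" and m: "m > 0"
  shows "[(\<Prod>j\<in>{n..<n + p ^ m}. unit_factor_nat p j) = -1] (mod int (p ^ m))"
proof (induction n)
  case 0
  have "(\<Prod>j\<in>{0..<p ^ m}. unit_factor_nat p j) = (\<Prod>k\<in>totatives (p ^ m). int k)"
  proof (rule prod.mono_neutral_cong_right)
    have *: "coprime j (p ^ m) \<longleftrightarrow> \<not> p dvd j" for j
    proof
      show "\<not> p dvd j" if "coprime j (p ^ m)"
        using that m p(1) by (auto simp: coprime_commute[of _ p] dest: not_coprimeI[of p p j])
      show "coprime j (p ^ m)" if "\<not> p dvd j"
        using prime_imp_coprime[OF p(1) that] by (simp add: coprime_commute)
    qed
    have *: "j \<in> totatives (p ^ m) \<longleftrightarrow> j < p ^ m \<and> \<not> p dvd j" for j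
    proof -
      have "j \<noteq> 0" if "\<not> p dvd j" using that by (cases "j = 0") simp_all
      moreover have "p dvd p ^ m" using m by (rule dvd_power[OF disjI1])
      hence "j \<noteq> p ^ m" if "\<not> p dvd j" using that by blast
      ultimately show ?thesis unfolding in_totatives_iff * by auto
    qed
    show "totatives (p ^ m) \<subseteq> {0..<p ^ m}"
      using * by (simp add: subset_iff)
    show "\<forall>i\<in>{0..<p ^ m} - totatives (p ^ m). unit_factor_nat p i = 1"
      using * by (simp add: unit_factor_nat_def)
    show "unit_factor_nat p x = int x" if "x \<in> totatives (p ^ m)" for x
      using that * by (simp add: unit_factor_nat_def)
  qed simp
  thus ?case using wilson_prime_power[OF p m] by simp
next
  case (Suc n)
  let ?u = "unit_factor_nat p" and ?q = "p ^ m"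
  have q0: "?q > 0" using prime_gt_0_nat[OF p(1)] by simp
  have "?u n * (\<Prod>j\<in>{Suc n..<Suc n + ?q}. ?u j) = (\<Prod>j\<in>{n..<Suc (n + ?q)}. ?u j)"
    using q0 by (subst prod.atLeast_Suc_lessThan[of n]) auto
  also have "\<dots> = (\<Prod>j\<in>{n..<n + ?q}. ?u j) * ?u (n + ?q)"
    by simp
  also have "[\<dots> = -1 * ?u n] (mod int ?q)"
  proof (intro cong_mult Suc.IH)
    have "p dvd n + ?q \<longleftrightarrow> p dvd n" using m by (simp add: dvd_add_left_iff)
    thus "[?u (n + ?q) = ?u n] (mod int ?q)"
      by (simp add: unit_factor_nat_def cong_def)
  qed
  finally have "[?u n * (\<Prod>j\<in>{Suc n..<Suc n + ?q}. ?u j) = ?u n * -1] (mod int ?q)"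
    by (simp add: mult.commute)
  moreover have "coprime (?u n) (int ?q)"
    using prime_imp_coprime[OF p(1), of n]
    by (simp add: unit_factor_nat_def coprime_commute[of n])
  ultimately show ?case by (simp only: cong_mult_lcancel)
qed

lemma morita_nat_cong:
  assumes p: "prime p" "odd p"
  shows "[morita_nat p (n + k * p ^ m) = morita_nat p n] (mod int (p ^ m))"
proof (cases "m = 0")
  case False
  have step: "[morita_nat p (n + p ^ m) = morita_nat p n] (mod int (p ^ m))" for n
  proof -
    have "[morita_nat p (n + p ^ m) = (-1) ^ (p ^ m) * (-1) * morita_nat p n] (mod int (p ^ m))"
      unfolding morita_nat_add using False
      by (intro cong_mult cong_refl prod_unit_factor_cong p) auto
    thus ?thesis using p by simp
  qed
  show ?thesis
  proof (induction k)
    case (Suc k)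
    have "[morita_nat p (n + k * p ^ m + p ^ m) = morita_nat p (n + k * p ^ m)] (mod int (p ^ m))"
      by (rule step)
    from cong_trans[OF this Suc] show ?case by (simp add: algebra_simps)
  qed simp
qed (simp add: cong_def)

definition is_morita_Gamma :: "('p :: prime_card padic_int \<Rightarrow> 'p padic_int) \<Rightarrow> bool" where
  "is_morita_Gamma f \<longleftrightarrow> continuous_on UNIV f \<and> f 0 = 1 \<and>
     (\<forall>n\<ge>1. f (of_nat n) = of_int (morita_nat CARD('p) n))"

definition morita_Gamma :: "'p :: prime_card padic_int \<Rightarrow> 'p padic_int" where
  "morita_Gamma = (THE f. is_morita_Gamma f)"

lemma is_morita_Gamma_unique:
  assumes "is_morita_Gamma f" "is_morita_Gamma (g :: 'p :: prime_card padic_int \<Rightarrow> 'p padic_int)"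
  shows "f = g"
proof (rule ccontr)
  assume "f \<noteq> g"
  then obtain x where x: "f x \<noteq> g x" by auto
  have agree: "f (of_nat n) = g (of_nat n)" for n
    using assms by (cases "n = 0") (auto simp: is_morita_Gamma_def)
  have "open {x. f x \<noteq> g x}"
    using assms by (intro open_Collect_neq) (auto simp: is_morita_Gamma_def)
  then obtain n where n: "\<And>y. of_nat CARD('p) ^ n dvd y - x \<Longrightarrow> f y \<noteq> g y"
    using x by (auto simp: open_padic_int_def)
  define k where "k = nat (padic_trunc x n)"
  have "int k = padic_trunc x n" using padic_trunc_bounds[of x n] by (simp add: k_def)
  hence "of_nat CARD('p) ^ n dvd of_nat k - x"
    using padic_trunc_bounds[of x n]
    by (simp add: power_p_dvd_iff minus_padic_int.rep_eq padic_trunc_of_nat)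
  thus False using n agree by blast
qed

lemma is_morita_Gamma_exists:
  assumes odd: "odd CARD('p :: prime_card)"
  shows "\<exists>f :: 'p padic_int \<Rightarrow> 'p padic_int. is_morita_Gamma f"
proof -
  let ?p = "CARD('p)"
  let ?G = "morita_nat ?p"
  define F :: "'p padic_int \<Rightarrow> nat \<Rightarrow> int"
    where "F x m = ?G (nat (padic_trunc x m)) mod int ?p ^ m" for x m
  define f :: "'p padic_int \<Rightarrow> 'p padic_int" where "f x = Abs_padic_int (F x)" for x
  have cong: "?G a mod int ?p ^ m = ?G b mod int ?p ^ m" if "[a = b] (mod ?p ^ m)" for a b m
  proof -
    have *: "?G a mod int ?p ^ m = ?G (a mod ?p ^ m) mod int ?p ^ m" for a
      using morita_nat_cong[OF prime_card odd, of "a mod ?p ^ m" "a div ?p ^ m" m]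
      unfolding mod_div_mult_eq cong_def of_nat_power .
    show ?thesis
      by (rule trans[OF *[of a] trans[OF _ *[of b, symmetric]]]) (simp only: that[unfolded cong_def])
  qed
  have coh: "F x (Suc m) mod int ?p ^ m = F x m" for x m
  proof -
    have "int (nat (padic_trunc x (Suc m)) mod ?p ^ m) = int (nat (padic_trunc x m))"
      using padic_trunc_Suc[of x m] padic_trunc_bounds[of x m] padic_trunc_bounds[of x "Suc m"]
      by (simp add: zmod_int)
    hence "nat (padic_trunc x (Suc m)) mod ?p ^ m = nat (padic_trunc x m)" by linarith
    hence "[nat (padic_trunc x (Suc m)) = nat (padic_trunc x m)] (mod ?p ^ m)"
      by (metis cong_def mod_mod_trivial)
    from cong[OF this] show ?thesis by (simp add: F_def mod_power_Suc_mod del: power_Suc)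
  qed
  have f: "padic_trunc (f x) m = F x m" for x m
  proof -
    have "F x n \<in> {0..<int ?p ^ n}" for n by (simp add: F_def)
    hence "F x \<in> {x. \<forall>n. x n \<in> {0..<int ?p ^ n} \<and> x (Suc n) mod int ?p ^ n = x n}"
      using coh by blast
    hence "padic_trunc (f x) = F x" unfolding f_def by (rule Abs_padic_int_inverse)
    thus ?thesis by (rule fun_cong)
  qed
  have nat: "f (of_nat n) = of_int (?G n)" for n
  proof (rule padic_int_eqI)
    fix m
    have *: "padic_trunc (of_nat n :: 'p padic_int) m = int (n mod ?p ^ m)"
      by (simp only: padic_trunc_of_nat zmod_int of_nat_power)
    have "[n mod ?p ^ m = n] (mod ?p ^ m)" by (simp only: cong_def mod_mod_trivial)
    from cong[OF this] show "padic_trunc (f (of_nat n)) m = padic_trunc (of_int (?G n) :: 'p padic_int) m"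
      by (simp only: f F_def * nat_int padic_trunc_of_int)
  qed
  have "continuous_on UNIV f"
    unfolding continuous_on_open_vimage[OF open_UNIV]
  proof (intro allI impI)
    fix B :: "'p padic_int set"
    assume B: "open B"
    show "open (f -` B \<inter> UNIV)"
      unfolding open_padic_int_def
    proof
      fix x assume "x \<in> f -` B \<inter> UNIV"
      then obtain n where n: "\<And>y. of_nat ?p ^ n dvd y - f x \<Longrightarrow> y \<in> B"
        using B by (auto simp: open_padic_int_def)
      have "f y \<in> B" if "of_nat ?p ^ n dvd y - x" for y
      proof -
        have "(padic_trunc y n - padic_trunc x n) mod int ?p ^ n = 0"
          using that by (simp add: power_p_dvd_iff minus_padic_int.rep_eq)
        hence "padic_trunc y n mod int ?p ^ n = padic_trunc x n mod int ?p ^ n"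
          by (metis mod_eq_dvd_iff dvd_eq_mod_eq_0)
        hence "padic_trunc y n = padic_trunc x n"
          using padic_trunc_bounds[of x n] padic_trunc_bounds[of y n] by simp
        hence "of_nat ?p ^ n dvd f y - f x"
          by (simp add: power_p_dvd_iff minus_padic_int.rep_eq f F_def)
        thus ?thesis by (rule n)
      qed
      thus "\<exists>n. \<forall>y. of_nat ?p ^ n dvd y - x \<longrightarrow> y \<in> f -` B \<inter> UNIV" by auto
    qed
  qed
  moreover have "f 0 = 1" using nat[of 0] by (simp add: morita_nat_def)
  ultimately show ?thesis using nat unfolding is_morita_Gamma_def by blast
qed

lemma is_morita_Gamma_morita_Gamma:
  assumes "odd CARD('p :: prime_card)"
  shows "is_morita_Gamma (morita_Gamma :: 'p padic_int \<Rightarrow> 'p padic_int)"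
proof -
  obtain f :: "'p padic_int \<Rightarrow> 'p padic_int" where f: "is_morita_Gamma f"
    using is_morita_Gamma_exists[OF assms] ..
  show ?thesis
    unfolding morita_Gamma_def by (rule theI[where P = is_morita_Gamma, OF f], rule is_morita_Gamma_unique[OF _ f])
qed

section \<open>The field of $p$-adic numbers\<close>

type_synonym 'p padic = "'p padic_int fract"

text \<open>The embedding of the \<open>p\<close>-adic integers into the \<open>p\<close>-adic numbers is \<^const>\<open>to_fract\<close>.\<close>

lemma of_nat_fract_eq: "(of_nat n :: 'a :: idom fract) = to_fract (of_nat n)"
  by (induction n) auto

instance fract :: ("{idom, ring_char_0}") field_char_0
proof
  show "inj (of_nat :: nat \<Rightarrow> 'a fract)"
    by (rule injI) (simp add: of_nat_fract_eq)
qed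

text \<open>\<open>x \<equiv> y (mod p\<^sup>m)\<close> in the \<open>p\<close>-adic numbers: \<open>x - y\<close> lies in \<open>p\<^sup>m\<close> times the \<open>p\<close>-adic integers.\<close>

definition padic_cong :: "nat \<Rightarrow> 'p :: prime_card padic \<Rightarrow> 'p padic \<Rightarrow> bool" where
  "padic_cong m x y \<longleftrightarrow> (\<exists>z :: 'p padic_int. x - y = of_nat CARD('p) ^ m * to_fract z)"

section \<open>Truncated hypergeometric series\<close>

text \<open>
  The factor \<open>k!\<close> is not among the lower parameters \<open>bs\<close>; the series is \<open>\<^sub>m\<^sub>+\<^sub>1F\<^sub>m\<close> if
  \<open>as\<close> and \<open>bs\<close> have lengths \<open>m + 1\<close> and \<open>m\<close>.
\<close>

definition trunc_hypergeom :: "'a :: field_char_0 list \<Rightarrow> 'a list \<Rightarrow> 'a \<Rightarrow> nat \<Rightarrow> 'a" where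
  "trunc_hypergeom as bs z n =
     (\<Sum>k\<le>n. (\<Prod>a\<leftarrow>as. pochhammer a k) / (\<Prod>b\<leftarrow>bs. pochhammer b k) * (z ^ k / fact k))"

text \<open>
  The same series with the additional upper parameter \<open>1 + c/2\<close> and the additional lower
  parameter \<open>c/2\<close>, where the ratio \<open>(1 + c/2)\<^sub>k / (c/2)\<^sub>k\<close> is read as \<open>(c/2 + k) / (c/2)\<close>.
  The two agree as long as \<open>(c/2)\<^sub>k \<noteq> 0\<close>; but \<open>(c/2)\<^sub>k\<close> vanishes when \<open>c\<close> is one of
  \<open>0, -2, \<dots>, -2(k-1)\<close>, and there division by zero in HOL would give the wrong summand.
\<close>

definition vwp_trunc_hypergeom ::
    "'a :: field_char_0 \<Rightarrow> 'a list \<Rightarrow> 'a list \<Rightarrow> 'a \<Rightarrow> nat \<Rightarrow> 'a" where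
  "vwp_trunc_hypergeom c as bs z n =
     (\<Sum>k\<le>n. (c / 2 + of_nat k) / (c / 2) *
        ((\<Prod>a\<leftarrow>as. pochhammer a k) / (\<Prod>b\<leftarrow>bs. pochhammer b k)) * (z ^ k / fact k))"

lemma pochhammer_ratio_Suc:
  fixes x :: "'a :: field_char_0"
  assumes "pochhammer x k \<noteq> 0" "x \<noteq> 0"
  shows "pochhammer (1 + x) k / pochhammer x k = (x + of_nat k) / x"
proof -
  have "x * pochhammer (1 + x) k = pochhammer x k * (x + of_nat k)"
    by (metis add.commute pochhammer_rec pochhammer_Suc)
  thus ?thesis using assms by (simp add: field_simps)
qed

lemma vwp_trunc_hypergeom_eq:
  assumes "\<And>k. k \<le> n \<Longrightarrow> pochhammer (c / 2) k \<noteq> 0" "c \<noteq> 0"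
  shows "vwp_trunc_hypergeom c as bs z n = trunc_hypergeom ((1 + c / 2) # as) (c / 2 # bs) z n"
  unfolding vwp_trunc_hypergeom_def trunc_hypergeom_def
proof (rule sum.cong[OF refl])
  fix k assume "k \<in> {..n}"
  hence "pochhammer (1 + c / 2) k / pochhammer (c / 2) k = (c / 2 + of_nat k) / (c / 2)"
    using assms by (intro pochhammer_ratio_Suc) auto
  thus "(c / 2 + of_nat k) / (c / 2) * ((\<Prod>a\<leftarrow>as. pochhammer a k) / (\<Prod>b\<leftarrow>bs. pochhammer b k)) *
          (z ^ k / fact k) =
        (\<Prod>a\<leftarrow>(1 + c / 2) # as. pochhammer a k) / (\<Prod>b\<leftarrow>c / 2 # bs. pochhammer b k) *
          (z ^ k / fact k)"
    by (simp only: list.map prod_list.Cons times_divide_times_eq[symmetric])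
qed

end

theory Submission
  imports Defs
begin

text \<open>
  Let \<open>a\<close>, \<open>b\<close>, \<open>c\<close>, \<open>d\<close>, \<open>e\<close> be the residues of \<open>-\<alpha>\<close>, \<open>-\<beta>\<close>, \<open>-\<gamma>\<close>, \<open>-\<delta>\<close>, \<open>-\<epsilon>\<close>, and write
  \<open>\<alpha> = -a + p x\<close>, \<open>\<gamma> = -c + p y\<close>, \<open>\<delta> = -d + p z\<close>; hypothesis (iii) says that
  \<open>\<beta> = -b + p \<kappa> x\<close> with \<open>\<kappa> = b/a\<close>.  Modulo \<open>p\<^sup>2\<close> only the terms with \<open>k \<le> a\<close> of the left-hand
  series and those with \<open>k \<le> min(c, d)\<close> of the right-hand series survive.

  The difference of the two sides, with the series cut in this way, is an affine function of
  \<open>p x\<close>, \<open>p y\<close>, \<open>p z\<close> modulo \<open>p\<^sup>2\<close> with \<open>p\<close>-integral coefficients.  The terms on the left have a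
  simple pole at \<open>x = 0\<close>, because \<open>(\<alpha> - \<beta> + 1)\<^sub>k\<close> contains \<open>\<alpha> - \<beta> + a - b = (1 - \<kappa>) p x\<close>, but at
  \<open>x = 0\<close> the residues are antisymmetric under \<open>k \<mapsto> a - k\<close> and cancel.  For \<open>y = 0\<close> or \<open>z = 0\<close> the
  series terminates and Whipple's transformation shows that the difference vanishes modulo
  \<open>p\<^sup>2\<close>.  An affine function that vanishes at enough such points vanishes everywhere.
\<close>

text \<open>Whipple's transformation needs a terminating series, but \<gamma> and \<delta> agree
  with negative integers in general only modulo p; the loss is of first order in p, which is why
  affine functions modulo p^2 are the right class. Hypothesis (iii) moves \<beta> along with
  \<alpha>, so that at x = 0 both become negative integers at once, and this is what makes the
  residues at the pole antisymmetric. \<epsilon> stays fixed throughout.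

  Dividing a congruence modulo p^2 by p x would lose precision. The pole is therefore removed
  through exact difference quotients, which must themselves be affine modulo p^2.

  The constant a/(a - b) is 1/(1 - \<kappa>): in Whipple's prefactor (\<alpha> + 1)_c contains p x
  and (\<alpha> - \<beta> + 1)_c contains (1 - \<kappa>) p x, while Gamma_p skips both factors.

  The discarded terms are controlled by (ii) and (iv): a denominator can cost one factor p at most,
  and whenever it does, enough numerators are divisible by p.\<close>

section \<open>Whipple's transformation\<close>

text \<open>
  The polynomial form of \<open>(1 + a/2)\<^sub>j (a)\<^sub>j / (a/2)\<^sub>j\<close>, which makes sense for \<open>a = 0\<close> as well.
\<close>

definition vwp_weight :: "'a :: field_char_0 \<Rightarrow> nat \<Rightarrow> 'a" where
  "vwp_weight a j = pochhammer (a + 1) j + of_nat j * pochhammer (a + 1) (j - 1)"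

lemma vwp_weight_0 [simp]: "vwp_weight a 0 = 1"
  by (simp add: vwp_weight_def)

lemma vwp_weight_Suc: "vwp_weight a (Suc j) = (a + 2 * of_nat (Suc j)) * pochhammer (a + 1) j"
  by (simp add: vwp_weight_def pochhammer_Suc algebra_simps)

lemma vwp_weight_eq:
  assumes "a \<noteq> 0"
  shows "vwp_weight a j = (a / 2 + of_nat j) / (a / 2) * pochhammer a j"
  using assms by (cases j) (simp_all add: vwp_weight_Suc pochhammer_rec field_simps)

text \<open>The factor (a + k)_r of Saalschuetz's sum, with k = r + j, completes the weight at a to
  a weight at a + 2r. This keeps the inner sums after Bailey's interchange very well poised.\<close>

lemma vwp_weight_shift:
  "vwp_weight a (r + j) * pochhammer (a + of_nat (r + j)) r =
   pochhammer (a + 1) (2 * r) * vwp_weight (a + 2 * of_nat r) j"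
proof (cases "r + j")
  case 0
  thus ?thesis by simp
next
  case (Suc m)
  have *: "vwp_weight a (r + j) * pochhammer (a + of_nat (r + j)) r
      = (a + 2 * of_nat (r + j)) * pochhammer (a + 1) (m + r)"
    unfolding Suc vwp_weight_Suc pochhammer_product'[of "a + 1" m r]
    by (simp add: add_ac mult_ac)
  show ?thesis
  proof (cases j)
    case 0
    hence m: "2 * r = Suc (m + r)" using Suc by auto
    have "(of_nat r :: 'a) = of_nat m + 1" using 0 Suc by simp
    thus ?thesis unfolding * m pochhammer_Suc using 0 by (simp add: algebra_simps)
  next
    case (Suc i)
    hence m: "m + r = 2 * r + i" using \<open>r + j = Suc m\<close> by simp
    show ?thesis
      unfolding * unfolding Suc vwp_weight_Suc m pochhammer_product'[of "a + 1" "2 * r" i]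
      by (simp add: add_ac mult_ac)
  qed
qed

section \<open>Saalschuetz's summation\<close>

text \<open>
  If \<open>s k\<close> is the Saalschuetz sum, then \<open>(B + k) (C + k) s (k + 1) - (a + 1 - B + k) (a + 1 - C + k) s k\<close>
  telescopes; for \<open>m = k + 1\<close> the right-hand side below is zero.
\<close>

lemma saalschuetz_recurrence_partial:
  fixes a B C :: "'a :: field_char_0"
  defines "D \<equiv> B + C - a - 1"
  assumes "pochhammer B m \<noteq> 0" "pochhammer C m \<noteq> 0"
  shows "(\<Sum>r\<le>m. ((B + of_nat k) * (C + of_nat k) * pochhammer (- of_nat (Suc k)) r *
      pochhammer (a + of_nat (Suc k)) r
             - (a + 1 - B + of_nat k) * (a + 1 - C + of_nat k) * pochhammer (- of_nat k) r *
                 pochhammer (a + of_nat k) r)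
              * pochhammer D r / (fact r * pochhammer B r * pochhammer C r)) =
         (a + 2 * of_nat k + 1) * pochhammer (- of_nat k) m * pochhammer (a + of_nat k + 1) m
              * pochhammer D (Suc m) / (fact m * pochhammer B m * pochhammer C m)"
  using assms(2,3)
proof (induction m)
  case 0
  show ?case by (simp add: D_def) Groebner_Basis.algebra
next
  case (Suc m)
  let ?k = "of_nat k :: 'a" and ?m = "of_nat m :: 'a"
  define N where "N = fact m * pochhammer B m * pochhammer C m"
  define X where "X = pochhammer (- ?k) m * pochhammer (a + ?k + 1) m * pochhammer D (Suc m)"
  have nz: "pochhammer B m \<noteq> 0" "pochhammer C m \<noteq> 0" "B + ?m \<noteq> 0" "C + ?m \<noteq> 0"
    using Suc.prems by (auto simp: pochhammer_Suc)
  have m0: "1 + ?m \<noteq> 0" by (metis of_nat_Suc of_nat_eq_0_iff nat.distinct(1))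
  have den: "fact (Suc m) * pochhammer B (Suc m) * pochhammer C (Suc m) =
      N * ((1 + ?m) * (B + ?m) * (C + ?m))"
    by (simp add: N_def pochhammer_Suc algebra_simps)
  have e1: "pochhammer (- of_nat (Suc k)) (Suc m) = - (?k + 1) * pochhammer (- ?k) m"
    unfolding pochhammer_rec by simp
  have e2: "pochhammer (a + of_nat (Suc k)) (Suc m) = pochhammer (a + ?k + 1) m * (a + ?k + 1 + ?m)"
    unfolding pochhammer_Suc by (simp add: algebra_simps)
  have e3: "pochhammer (- ?k) (Suc m) = pochhammer (- ?k) m * (?m - ?k)"
    unfolding pochhammer_Suc by simp
  have e4: "pochhammer (a + ?k) (Suc m) = (a + ?k) * pochhammer (a + ?k + 1) m"
    unfolding pochhammer_rec by simp
  have e6: "pochhammer (a + ?k + 1) (Suc m) = pochhammer (a + ?k + 1) m * (a + ?k + 1 + ?m)"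
    unfolding pochhammer_Suc ..
  have e5: "pochhammer D (Suc (Suc m)) = pochhammer D (Suc m) * (D + 1 + ?m)"
    unfolding pochhammer_Suc by (simp add: algebra_simps)
  \<comment> \<open>Once the common factor \<open>X\<close> and the denominators are cleared, the
    induction step is this polynomial identity.\<close>
  have key: "(B + ?k) * (C + ?k) * (- (?k + 1)) * (a + ?k + 1 + ?m)
       - (a + 1 - B + ?k) * (a + 1 - C + ?k) * (?m - ?k) * (a + ?k)
     + (a + 2 * ?k + 1) * ((1 + ?m) * (B + ?m) * (C + ?m))
     = (a + 2 * ?k + 1) * ((?m - ?k) * (a + ?k + 1 + ?m) * (D + 1 + ?m))"
    unfolding D_def by Groebner_Basis.algebra
  have scale: "y / N = y * ((1 + ?m) * (B + ?m) * (C + ?m)) / (N * ((1 + ?m) * (B + ?m) * (C + ?m)))"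
      for y
    using nz m0 by (subst mult_divide_mult_cancel_right) auto
  note IH = Suc.IH[OF nz(1,2), folded N_def, unfolded scale[of "_ * _ * _ * _"]]
  show ?case
    unfolding sum.atMost_Suc IH[unfolded N_def] unfolding N_def[symmetric] den e1 e2 e3 e4 e5 e6
      add_divide_distrib[symmetric]
    apply (rule arg_cong2[of _ _ _ _ "(/)", OF _ refl])
    using key unfolding X_def by Groebner_Basis.algebra
qed

text \<open>The series is balanced: B + C exceeds the sum of the upper parameters -k, a + k, B + C -
  a - 1 by 1. With a + k as an upper parameter, a, B and C stay fixed in the induction on k, and the
  summands have the shape that \<open>vwp_weight_shift\<close> expects.\<close>

lemma saalschuetz:
  fixes a B C :: "'a :: field_char_0"
  assumes "pochhammer B k \<noteq> 0" "pochhammer C k \<noteq> 0"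
  shows "(\<Sum>r\<le>k. pochhammer (- of_nat k) r * pochhammer (a + of_nat k) r * pochhammer (B + C - a - 1) r /
                  (fact r * pochhammer B r * pochhammer C r)) =
         pochhammer (a + 1 - B) k * pochhammer (a + 1 - C) k / (pochhammer B k * pochhammer C k)"
  using assms
proof (induction k)
  case (Suc k)
  let ?D = "B + C - a - 1"
  define s where "s k m =
      (\<Sum>r\<le>m. pochhammer (- of_nat k) r * pochhammer (a + of_nat k) r * pochhammer ?D r /
                  (fact r * pochhammer B r * pochhammer C r))" for k m
  have nz: "pochhammer B k \<noteq> 0" "pochhammer C k \<noteq> 0" "B + of_nat k \<noteq> 0" "C + of_nat k \<noteq> 0"
    using Suc.prems by (auto simp: pochhammer_Suc)
  have IH: "s k k = pochhammer (a + 1 - B) k * pochhammer (a + 1 - C) k /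
      (pochhammer B k * pochhammer C k)"
    using Suc.IH[OF nz(1,2)] by (simp only: s_def)
  have z: "pochhammer (- of_nat k :: 'a) (Suc k) = 0"
    by (subst pochhammer_of_nat_eq_0_iff) simp
  have s: "s k (Suc k) = s k k"
    unfolding s_def by (simp add: z)
  have "(B + of_nat k) * (C + of_nat k) * s (Suc k) (Suc k)
      - (a + 1 - B + of_nat k) * (a + 1 - C + of_nat k) * s k (Suc k) =
     (\<Sum>r\<le>Suc k. ((B + of_nat k) * (C + of_nat k) * pochhammer (- of_nat (Suc k)) r *
         pochhammer (a + of_nat (Suc k)) r
             - (a + 1 - B + of_nat k) * (a + 1 - C + of_nat k) * pochhammer (- of_nat k) r *
                 pochhammer (a + of_nat k) r)
              * pochhammer ?D r / (fact r * pochhammer B r * pochhammer C r))"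
    unfolding s_def sum_distrib_left sum_subtractf[symmetric]
    by (intro sum.cong refl) (simp add: left_diff_distrib diff_divide_distrib mult.assoc del: of_nat_Suc)
  also have "\<dots> = 0"
    unfolding saalschuetz_recurrence_partial[OF Suc.prems] z by simp
  finally have "s (Suc k) (Suc k) =
      (a + 1 - B + of_nat k) * (a + 1 - C + of_nat k) * s k k / ((B + of_nat k) * (C + of_nat k))"
    unfolding s
    by (subst nonzero_eq_divide_eq) (use nz in \<open>auto simp: mult_ac\<close>)
  also have "\<dots> = pochhammer (a + 1 - B) (Suc k) * pochhammer (a + 1 - C) (Suc k) /
      (pochhammer B (Suc k) * pochhammer C (Suc k))"
    unfolding IH by (simp add: pochhammer_Suc mult_ac)
  finally show ?case unfolding s_def .
qed simp

section \<open>Bailey's interchange and the very-well-poised sums\<close>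

lemma pochhammer_minus_of_nat:
  assumes "r \<le> k"
  shows "pochhammer (- of_nat k :: 'a :: field_char_0) r = (-1) ^ r * fact k / fact (k - r)"
proof -
  have "pochhammer 1 (k - r + r) = pochhammer 1 (k - r) * pochhammer (1 + of_nat (k - r) :: 'a) r"
    by (rule pochhammer_product')
  hence "fact k = fact (k - r) * pochhammer (1 + of_nat (k - r) :: 'a) r"
    using assms by (simp add: pochhammer_fact)
  moreover have "of_nat k - of_nat r + 1 = (1 + of_nat (k - r) :: 'a)"
    using assms by (simp add: of_nat_diff)
  ultimately show ?thesis by (simp add: pochhammer_minus add.commute)
qed

text \<open>
  Bailey's method: expand the quotient of Pochhammer symbols by Saalschuetz's formula and
  interchange the summations.
\<close>

lemma bailey_interchange:
  fixes a b c :: "'a :: field_char_0"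
  assumes "pochhammer (a - b + 1) n \<noteq> 0" "pochhammer (a - c + 1) n \<noteq> 0"
  shows "(\<Sum>k\<le>n. vwp_weight a k / fact k *
            (pochhammer b k * pochhammer c k / (pochhammer (a - b + 1) k * pochhammer (a - c + 1) k))
                * u k) =
         (\<Sum>r\<le>n. (-1) ^ r * pochhammer (a - b - c + 1) r * pochhammer (a + 1) (2 * r) /
            (fact r * pochhammer (a - b + 1) r * pochhammer (a - c + 1) r) *
            (\<Sum>j\<le>n - r. vwp_weight (a + 2 * of_nat r) j / fact j * u (r + j)))"
proof -
  let ?B = "a - b + 1" and ?C = "a - c + 1" and ?D = "a - b - c + 1"
  define g where "g r j = (-1) ^ r * pochhammer ?D r * pochhammer (a + 1) (2 * r) /
            (fact r * pochhammer ?B r * pochhammer ?C r) *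
            (vwp_weight (a + 2 * of_nat r) j / fact j * u (r + j))" for r j
  have g: "vwp_weight a (r + j) / fact (r + j) * (pochhammer (- of_nat (r + j)) r *
      pochhammer (a + of_nat (r + j)) r *
        pochhammer ?D r / (fact r * pochhammer ?B r * pochhammer ?C r)) * u (r + j) = g r j" for r j
  proof -
    have "vwp_weight a (r + j) / fact (r + j) * (pochhammer (- of_nat (r + j)) r *
        pochhammer (a + of_nat (r + j)) r *
        pochhammer ?D r / (fact r * pochhammer ?B r * pochhammer ?C r)) * u (r + j) =
      (vwp_weight a (r + j) * pochhammer (a + of_nat (r + j)) r) *
        ((-1) ^ r / fact j * pochhammer ?D r / (fact r * pochhammer ?B r * pochhammer ?C r) * u (r + j))"
      by (simp add: pochhammer_minus_of_nat del: of_nat_add)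
    thus ?thesis unfolding vwp_weight_shift g_def by (simp add: mult_ac)
  qed
  have *: "pochhammer b k * pochhammer c k / (pochhammer ?B k * pochhammer ?C k) =
      (\<Sum>r\<le>k. pochhammer (- of_nat k) r * pochhammer (a + of_nat k) r * pochhammer ?D r /
                  (fact r * pochhammer ?B r * pochhammer ?C r))" if "k \<le> n" for k
    using saalschuetz[of ?B k ?C a] pochhammer_neq_0_mono[OF assms(1) that]
      pochhammer_neq_0_mono[OF assms(2) that]
    by (simp add: algebra_simps)
  have "(\<Sum>k\<le>n. vwp_weight a k / fact k *
            (pochhammer b k * pochhammer c k / (pochhammer ?B k * pochhammer ?C k)) * u k) =
        (\<Sum>k\<le>n. \<Sum>r\<le>k. g r (k - r))"
  proof (rule sum.cong[OF refl])
    fix k assume k: "k \<in> {..n}"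
    show "vwp_weight a k / fact k * (pochhammer b k * pochhammer c k /
        (pochhammer ?B k * pochhammer ?C k)) * u k =
        (\<Sum>r\<le>k. g r (k - r))"
      unfolding *[OF k[simplified]] sum_distrib_left sum_distrib_right
    proof (rule sum.cong[OF refl])
      fix r assume "r \<in> {..k}"
      hence "r + (k - r) = k" by simp
      thus "vwp_weight a k / fact k * (pochhammer (- of_nat k) r * pochhammer (a + of_nat k) r *
          pochhammer ?D r / (fact r * pochhammer ?B r * pochhammer ?C r)) * u k = g r (k - r)"
        using g[of r "k - r"] by simp
    qed
  qed
  also have "\<dots> = (\<Sum>(r, j)\<in>{(r, j). r + j \<le> n}. g r j)"
    by (rule sum.triangle_reindex_eq[symmetric])
  also have "{(r, j). r + j \<le> n} = Sigma {..n} (\<lambda>r. {..n - r})" by auto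
  also have "(\<Sum>(r, j)\<in>\<dots>. g r j) = (\<Sum>r\<le>n. \<Sum>j\<le>n - r. g r j)"
    by (rule sum.Sigma[symmetric]) auto
  finally show ?thesis by (simp only: g_def sum_distrib_left)
qed

text \<open>The summand is Gosper summable, so every partial sum is a product. For n > 0 the factor
  (1 - n)_m is zero at m = n, which gives \<open>vwp_sum_3F2\<close>.\<close>

lemma vwp_sum_3F2_partial:
  fixes a :: "'a :: field_char_0"
  assumes "pochhammer (a + of_nat n + 1) m \<noteq> 0"
  shows "(\<Sum>j\<le>m. vwp_weight a j / fact j * (pochhammer (- of_nat n) j / pochhammer (a + of_nat n + 1)
      j)) =
         pochhammer (a + 1) m * pochhammer (1 - of_nat n) m / (fact m * pochhammer (a + of_nat n + 1) m)"
  using assms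
proof (induction m)
  case (Suc m)
  let ?m = "of_nat m :: 'a" and ?n = "of_nat n :: 'a"
  have nz: "pochhammer (a + ?n + 1) m \<noteq> 0" "a + ?n + 1 + ?m \<noteq> 0"
    using Suc.prems by (auto simp: pochhammer_Suc)
  have m0: "1 + ?m \<noteq> 0" by (metis of_nat_Suc of_nat_eq_0_iff nat.distinct(1))
  have e: "pochhammer (- ?n) (Suc m) = - ?n * pochhammer (1 - ?n) m"
    unfolding pochhammer_rec by simp
  show ?case
    unfolding sum.atMost_Suc Suc.IH[OF nz(1)] e vwp_weight_Suc unfolding pochhammer_Suc fact_Suc
    using nz m0 by (simp add: divide_simps) Groebner_Basis.algebra
qed simp

lemma vwp_sum_3F2:
  fixes a :: "'a :: field_char_0"
  assumes "pochhammer (a + of_nat n + 1) n \<noteq> 0"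
  shows "(\<Sum>j\<le>n. vwp_weight a j / fact j * (pochhammer (- of_nat n) j / pochhammer (a + of_nat n + 1)
      j)) =
         (if n = 0 then 1 else 0)"
proof (cases n)
  case (Suc m)
  have "pochhammer (1 - of_nat n :: 'a) n = 0"
    using pochhammer_of_nat_eq_0_iff[of m n, where 'a = 'a] Suc by simp
  thus ?thesis using vwp_sum_3F2_partial[OF assms] Suc by simp
qed simp

text \<open>Expanding the pair d, e by \<open>bailey_interchange\<close> leaves inner sums of the
  type \<open>vwp_sum_3F2\<close> with n - r in place of n. They vanish unless r = n, so a single
  term remains.\<close>

lemma vwp_sum_5F4:
  fixes a d e :: "'a :: field_char_0"
  assumes "pochhammer (a - d + 1) n \<noteq> 0" "pochhammer (a - e + 1) n \<noteq> 0" "pochhammer (a + of_nat n + 1)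
      n \<noteq> 0"
  shows "(\<Sum>j\<le>n. vwp_weight a j / fact j * (pochhammer d j * pochhammer e j /
      (pochhammer (a - d + 1) j * pochhammer (a - e + 1) j)) *
            (pochhammer (- of_nat n) j / pochhammer (a + of_nat n + 1) j)) =
         pochhammer (a + 1) n * pochhammer (a - d - e + 1) n / (pochhammer (a - d + 1) n *
             pochhammer (a - e + 1) n)"
proof -
  let ?n = "of_nat n :: 'a"
  have inner: "(\<Sum>j\<le>n - r. vwp_weight (a + 2 * of_nat r) j / fact j * (pochhammer (- ?n) (r + j) /
      pochhammer (a + ?n + 1) (r + j))) =
      (if r = n then pochhammer (- ?n) n / pochhammer (a + ?n + 1) n else 0)" if r: "r \<le> n" for r
  proof -
    have nr: "(of_nat (n - r) :: 'a) = ?n - of_nat r" using r by (simp add: of_nat_diff)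
    have "pochhammer (a + ?n + 1) (r + (n - r)) =
        pochhammer (a + ?n + 1) r * pochhammer (a + ?n + 1 + of_nat r) (n - r)"
      by (rule pochhammer_product')
    hence "pochhammer (a + ?n + 1 + of_nat r) (n - r) \<noteq> 0" using assms(3) r by auto
    hence "pochhammer (a + 2 * of_nat r + of_nat (n - r) + 1) (n - r) \<noteq> 0"
      by (simp add: nr algebra_simps)
    note s = vwp_sum_3F2[OF this]
    have "(\<Sum>j\<le>n - r. vwp_weight (a + 2 * of_nat r) j / fact j * (pochhammer (- ?n) (r + j) /
        pochhammer (a + ?n + 1) (r + j))) =
        pochhammer (- ?n) r / pochhammer (a + ?n + 1) r *
        (\<Sum>j\<le>n - r. vwp_weight (a + 2 * of_nat r) j / fact j * (pochhammer (- of_nat (n - r)) j /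
            pochhammer (a + 2 * of_nat r + of_nat (n - r) + 1) j))"
      unfolding sum_distrib_left pochhammer_product' nr by (simp add: algebra_simps)
    thus ?thesis unfolding s using r by simp
  qed
  have "(\<Sum>j\<le>n. vwp_weight a j / fact j * (pochhammer d j * pochhammer e j /
      (pochhammer (a - d + 1) j * pochhammer (a - e + 1) j)) *
            (pochhammer (- ?n) j / pochhammer (a + ?n + 1) j)) =
        (-1) ^ n * pochhammer (a - d - e + 1) n * pochhammer (a + 1) (2 * n) /
            (fact n * pochhammer (a - d + 1) n * pochhammer (a - e + 1) n) *
                (pochhammer (- ?n) n / pochhammer (a + ?n + 1) n)"
    unfolding bailey_interchange[OF assms(1,2)]
    by (subst sum.mono_neutral_right[of "{..n}" "{n}"]) (use inner in \<open>auto simp: inner\<close>)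
  also have "pochhammer (a + 1) (2 * n) = pochhammer (a + 1) n * pochhammer (a + ?n + 1) n"
    using pochhammer_product'[of "a + 1" n n] by (simp add: add_ac mult_2)
  also have "pochhammer (- ?n) n = (-1) ^ n * fact n"
    by (simp add: pochhammer_minus_of_nat)
  finally show ?thesis using assms(3) by (simp add: field_simps flip: power_add)
qed

lemma pochhammer_split:
  assumes "r \<le> n"
  shows "pochhammer x n = pochhammer x r * pochhammer (x + of_nat r) (n - r)"
  using pochhammer_product'[of x r "n - r"] assms by simp

text \<open>Expanding the pair b, c by \<open>bailey_interchange\<close> leaves inner sums with base
  a + 2r and parameters d + r, e + r, -(n - r), which \<open>vwp_sum_5F4\<close> evaluates. The
  outer sum over r is then a balanced 4F3.\<close>

lemma whipple_7F6_4F3: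
  fixes a b c d e :: "'a :: field_char_0"
  assumes "pochhammer (a - b + 1) n \<noteq> 0" "pochhammer (a - c + 1) n \<noteq> 0" "pochhammer (a - d + 1) n \<noteq> 0"
    "pochhammer (a - e + 1) n \<noteq> 0" "pochhammer (a + of_nat n + 1) n \<noteq> 0" "pochhammer (d + e - a -
        of_nat n) n \<noteq> 0"
  shows "(\<Sum>k\<le>n. vwp_weight a k / fact k * (pochhammer b k * pochhammer c k /
      (pochhammer (a - b + 1) k * pochhammer (a - c + 1) k)) *
            (pochhammer d k * pochhammer e k * pochhammer (- of_nat n) k /
              (pochhammer (a - d + 1) k * pochhammer (a - e + 1) k * pochhammer (a + of_nat n + 1) k))) =
         pochhammer (a + 1) n * pochhammer (a - d - e + 1) n / (pochhammer (a - d + 1) n *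
             pochhammer (a - e + 1) n) *
         (\<Sum>k\<le>n. pochhammer (a - b - c + 1) k * pochhammer d k * pochhammer e k *
             pochhammer (- of_nat n) k /
            (fact k * pochhammer (a - b + 1) k * pochhammer (a - c + 1) k * pochhammer (d + e - a -
                of_nat n) k))"
  unfolding bailey_interchange[OF assms(1,2)] sum_distrib_left[of _ _ "{..n}"]
proof (rule sum.cong[OF refl])
  let ?n = "of_nat n :: 'a"
  fix r assume "r \<in> {..n}"
  hence r: "r \<le> n" by simp
  let ?r = "of_nat r :: 'a" and ?m = "n - r"
  have nr: "(of_nat ?m :: 'a) = ?n - ?r" using r by (simp add: of_nat_diff)
  note sp = pochhammer_split[OF r]
  have a1: "a + 2 * ?r - (d + ?r) + 1 = a - d + 1 + ?r" "a + 2 * ?r - (e + ?r) + 1 = a - e + 1 + ?r"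
    "a + 2 * ?r + of_nat ?m + 1 = a + ?n + 1 + ?r" "a + 2 * ?r - (d + ?r) - (e + ?r) + 1 = a - d - e + 1"
    "- of_nat ?m = - ?n + ?r"
    by (simp_all add: nr algebra_simps)
  have nz: "pochhammer (a - d + 1) r \<noteq> 0" "pochhammer (a - d + 1 + ?r) ?m \<noteq> 0"
    "pochhammer (a - e + 1) r \<noteq> 0" "pochhammer (a - e + 1 + ?r) ?m \<noteq> 0"
    "pochhammer (a + ?n + 1) r \<noteq> 0" "pochhammer (a + ?n + 1 + ?r) ?m \<noteq> 0"
    "pochhammer (d + e - a - ?n) r \<noteq> 0"
    using assms(3-6) unfolding sp by auto
  note s = vwp_sum_5F4[of "a + 2 * ?r" "d + ?r" ?m "e + ?r", unfolded a1, OF nz(2,4,6)]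
  have inner: "(\<Sum>j\<le>?m. vwp_weight (a + 2 * ?r) j / fact j *
      (pochhammer d (r + j) * pochhammer e (r + j) * pochhammer (- ?n) (r + j) /
       (pochhammer (a - d + 1) (r + j) * pochhammer (a - e + 1) (r + j) * pochhammer (a + ?n + 1) (r +
           j)))) =
      pochhammer d r * pochhammer e r * pochhammer (- ?n) r /
       (pochhammer (a - d + 1) r * pochhammer (a - e + 1) r * pochhammer (a + ?n + 1) r) *
      (pochhammer (a + 2 * ?r + 1) ?m * pochhammer (a - d - e + 1) ?m /
        (pochhammer (a - d + 1 + ?r) ?m * pochhammer (a - e + 1 + ?r) ?m))"
    unfolding s[symmetric] sum_distrib_left pochhammer_product' by (simp add: mult_ac)
  have p1: "pochhammer (a + 1) (2 * r) * pochhammer (a + 2 * ?r + 1) ?m =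
      pochhammer (a + 1) n * pochhammer (a + ?n + 1) r"
  proof -
    have "pochhammer (a + 1) (2 * r + ?m) =
        pochhammer (a + 1) (n + r)" using r by (simp add: mult_2 add.commute)
    thus ?thesis unfolding pochhammer_product' by (simp add: algebra_simps)
  qed
  \<comment> \<open>Reading these r factors backwards with opposite signs produces the lower
    parameter d + e - a - n; the sign matches the (-1)^r of the interchange.\<close>
  have "pochhammer (a - d - e + 1 + of_nat ?m) r = (-1) ^ r * pochhammer (d + e - a - ?n) r"
    using pochhammer_minus[of "- (d + e - a - ?n)" r]
    by (simp add: nr algebra_simps)
  hence p2: "pochhammer (a - d - e + 1) n =
      pochhammer (a - d - e + 1) ?m * ((-1) ^ r * pochhammer (d + e - a - ?n) r)"
    using pochhammer_split[of ?m n "a - d - e + 1"] r by simp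
  have p1': "pochhammer (a + 1) (2 * r) * pochhammer (a + 2 * ?r + 1) ?m / pochhammer (a + ?n + 1) r =
      pochhammer (a + 1) n"
    unfolding p1 using nz by simp
  show "(-1) ^ r * pochhammer (a - b - c + 1) r * pochhammer (a + 1) (2 * r) /
      (fact r * pochhammer (a - b + 1) r * pochhammer (a - c + 1) r) *
      (\<Sum>j\<le>?m. vwp_weight (a + 2 * ?r) j / fact j *
      (pochhammer d (r + j) * pochhammer e (r + j) * pochhammer (- ?n) (r + j) /
       (pochhammer (a - d + 1) (r + j) * pochhammer (a - e + 1) (r + j) * pochhammer (a + ?n + 1) (r +
           j)))) =
      pochhammer (a + 1) n * pochhammer (a - d - e + 1) n / (pochhammer (a - d + 1) n *
          pochhammer (a - e + 1) n) *
      (pochhammer (a - b - c + 1) r * pochhammer d r * pochhammer e r * pochhammer (- ?n) r /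
            (fact r * pochhammer (a - b + 1) r * pochhammer (a - c + 1) r * pochhammer (d + e - a -
                ?n) r))"
    unfolding inner p2 unfolding p1'[symmetric] sp[of "a - d + 1"] sp[of "a - e + 1"] using nz(7)
    by (simp add: mult_ac)
qed

section \<open>Ideals and units in the \<open>p\<close>-adic numbers\<close>

lemma padic_int_eq_0I:
  assumes "\<And>m. of_nat CARD('p) ^ m dvd (x :: 'p :: prime_card padic_int)"
  shows "x = 0"
  using assms by (intro padic_int_eqI) (simp add: power_p_dvd_iff zero_padic_int.rep_eq)

lemma padic_int_approx_nat:
  "\<exists>n. of_nat CARD('p) ^ m dvd (x :: 'p :: prime_card padic_int) - of_nat n"
proof
  show "of_nat CARD('p) ^ m dvd x - of_nat (nat (padic_trunc x m))"
    using padic_trunc_bounds[of x m]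
    by (simp add: power_p_dvd_iff minus_padic_int.rep_eq padic_trunc_of_nat del: of_nat_nat)
qed

lemma p_power_dvd_of_int_iff:
  "of_nat CARD('p) ^ m dvd (of_int n :: 'p :: prime_card padic_int) \<longleftrightarrow> int CARD('p) ^ m dvd n"
  by (simp add: power_p_dvd_iff padic_trunc_of_int dvd_eq_mod_eq_0)

lemma p_dvd_of_int_iff:
  "of_nat CARD('p) dvd (of_int n :: 'p :: prime_card padic_int) \<longleftrightarrow> int CARD('p) dvd n"
  using p_power_dvd_of_int_iff[of 1 n, where 'p = 'p] by simp

text \<open>Each truncation of x is prime to p, hence invertible modulo p^n. Inverses modulo p^n are
  unique, so the inverses at all levels are coherent and define a p-adic integer.\<close>

lemma padic_int_unitI:
  fixes x :: "'p :: prime_card padic_int"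
  assumes "\<not> of_nat CARD('p) dvd x"
  shows "x dvd 1"
proof -
  let ?P = "int CARD('p)"
  have pr: "prime ?P" using prime_card[where 'a = 'p] by simp
  have cop: "coprime (padic_trunc x n) (?P ^ n)" for n
  proof (cases n)
    case (Suc k)
    have "padic_trunc x (1 + k) mod ?P = padic_trunc x 1"
      using padic_trunc_add_mod[of x 1 k] by simp
    moreover have "padic_trunc x 1 \<noteq> 0" using assms power_p_dvd_iff[of 1 x] by simp
    ultimately have "\<not> ?P dvd padic_trunc x n" using Suc by (auto simp: dvd_eq_mod_eq_0)
    thus ?thesis using prime_imp_coprime[OF pr] by (simp add: coprime_commute)
  qed simp
  have "\<exists>y. y \<in> {0..<?P ^ n} \<and> [padic_trunc x n * y = 1] (mod ?P ^ n)" for n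
  proof -
    obtain y where y: "[padic_trunc x n * y = 1] (mod ?P ^ n)"
      using cong_solve_coprime_int[OF cop] by blast
    show ?thesis
      by (rule exI[of _ "y mod ?P ^ n"]) (use y in \<open>auto simp: cong_def mod_simps\<close>)
  qed
  then obtain y where y: "\<And>n. y n \<in> {0..<?P ^ n}" "\<And>n. [padic_trunc x n * y n = 1] (mod ?P ^ n)"
    by metis
  have coh: "y (Suc n) mod ?P ^ n = y n" for n
  proof -
    have "[padic_trunc x (Suc n) * y (Suc n) = 1] (mod ?P ^ n)"
      using y(2)[of "Suc n"] by (rule cong_dvd_modulus) simp
    moreover have "[padic_trunc x (Suc n) * y (Suc n) = padic_trunc x n * y (Suc n)] (mod ?P ^ n)"
      by (intro cong_mult cong_refl) (metis cong_def mod_mod_trivial padic_trunc_Suc)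
    ultimately have "[padic_trunc x n * y (Suc n) = padic_trunc x n * y n] (mod ?P ^ n)"
      using y(2)[of n] by (metis cong_sym cong_trans)
    hence "[y (Suc n) = y n] (mod ?P ^ n)"
      using cop[of n] cong_mult_lcancel by blast
    thus ?thesis using y(1)[of n] by (simp add: cong_def)
  qed
  define z :: "'p padic_int" where "z = Abs_padic_int y"
  have z: "padic_trunc z = y"
    unfolding z_def by (rule Abs_padic_int_inverse) (use y coh in auto)
  have "x * z = 1"
    by (rule padic_int_eqI) (use y(2) in \<open>simp add: times_padic_int.rep_eq one_padic_int.rep_eq z
        cong_def\<close>)
  thus ?thesis by (metis dvdI)
qed

lemma p_not_unit: "\<not> of_nat CARD('p) dvd (1 :: 'p :: prime_card padic_int)"
  using p_dvd_of_int_iff[of 1, where 'p = 'p] prime_card[where 'a = 'p]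
  by (metis of_int_1 not_prime_unit prime_nat_int_transfer)

text \<open>This is the form in which hypothesis (iv) is used: a denominator of valuation at most 1
  is cancelled by a single p.\<close>

lemma dvd_p_if_not_p_square_dvd:
  fixes x :: "'p :: prime_card padic_int"
  assumes "\<not> of_nat CARD('p) ^ 2 dvd x"
  shows "x dvd of_nat CARD('p)"
proof (cases "of_nat CARD('p) dvd x")
  case True
  then obtain y where y: "x = of_nat CARD('p) * y" ..
  hence "\<not> of_nat CARD('p) dvd y" using assms by (auto simp: power2_eq_square)
  hence "y dvd 1" by (rule padic_int_unitI)
  thus ?thesis using y mult_dvd_mono[of "of_nat CARD('p)" "of_nat CARD('p)" y 1] by simp
next
  case False
  thus ?thesis by (rule dvd_trans[OF padic_int_unitI one_dvd])
qed

lemma padic_residue_bounds: "padic_residue (x :: 'p :: prime_card padic_int) \<in> {0..<int CARD('p)}"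
  and padic_residue_dvd: "of_nat CARD('p) dvd x - of_int (padic_residue x)"
  using theI'[OF padic_residue_ex1[of x]] by (simp_all add: padic_residue_def)

section \<open>The ideals generated by powers of p, and units\<close>

definition padic_ideal :: "nat \<Rightarrow> 'p :: prime_card padic set" where
  "padic_ideal m = range (\<lambda>z. of_nat CARD('p) ^ m * to_fract z)"

lemma padic_cong_iff: "padic_cong m x y \<longleftrightarrow> x - y \<in> padic_ideal m"
  by (auto simp: padic_cong_def padic_ideal_def)

lemma to_fract_power: "to_fract (x ^ n) = to_fract x ^ n"
  by (induction n) simp_all

lemma to_fract_of_nat [simp]: "to_fract (of_nat n) = of_nat n"
  by (simp add: of_nat_fract_eq)

lemma to_fract_of_int [simp]: "to_fract (of_int n) = of_int n"
  by (cases n rule: int_cases2) simp_all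

lemma to_fract_pochhammer: "to_fract (pochhammer x n) = pochhammer (to_fract x) n"
  by (induction n) (simp_all add: pochhammer_Suc)

lemma to_fract_in_padic_ideal_iff:
  "to_fract x \<in> padic_ideal m \<longleftrightarrow> of_nat CARD('p) ^ m dvd (x :: 'p :: prime_card padic_int)"
proof -
  have "to_fract x \<in> padic_ideal m \<longleftrightarrow> (\<exists>z. to_fract x = to_fract (of_nat CARD('p) ^ m * z))"
    by (auto simp: padic_ideal_def to_fract_power)
  thus ?thesis by (simp only: to_fract_eq_iff dvd_def)
qed

lemma to_fract_padic_ideal_0 [simp, intro]: "to_fract x \<in> padic_ideal 0"
  by (simp add: to_fract_in_padic_ideal_iff)

lemma padic_ideal_0E:
  assumes "x \<in> padic_ideal 0"
  obtains z where "x = to_fract z"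
  using assms by (auto simp: padic_ideal_def)

lemma padic_ideal_add [intro]: "x \<in> padic_ideal m \<Longrightarrow> y \<in> padic_ideal m \<Longrightarrow> x + y \<in> padic_ideal m"
  unfolding padic_ideal_def by (auto simp: image_iff) (metis distrib_left to_fract_add)

lemma padic_ideal_uminus [intro]: "x \<in> padic_ideal m \<Longrightarrow> - x \<in> padic_ideal m"
  unfolding padic_ideal_def by (auto simp: image_iff) (metis mult_minus_right to_fract_uminus)

lemma padic_ideal_diff [intro]: "x \<in> padic_ideal m \<Longrightarrow> y \<in> padic_ideal m \<Longrightarrow> x - y \<in> padic_ideal m"
  using padic_ideal_add[of x m "- y"] padic_ideal_uminus[of y m] by simp

lemma padic_ideal_zero [simp, intro]: "0 \<in> padic_ideal m"
  unfolding padic_ideal_def by (rule image_eqI[of _ _ 0]) auto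

lemma padic_ideal_sum [intro]: "(\<And>i. i \<in> I \<Longrightarrow> f i \<in> padic_ideal m) \<Longrightarrow> sum f I \<in> padic_ideal m"
  by (induction I rule: infinite_finite_induct) auto

lemma padic_ideal_mult: "x \<in> padic_ideal m \<Longrightarrow> y \<in> padic_ideal n \<Longrightarrow> x * y \<in> padic_ideal (m + n)"
proof -
  assume "x \<in> padic_ideal m" "y \<in> padic_ideal n"
  then obtain u v where "x = of_nat CARD('a) ^ m * to_fract u" "y = of_nat CARD('a) ^ n * to_fract v"
    by (auto simp: padic_ideal_def)
  hence "x * y = of_nat CARD('a) ^ (m + n) * to_fract (u * v)" by (simp add: power_add)
  thus ?thesis unfolding padic_ideal_def by blast
qed

lemma padic_ideal_mult_left [intro]: "x \<in> padic_ideal 0 \<Longrightarrow> y \<in> padic_ideal m \<Longrightarrow> x * y \<in> padic_ideal m"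
  and padic_ideal_mult_right [intro]: "x \<in> padic_ideal m \<Longrightarrow> y \<in> padic_ideal 0 \<Longrightarrow> x * y \<in> padic_ideal m"
  using padic_ideal_mult[of x 0 y m] padic_ideal_mult[of x m y 0] by simp_all

lemma padic_ideal_antimono:
  assumes "m \<le> n"
  shows "padic_ideal n \<subseteq> padic_ideal m"
proof
  fix x :: "'a padic" assume "x \<in> padic_ideal n"
  then obtain z where "x = of_nat CARD('a) ^ n * to_fract z" by (auto simp: padic_ideal_def)
  hence "x = of_nat CARD('a) ^ m * to_fract (of_nat CARD('a) ^ (n - m) * z)"
    using assms by (simp add: to_fract_power mult.assoc[symmetric] flip: power_add)
  thus "x \<in> padic_ideal m" unfolding padic_ideal_def by blast
qed

lemma padic_ideal_one [simp, intro]: "1 \<in> padic_ideal 0"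
  using to_fract_padic_ideal_0[of 1] by simp

lemma padic_ideal_of_int [simp, intro]: "of_int n \<in> padic_ideal 0"
  using to_fract_padic_ideal_0[of "of_int n"] by simp

lemma padic_ideal_of_nat [simp, intro]: "of_nat n \<in> padic_ideal 0"
  using to_fract_padic_ideal_0[of "of_nat n"] by simp

lemma p_power_in_padic_ideal [simp, intro]: "of_nat CARD('p) ^ m \<in>
    (padic_ideal m :: 'p :: prime_card padic set)"
  unfolding padic_ideal_def by (rule image_eqI[of _ _ 1]) auto

lemma p_in_padic_ideal [simp, intro]: "of_nat CARD('p) \<in> (padic_ideal 1 :: 'p :: prime_card padic set)"
  using p_power_in_padic_ideal[of 1, where 'p = 'p] by simp

lemma p_mult_padic_ideal_iff:
  "of_nat CARD('p) * x \<in> padic_ideal (Suc m) \<longleftrightarrow> (x :: 'p :: prime_card padic) \<in> padic_ideal m"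
  by (auto simp: padic_ideal_def mult.assoc)

definition padic_unit :: "'p :: prime_card padic \<Rightarrow> bool" where
  "padic_unit x \<longleftrightarrow> x \<noteq> 0 \<and> x \<in> padic_ideal 0 \<and> inverse x \<in> padic_ideal 0"

lemma padic_unit_nonzero: "padic_unit x \<Longrightarrow> x \<noteq> 0"
  and padic_unit_integral: "padic_unit x \<Longrightarrow> x \<in> padic_ideal 0"
  and padic_unit_inverse_integral: "padic_unit x \<Longrightarrow> inverse x \<in> padic_ideal 0"
  by (auto simp: padic_unit_def)

lemma padic_unit_mult [intro]: "padic_unit x \<Longrightarrow> padic_unit y \<Longrightarrow> padic_unit (x * y)"
  by (auto simp: padic_unit_def)

lemma padic_unit_inverse [intro]: "padic_unit x \<Longrightarrow> padic_unit (inverse x)"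
  by (auto simp: padic_unit_def)

lemma padic_unit_divide [intro]: "padic_unit x \<Longrightarrow> padic_unit y \<Longrightarrow> padic_unit (x / y)"
  by (auto simp: divide_inverse)

lemma padic_unit_one [simp, intro]: "padic_unit 1"
  by (simp add: padic_unit_def)

lemma padic_unit_power [intro]: "padic_unit x \<Longrightarrow> padic_unit (x ^ n)"
  by (induction n) auto

lemma padic_ideal_divide_unit [intro]: "x \<in> padic_ideal m \<Longrightarrow> padic_unit y \<Longrightarrow> x / y \<in> padic_ideal m"
  by (auto simp: divide_inverse padic_unit_def)

lemma padic_unit_to_fract_iff:
  "padic_unit (to_fract x) \<longleftrightarrow> \<not> of_nat CARD('p) dvd (x :: 'p :: prime_card padic_int)"
proof
  assume x: "padic_unit (to_fract x)"
  then obtain y where y: "inverse (to_fract x) = to_fract y"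
    using padic_ideal_0E[OF padic_unit_inverse_integral] by metis
  have "to_fract (x * y) = to_fract 1"
    using padic_unit_nonzero[OF x] by (simp flip: y)
  hence "x * y = 1" by (simp only: to_fract_eq_iff)
  thus "\<not> of_nat CARD('p) dvd x" using p_not_unit[where 'p = 'p] by (metis dvd_mult2)
next
  assume "\<not> of_nat CARD('p) dvd x"
  then obtain y where y: "x * y = 1" using padic_int_unitI by (metis dvdE)
  hence "to_fract x * to_fract y = 1" by (simp flip: to_fract_mult)
  hence "inverse (to_fract x) = to_fract y" "to_fract x \<noteq> 0"
    by (auto intro: inverse_unique)
  thus "padic_unit (to_fract x)" by (simp add: padic_unit_def)
qed

lemma padic_unit_if_cong_int:
  fixes x :: "'p :: prime_card padic"
  assumes "padic_cong 1 x (of_int n)" "\<not> int CARD('p) dvd n"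
  shows "padic_unit x"
proof -
  have "x - of_int n \<in> padic_ideal 0"
    using assms(1) padic_ideal_antimono[of 0 1] by (auto simp: padic_cong_iff)
  from padic_ideal_add[OF this padic_ideal_of_int[of n]] obtain z where z: "x = to_fract z"
    by (auto elim: padic_ideal_0E)
  have "to_fract (z - of_int n) \<in> (padic_ideal 1 :: 'p padic set)"
    using assms(1) by (simp add: padic_cong_iff z)
  hence *: "of_nat CARD('p) dvd z - of_int n"
    unfolding to_fract_in_padic_ideal_iff power_one_right .
  have "\<not> of_nat CARD('p) dvd z"
  proof
    assume "of_nat CARD('p) dvd z"
    hence "of_nat CARD('p) dvd z - (z - of_int n)" using * by (rule dvd_diff)
    hence "of_nat CARD('p) dvd (of_int n :: 'p padic_int)" by simp
    thus False using assms(2) unfolding p_dvd_of_int_iff by blast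
  qed
  thus ?thesis by (simp add: z padic_unit_to_fract_iff)
qed

lemma padic_cong_refl [simp, intro]: "padic_cong m x x"
  by (simp add: padic_cong_iff)

lemma padic_cong_add: "padic_cong m x x' \<Longrightarrow> padic_cong m y y' \<Longrightarrow> padic_cong m (x + y) (x' + y')"
  using padic_ideal_add[of "x - x'" m "y - y'"] by (simp add: padic_cong_iff algebra_simps)

lemma padic_cong_diff: "padic_cong m x x' \<Longrightarrow> padic_cong m y y' \<Longrightarrow> padic_cong m (x - y) (x' - y')"
  using padic_ideal_diff[of "x - x'" m "y - y'"] by (simp add: padic_cong_iff algebra_simps)

section \<open>Divisibility of Pochhammer symbols by p\<close>

lemma pochhammer_unit:
  fixes x :: "'p :: prime_card padic"
  assumes "padic_cong 1 x (of_int n)" "\<And>j. j < k \<Longrightarrow> \<not> int CARD('p) dvd n + int j"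
  shows "padic_unit (pochhammer x k)"
  using assms(2)
proof (induction k)
  case (Suc k)
  have "padic_cong 1 (x + of_nat k) (of_int (n + int k))"
    using padic_cong_add[OF assms(1) padic_cong_refl[of _ "of_nat k"]] by simp
  hence "padic_unit (x + of_nat k)"
    by (rule padic_unit_if_cong_int) (use Suc.prems in auto)
  thus ?case using Suc by (auto simp: pochhammer_Suc)
qed simp

text \<open>When at most one factor is divisible by p, that factor alone decides the valuation of
  the symbol and whether it vanishes.\<close>

lemma pochhammer_eq_factor_times_unit:
  fixes x :: "'p :: prime_card padic"
  assumes "padic_cong 1 x (of_int n)" "j0 < k" "\<And>j. j < k \<Longrightarrow> j \<noteq> j0 \<Longrightarrow> \<not> int CARD('p) dvd n + int j"
  obtains u where "padic_unit u" "pochhammer x k = (x + of_nat j0) * u"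
proof
  let ?u = "pochhammer x j0 * pochhammer (x + of_nat (Suc j0)) (k - Suc j0)"
  show "padic_unit ?u"
  proof (intro padic_unit_mult pochhammer_unit)
    show "padic_cong 1 x (of_int n)" by fact
    show "padic_cong 1 (x + of_nat (Suc j0)) (of_int (n + int (Suc j0)))"
      using padic_cong_add[OF assms(1) padic_cong_refl[of _ "of_nat (Suc j0)"]] by simp
    show "\<not> int CARD('p) dvd n + int j" if "j < j0" for j
      using that assms(2) by (intro assms(3)) auto
    show "\<not> int CARD('p) dvd n + int (Suc j0) + int j" if "j < k - Suc j0" for j
      using assms(3)[of "Suc j0 + j"] that by (simp add: algebra_simps)
  qed
  show "pochhammer x k = (x + of_nat j0) * ?u"
    using pochhammer_split[of "Suc j0" k x] assms(2) by (simp add: pochhammer_Suc mult_ac)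
qed

lemma pochhammer_in_padic_ideal_0: "x \<in> padic_ideal 0 \<Longrightarrow> pochhammer x k \<in> padic_ideal 0"
  by (induction k) (auto simp: pochhammer_Suc)

lemma pochhammer_in_padic_ideal_1:
  assumes "padic_cong 1 x (of_int n)" "n + int j = 0" "j < k"
  shows "pochhammer x k \<in> padic_ideal 1"
proof -
  have "x - of_int n \<in> padic_ideal 1" using assms(1) by (simp add: padic_cong_iff)
  moreover have n: "n = - int j" using assms(2) by simp
  ultimately have 1: "x + of_nat j \<in> padic_ideal 1" by simp
  have "x + of_nat j - of_nat j \<in> padic_ideal 0"
    using 1 padic_ideal_antimono[of 0 1] by (intro padic_ideal_diff) auto
  hence 0: "x \<in> padic_ideal 0" by simp
  hence "pochhammer x j * pochhammer (x + of_nat (Suc j)) (k - Suc j) \<in> padic_ideal 0"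
    by (intro padic_ideal_mult_left pochhammer_in_padic_ideal_0 padic_ideal_add) auto
  from padic_ideal_mult_left[OF this 1] show ?thesis
    using pochhammer_split[of "Suc j" k x] assms(3) by (simp add: pochhammer_Suc mult_ac)
qed

section \<open>Morita's gamma function modulo \<open>p\<^sup>2\<close>\<close>

lemma dvd_minus_commute: "d dvd a - b \<longleftrightarrow> d dvd b - (a :: 'a :: comm_ring_1)"
  by (metis dvd_minus_iff minus_diff_eq)

lemma not_p_dvd_morita_nat:
  assumes "prime p"
  shows "\<not> int p dvd morita_nat p n"
proof (induction n)
  case 0
  thus ?case using assms by (simp add: morita_nat_def prime_nat_iff)
next
  case (Suc n)
  thus ?case using assms prime_dvd_mult_iff[of "int p" "unit_factor_nat p n" "morita_nat p n"]
    by (auto simp: morita_nat_Suc unit_factor_nat_def prime_nat_iff)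
qed

text \<open>
  The product \<open>f t\<close> of the \<open>j + p t\<close> is affine in \<open>t\<close> modulo \<open>p\<^sup>2\<close>, and \<open>j \<mapsto> p - j\<close> gives
  \<open>f (-1) = f 0\<close>, so it is constant.
\<close>

lemma prod_unit_factor_block_cong:
  assumes p: "prime p" "odd p"
  shows "[(\<Prod>j\<in>{i * p..<i * p + p}. unit_factor_nat p j) = (\<Prod>j\<in>{1..<p}. int j)] (mod int p ^ 2)"
proof -
  let ?P = "int p"
  define f where "f t = (\<Prod>j\<in>{1..<p}. int j + ?P * t)" for t
  define H where "H = (\<Sum>j\<in>{1..<p}. \<Prod>i\<in>{1..<p} - {j}. int i)"
  have f: "[f t = f 0 + ?P * t * H] (mod ?P ^ 2)" for t
  proof -
    have "finite I \<Longrightarrow> [(\<Prod>j\<in>I. int j + ?P * t) = (\<Prod>j\<in>I. int j) + ?P * t * (\<Sum>j\<in>I. \<Prod>i\<in>I - {j}. int i)]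
        (mod ?P ^ 2)" for I :: "nat set"
    proof (induction I rule: finite_induct)
      case (insert x I)
      have *: "(\<Prod>i\<in>insert x I - {j}. int i) = int x * (\<Prod>i\<in>I - {j}. int i)" if "j \<in> I" for j
      proof -
        have "insert x I - {j} = insert x (I - {j})" using that insert by auto
        thus ?thesis using insert by simp
      qed
      let ?A = "\<Prod>j\<in>I. int j" and ?S = "\<Sum>j\<in>I. \<Prod>i\<in>I - {j}. int i"
      have s: "(\<Sum>j\<in>insert x I. \<Prod>i\<in>insert x I - {j}. int i) = ?A + int x * ?S"
        using insert * by (simp add: sum_distrib_left)
      have "[(\<Prod>j\<in>insert x I. int j + ?P * t) = (int x + ?P * t) * (?A + ?P * t * ?S)] (mod ?P ^ 2)"
        using insert by (simp add: cong_mult)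
      also have "(int x + ?P * t) * (?A + ?P * t * ?S) = (int x * ?A + ?P * t * (?A + int x * ?S)) +
          ?P ^ 2 * (t ^ 2 * ?S)"
        by (simp add: algebra_simps power2_eq_square)
      also have "[\<dots> = int x * ?A + ?P * t * (?A + int x * ?S)] (mod ?P ^ 2)"
        by (simp add: cong_def)
      finally show ?case using insert by (simp add: s)
    qed simp
    from this[of "{1..<p}"] show ?thesis by (simp add: f_def H_def)
  qed
  have "f (- 1) = (\<Prod>j\<in>{1..<p}. - int (p - j))"
    unfolding f_def by (intro prod.cong refl) (auto simp: of_nat_diff)
  also have "\<dots> = (-1) ^ (p - 1) * (\<Prod>j\<in>{1..<p}. int (p - j))"
    by (subst prod_uminus) simp
  also have "(\<Prod>j\<in>{1..<p}. int (p - j)) = f 0"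
    unfolding f_def
    by (rule prod.reindex_bij_witness[of _ "\<lambda>j. p - j" "\<lambda>j. p - j"]) auto
  also have "(-1 :: int) ^ (p - 1) = 1" using p prime_gt_0_nat[of p] by simp
  finally have "f (-1) = f 0" by simp
  hence "[f 0 = f 0 + ?P * (- 1) * H] (mod ?P ^ 2)" using f[of "-1"] by simp
  \<comment> \<open>Since \<open>H\<close> is (p - 1)! times the sum of the reciprocals of 1, ..., p
    - 1, this amounts to the divisibility of that harmonic sum by p.\<close>
  hence H: "?P ^ 2 dvd ?P * H" by (simp add: cong_iff_dvd_diff)
  have p0: "p > 0" using prime_gt_0_nat[OF p(1)] .
  have "{i * p..<i * p + p} = insert (i * p) ((\<lambda>j. j + i * p) ` {1..<p})"
    using p0 by (auto simp: image_iff intro!: bexI[of _ "_ - i * p"])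
  hence "(\<Prod>j\<in>{i * p..<i * p + p}. unit_factor_nat p j) =
      unit_factor_nat p (i * p) * (\<Prod>j\<in>(\<lambda>j. j + i * p) ` {1..<p}. unit_factor_nat p j)"
    by (simp only:) (rule prod.insert, auto)
  also have "unit_factor_nat p (i * p) = 1" by (simp add: unit_factor_nat_def)
  also have "1 * (\<Prod>j\<in>(\<lambda>j. j + i * p) ` {1..<p}. unit_factor_nat p j) =
      (\<Prod>j\<in>(\<lambda>j. j + i * p) ` {1..<p}. unit_factor_nat p j)" by simp
  also have "\<dots> = f (int i)"
  proof -
    have "unit_factor_nat p (j + i * p) = int j + ?P * int i" if "j \<in> {1..<p}" for j
    proof -
      have "\<not> p dvd j" using that by (auto dest: dvd_imp_le)
      thus ?thesis by (simp add: unit_factor_nat_def algebra_simps)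
    qed
    thus ?thesis unfolding f_def by (subst prod.reindex) (auto simp: inj_on_def)
  qed
  also have "[f (int i) = f 0 + ?P * int i * H] (mod ?P ^ 2)" by (rule f)
  also have "[f 0 + ?P * int i * H = f 0] (mod ?P ^ 2)"
    using dvd_mult[OF H, of "int i"] by (simp add: cong_iff_dvd_diff mult_ac)
  finally show ?thesis by (simp add: f_def)
qed

text \<open>Each step of the recurrence multiplies by -1 or by -(n + m p), and a product of two
  affine functions of m p is affine modulo p^2. At n = 0 each block of length p multiplies by -(p -
  1)!, which is 1 + p v by Wilson's theorem, and (1 + p v)^m is 1 + p v m modulo p^2.\<close>

lemma morita_nat_affine:
  assumes p: "prime p" "odd p"
  shows "\<exists>A B. \<forall>m. [morita_nat p (n + m * p) = A + int p * B * int m] (mod int p ^ 2)"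
proof (induction n)
  case 0
  let ?P = "int p" and ?F = "\<Prod>j\<in>{1..<p}. int j"
  have "[(\<Prod>j\<in>{0..<0 + p ^ 1}. unit_factor_nat p j) = - 1] (mod int (p ^ 1))"
    by (rule prod_unit_factor_cong[OF p]) simp
  moreover have "[(\<Prod>j\<in>{0 * p..<0 * p + p}. unit_factor_nat p j) = ?F] (mod ?P)"
    using prod_unit_factor_block_cong[OF p, of 0] by (rule cong_dvd_modulus) simp
  ultimately have "[?F = - 1] (mod ?P)" by (simp add: cong_def)
  hence "?P dvd ?F + 1" by (simp add: cong_iff_dvd_diff)
  then obtain k where "?F + 1 = ?P * k" ..
  then obtain v where v: "- ?F = 1 + ?P * v"
    by (intro that[of "- k"]) simp
  have "[morita_nat p (m * p) = 1 + ?P * v * int m] (mod ?P ^ 2)" for m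
  proof (induction m)
    case (Suc m)
    have "morita_nat p (Suc m * p) = - (\<Prod>j\<in>{m * p..<m * p + p}. unit_factor_nat p j) *
        morita_nat p (m * p)"
      using morita_nat_add[of p "m * p" p] p by (simp add: add.commute)
    also have "[\<dots> = - ?F * (1 + ?P * v * int m)] (mod ?P ^ 2)"
      by (intro cong_mult Suc) (use prod_unit_factor_block_cong[OF p, of m] in \<open>simp add:
          cong_minus_minus_iff\<close>)
    also have "- ?F * (1 + ?P * v * int m) = (1 + ?P * v * int (Suc m)) + ?P ^ 2 * (v ^ 2 * int m)"
      unfolding v by (simp add: algebra_simps power2_eq_square)
    also have "[\<dots> = 1 + ?P * v * int (Suc m)] (mod ?P ^ 2)" by (simp add: cong_def)
    finally show ?case .
  qed (simp add: morita_nat_def)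
  thus ?case by auto
next
  case (Suc n)
  let ?P = "int p"
  obtain A B where IH: "\<And>m. [morita_nat p (n + m * p) = A + ?P * B * int m] (mod ?P ^ 2)"
    using Suc.IH by blast
  show ?case
  proof (cases "p dvd n")
    case True
    have "[morita_nat p (Suc n + m * p) = - A + ?P * (- B) * int m] (mod ?P ^ 2)" for m
      using IH[of m] True cong_minus_minus_iff[of "morita_nat p (n + m * p)" "A + ?P * B *
          int m" "?P ^ 2"]
      by (simp add: morita_nat_Suc unit_factor_nat_def)
    thus ?thesis by blast
  next
    case False
    have "[morita_nat p (Suc n + m * p) = - (int n * A) + ?P * (- A - int n * B) * int m] (mod
        ?P ^ 2)" for m
    proof -
      have "morita_nat p (Suc n + m * p) = - (int n + ?P * int m) * morita_nat p (n + m * p)"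
        using False by (simp add: morita_nat_Suc unit_factor_nat_def algebra_simps)
      also have "[\<dots> = - (int n + ?P * int m) * (A + ?P * B * int m)] (mod ?P ^ 2)"
        by (intro cong_mult IH cong_refl)
      also have "- (int n + ?P * int m) * (A + ?P * B * int m) =
          - (int n * A) + ?P * (- A - int n * B) * int m + ?P ^ 2 * (- B * int m ^ 2)"
        by (simp add: algebra_simps power2_eq_square)
      also have "[\<dots> = - (int n * A) + ?P * (- A - int n * B) * int m] (mod ?P ^ 2)"
        by (simp add: cong_iff_dvd_diff)
      finally show ?thesis .
    qed
    thus ?thesis by blast
  qed
qed

section \<open>From integer arguments of Gamma_p to p-adic ones\<close>

context
  assumes odd: "odd CARD('p :: prime_card)"
begin

lemma morita_Gamma_of_nat:
  "morita_Gamma (of_nat n :: 'p padic_int) = of_int (morita_nat CARD('p) n)"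
  using is_morita_Gamma_morita_Gamma[OF odd]
  by (cases "n = 0") (auto simp: is_morita_Gamma_def morita_nat_def)

lemma morita_Gamma_cong_of_nat:
  "\<exists>n. of_nat CARD('p) ^ m dvd (x :: 'p padic_int) - of_nat n \<and>
       of_nat CARD('p) ^ m dvd morita_Gamma x - of_int (morita_nat CARD('p) n)"
proof -
  let ?P = "of_nat CARD('p) :: 'p padic_int"
  define U where "U = {w. ?P ^ m dvd w - morita_Gamma x}"
  have "open U"
    unfolding open_padic_int_def
  proof
    fix w assume w: "w \<in> U"
    have "y \<in> U" if "?P ^ m dvd y - w" for y
      using dvd_add[OF that, of "w - morita_Gamma x"] w by (simp add: U_def)
    thus "\<exists>n. \<forall>y. ?P ^ n dvd y - w \<longrightarrow> y \<in> U" by blast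
  qed
  moreover have "continuous_on UNIV (morita_Gamma :: 'p padic_int \<Rightarrow> _)"
    using is_morita_Gamma_morita_Gamma[OF odd] by (simp add: is_morita_Gamma_def)
  ultimately have "open (morita_Gamma -` U :: 'p padic_int set)"
    by (rule open_vimage)
  moreover have "x \<in> morita_Gamma -` U" by (simp add: U_def)
  ultimately obtain N where N: "\<And>y. ?P ^ N dvd y - x \<Longrightarrow> morita_Gamma y \<in> U"
    unfolding open_padic_int_def by blast
  \<comment> \<open>n must be close to x both for the radius \<open>N\<close> given by continuity
    and for the modulus \<open>m\<close>.\<close>
  obtain n where n: "?P ^ (max N m) dvd x - of_nat n" using padic_int_approx_nat by blast
  have n': "?P ^ k dvd x - of_nat n" if "k \<le> max N m" for k
    by (rule dvd_trans[OF le_imp_power_dvd[OF that] n])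
  have "morita_Gamma (of_nat n) \<in> U"
    by (rule N) (use n'[of N] in \<open>simp add: dvd_minus_commute[of _ x]\<close>)
  hence "?P ^ m dvd morita_Gamma x - of_int (morita_nat CARD('p) n)"
    by (simp add: U_def morita_Gamma_of_nat dvd_minus_commute[of _ "of_int _"])
  thus ?thesis using n'[of m] by auto
qed

text \<open>Continuity supplies the congruence for one natural number near x. Since
  \<open>morita_nat\<close> has period p^m modulo p^m, it then holds for every natural number
  congruent to x modulo p^m.\<close>

lemma morita_Gamma_cong_of_nat':
  assumes "of_nat CARD('p) ^ m dvd (x :: 'p padic_int) - of_nat n"
  shows "of_nat CARD('p) ^ m dvd morita_Gamma x - of_int (morita_nat CARD('p) n)"
proof -
  let ?p = "CARD('p)" and ?P = "of_nat CARD('p) :: 'p padic_int"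
  obtain k where k: "?P ^ m dvd x - of_nat k" "?P ^ m dvd morita_Gamma x - of_int (morita_nat ?p k)"
    using morita_Gamma_cong_of_nat by blast
  have "?P ^ m dvd of_int (int k - int n)"
    using dvd_diff[OF assms k(1)] by simp
  hence "[int k = int n] (mod int (?p ^ m))"
    unfolding p_power_dvd_of_int_iff by (simp add: cong_iff_dvd_diff)
  hence kn: "[k = n] (mod ?p ^ m)" by (simp only: cong_int_iff)
  have *: "[morita_nat ?p a = morita_nat ?p (a mod ?p ^ m)] (mod int (?p ^ m))" for a
    using morita_nat_cong[OF prime_card odd, of "a mod ?p ^ m" "a div ?p ^ m" m]
    unfolding mod_div_mult_eq .
  have "[morita_nat ?p k = morita_nat ?p n] (mod int (?p ^ m))"
    using cong_trans[OF *[of k] cong_sym[OF *[of n, folded kn[unfolded cong_def]]]] .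
  hence "?P ^ m dvd of_int (morita_nat ?p k - morita_nat ?p n)"
    unfolding p_power_dvd_of_int_iff by (simp add: cong_iff_dvd_diff)
  from dvd_add[OF k(2) this] show ?thesis by simp
qed

lemma not_p_dvd_morita_Gamma: "\<not> of_nat CARD('p) dvd morita_Gamma (x :: 'p padic_int)"
proof
  let ?P = "of_nat CARD('p) :: 'p padic_int"
  assume "?P dvd morita_Gamma x"
  moreover obtain n where n: "?P dvd morita_Gamma x - of_int (morita_nat CARD('p) n)"
    using morita_Gamma_cong_of_nat[of 1 x] by auto
  ultimately have "?P dvd of_int (morita_nat CARD('p) n)"
    using dvd_diff[of ?P "morita_Gamma x" "morita_Gamma x - of_int (morita_nat CARD('p) n)"] by simp
  thus False using not_p_dvd_morita_nat[OF prime_card] unfolding p_dvd_of_int_iff by blast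
qed

lemma morita_Gamma_plus_1:
  "morita_Gamma (x + 1 :: 'p padic_int) = - (if of_nat CARD('p) dvd x then 1 else x) * morita_Gamma x"
proof -
  let ?p = "CARD('p)" and ?P = "of_nat CARD('p) :: 'p padic_int"
  \<comment> \<open>Only for m > 0 does an approximation of x modulo p^m reveal whether p divides
    x.\<close>
  have "?P ^ m dvd morita_Gamma (x + 1) + (if ?P dvd x then 1 else x) * morita_Gamma x" if "m > 0" for m
  proof -
    obtain n where n: "?P ^ m dvd x - of_nat n" using padic_int_approx_nat by blast
    hence n1: "?P ^ m dvd (x + 1) - of_nat (Suc n)" by simp
    let ?g = "of_int (morita_nat ?p n) :: 'p padic_int"
    have "?P dvd ?P ^ m" using that by simp
    hence "?P dvd x - of_nat n" by (rule dvd_trans[OF _ n])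
    hence "?P dvd x \<longleftrightarrow> ?P dvd of_int (int n)"
      using dvd_diff[of ?P x "x - of_nat n"] dvd_add[of ?P "x - of_nat n" "of_nat n"] by auto
    hence dv: "?P dvd x \<longleftrightarrow> ?p dvd n" unfolding p_dvd_of_int_iff by simp
    have x: "?P ^ m dvd (if ?P dvd x then 1 else x) - of_int (unit_factor_nat ?p n)"
      using n dv by (simp add: unit_factor_nat_def)
    have "?P ^ m dvd (morita_Gamma (x + 1) - of_int (morita_nat ?p (Suc n)))
        + ((if ?P dvd x then 1 else x) - of_int (unit_factor_nat ?p n)) * morita_Gamma x
        + of_int (unit_factor_nat ?p n) * (morita_Gamma x - ?g)"
      by (intro dvd_add dvd_mult2[OF x] dvd_mult morita_Gamma_cong_of_nat' n n1)
    thus ?thesis by (simp add: morita_nat_Suc algebra_simps)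
  qed
  note * = this
  have "?P ^ m dvd morita_Gamma (x + 1) + (if ?P dvd x then 1 else x) * morita_Gamma x" for m
    using *[of m] by (cases "m = 0") auto
  from padic_int_eq_0I[OF this] show ?thesis by (simp add: eq_neg_iff_add_eq_0)
qed

lemma morita_Gamma_plus_of_nat:
  assumes "\<And>j. j < k \<Longrightarrow> \<not> of_nat CARD('p) dvd x + of_nat j"
  shows "morita_Gamma (x + of_nat k :: 'p padic_int) = (-1) ^ k * pochhammer x k * morita_Gamma x"
  using assms
proof (induction k)
  case (Suc k)
  thus ?case using morita_Gamma_plus_1[of "x + of_nat k"]
    by (simp add: pochhammer_Suc add_ac left_diff_distrib right_diff_distrib distrib_left distrib_right)
qed simp

text \<open>Gamma_p omits the one factor x + j0 that p divides, while the Pochhammer symbol contains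
  it. The equation is left multiplied out because x + j0 may be 0.\<close>

lemma morita_Gamma_plus_of_nat_skip:
  assumes "\<And>j. j < k \<Longrightarrow> of_nat CARD('p) dvd x + of_nat j \<longleftrightarrow> j = j0" "j0 < k"
  shows "morita_Gamma (x + of_nat k :: 'p padic_int) * (x + of_nat j0) =
      (-1) ^ k * pochhammer x k * morita_Gamma x"
proof -
  have "i \<le> k \<Longrightarrow> morita_Gamma (x + of_nat i) * (if j0 < i then x + of_nat j0 else 1) =
      (-1) ^ i * pochhammer x i * morita_Gamma x" for i
  proof (induction i)
    case (Suc i)
    have *: "morita_Gamma (x + of_nat (Suc i)) = - (if i = j0 then 1 else x + of_nat i) *
        morita_Gamma (x + of_nat i)"
      using morita_Gamma_plus_1[of "x + of_nat i"] assms(1)[of i] Suc.prems by (simp add: add_ac)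
    have IH: "morita_Gamma (x + of_nat i) * (if j0 < i then x + of_nat j0 else 1) =
        (-1) ^ i * pochhammer x i * morita_Gamma x"
      using Suc by simp
    have "morita_Gamma (x + of_nat (Suc i)) * (if j0 < Suc i then x + of_nat j0 else 1) =
        - (x + of_nat i) * (morita_Gamma (x + of_nat i) * (if j0 < i then x + of_nat j0 else 1))"
      unfolding * by (cases i j0 rule: linorder_cases) (simp_all add: algebra_simps)
    thus ?case unfolding IH by (simp add: pochhammer_Suc algebra_simps)
  qed simp
  from this[of k] assms(2) show ?thesis by simp
qed

lemma morita_Gamma_affine:
  "\<exists>g. \<forall>w. of_nat CARD('p) ^ 2 dvd morita_Gamma (u + of_nat CARD('p) * w :: 'p padic_int) -
      (morita_Gamma u + of_nat CARD('p) * (g * w))"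
proof -
  let ?p = "CARD('p)" and ?P = "of_nat CARD('p) :: 'p padic_int"
  obtain n where n: "?P ^ 2 dvd u - of_nat n" using padic_int_approx_nat by blast
  obtain A B where AB: "\<And>m. [morita_nat ?p (n + m * ?p) = A + int ?p * B * int m] (mod int ?p ^ 2)"
    using morita_nat_affine[OF prime_card odd] by blast
  have AB': "?P ^ 2 dvd of_int (morita_nat ?p (n + m * ?p)) - (of_int A + ?P * of_int B * of_nat m)"
      for m
  proof -
    have "?P ^ 2 dvd of_int (morita_nat ?p (n + m * ?p) - (A + int ?p * B * int m))"
      unfolding p_power_dvd_of_int_iff using AB[of m] by (simp add: cong_iff_dvd_diff)
    thus ?thesis by simp
  qed
  have u: "?P ^ 2 dvd morita_Gamma u - of_int A"
    using dvd_add[OF morita_Gamma_cong_of_nat'[OF n] AB'[of 0]] by simp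
  have "?P ^ 2 dvd morita_Gamma (u + ?P * w) - (morita_Gamma u + ?P * (of_int B * w))" for w
  proof -
    \<comment> \<open>\<open>w\<close> enters only through p w, so an approximation modulo p
      suffices modulo p^2.\<close>
    obtain m where m: "?P ^ 1 dvd w - of_nat m" using padic_int_approx_nat by blast
    hence w: "?P ^ 2 dvd ?P * (w - of_nat m)" by (simp add: power2_eq_square)
    have "?P ^ 2 dvd (u - of_nat n) + ?P * (w - of_nat m)" by (intro dvd_add n w)
    hence "?P ^ 2 dvd (u + ?P * w) - of_nat (n + m * ?p)" by (simp add: algebra_simps)
    from morita_Gamma_cong_of_nat'[OF this]
    have "?P ^ 2 dvd (morita_Gamma (u + ?P * w) - of_int (morita_nat ?p (n + m * ?p)))
       + (of_int (morita_nat ?p (n + m * ?p)) - (of_int A + ?P * of_int B * of_nat m))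
       - (morita_Gamma u - of_int A) - of_int B * (?P * (w - of_nat m))"
      by (rule dvd_diff[OF dvd_diff[OF dvd_add[OF _ AB'] u] dvd_mult[OF w]])
    thus ?thesis by (simp add: algebra_simps)
  qed
  thus ?thesis by blast
qed

end

section \<open>Functions that are affine modulo \<open>p\<^sup>2\<close>\<close>

text \<open>
  The argument \<open>v\<close> stands for the triple \<open>x = v 0\<close>, \<open>y = v 1\<close>, \<open>z = v 2\<close>.
\<close>

definition p2_affine :: "((nat \<Rightarrow> 'p :: prime_card padic_int) \<Rightarrow> 'p padic) \<Rightarrow> bool" where
  "p2_affine f \<longleftrightarrow> (\<exists>A B. \<forall>v. f v - to_fract (A + of_nat CARD('p) * (\<Sum>i<3. B i * v i)) \<in> padic_ideal 2)"

lemma p2_affineI: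
  fixes f :: "(nat \<Rightarrow> 'p :: prime_card padic_int) \<Rightarrow> 'p padic"
  assumes "\<And>v. f v - to_fract (A + of_nat CARD('p) * (\<Sum>i<3. B i * v i)) \<in> padic_ideal 2"
  shows "p2_affine f"
  using assms unfolding p2_affine_def by (intro exI[of _ A] exI[of _ B]) simp

lemma p2_affine_padic_ideal_0:
  assumes "p2_affine f"
  shows "f v \<in> padic_ideal 0"
proof -
  obtain A B where "f v - to_fract (A + of_nat CARD('a) * (\<Sum>i<3. B i * v i)) \<in> padic_ideal 2"
    using assms by (auto simp: p2_affine_def)
  hence "f v - to_fract (A + of_nat CARD('a) * (\<Sum>i<3. B i * v i)) \<in> padic_ideal 0"
    using padic_ideal_antimono[of 0 2] by auto
  from padic_ideal_add[OF this to_fract_padic_ideal_0[of "A + of_nat CARD('a) * (\<Sum>i<3. B i * v i)"]]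
  show ?thesis by simp
qed

named_theorems p2_affine_intros

lemma p2_affine_const [p2_affine_intros]: "c \<in> padic_ideal 0 \<Longrightarrow> p2_affine (\<lambda>_. c)"
proof -
  assume "c \<in> padic_ideal 0"
  then obtain z where "c = to_fract z" by (elim padic_ideal_0E)
  thus ?thesis
    unfolding p2_affine_def by (intro exI[of _ z] exI[of _ "\<lambda>_. 0"]) simp
qed

lemma p2_affine_add [p2_affine_intros]:
  assumes "p2_affine f" "p2_affine g"
  shows "p2_affine (\<lambda>v. f v + g v)"
proof -
  let ?p = "of_nat CARD('a)"
  obtain A B where f: "\<And>v. f v - to_fract (A + ?p * (\<Sum>i<3. B i * v i)) \<in> padic_ideal 2"
    using assms(1) by (auto simp: p2_affine_def)
  obtain A' B' where g: "\<And>v. g v - to_fract (A' + ?p * (\<Sum>i<3. B' i * v i)) \<in> padic_ideal 2"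
    using assms(2) by (auto simp: p2_affine_def)
  have "f v + g v - to_fract ((A + A') + ?p * (\<Sum>i<3. (B i + B' i) * v i)) \<in> padic_ideal 2" for v
    using padic_ideal_add[OF f[of v] g[of v]] by (simp add: algebra_simps sum.distrib)
  thus ?thesis by (rule p2_affineI)
qed

lemma p2_affine_mult [p2_affine_intros]:
  assumes "p2_affine f" "p2_affine g"
  shows "p2_affine (\<lambda>v. f v * g v)"
proof -
  let ?p = "of_nat CARD('a)"
  obtain A B where f: "\<And>v. f v - to_fract (A + ?p * (\<Sum>i<3. B i * v i)) \<in> padic_ideal 2"
    using assms(1) by (auto simp: p2_affine_def)
  obtain A' B' where g: "\<And>v. g v - to_fract (A' + ?p * (\<Sum>i<3. B' i * v i)) \<in> padic_ideal 2"
    using assms(2) by (auto simp: p2_affine_def)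
  have "f v * g v - to_fract (A * A' + ?p * (\<Sum>i<3. (A * B' i + A' * B i) * v i)) \<in> padic_ideal 2" for v
  proof -
    define l l' where "l = (\<Sum>i<3. B i * v i)" and "l' = (\<Sum>i<3. B' i * v i)"
    have s: "(\<Sum>i<3. (A * B' i + A' * B i) * v i) = A * l' + A' * l"
      by (simp add: l_def l'_def sum_distrib_left sum.distrib[symmetric] algebra_simps)
    have "to_fract (?p ^ 2 * (l * l')) \<in> padic_ideal 2"
      unfolding to_fract_in_padic_ideal_iff by simp
    moreover have "f v * (g v - to_fract (A' + ?p * l')) + (f v - to_fract (A + ?p * l)) *
        to_fract (A' + ?p * l') \<in> padic_ideal 2"
      unfolding l_def l'_def
      by (intro padic_ideal_add padic_ideal_mult_left[OF _ g] padic_ideal_mult_right[OF f]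
          p2_affine_padic_ideal_0[OF assms(1)] to_fract_padic_ideal_0)
    ultimately have "f v * (g v - to_fract (A' + ?p * l')) + (f v - to_fract (A + ?p * l)) *
        to_fract (A' + ?p * l')
        + to_fract (?p ^ 2 * (l * l')) \<in> padic_ideal 2" by (rule padic_ideal_add[rotated])
    thus ?thesis unfolding s by (simp add: algebra_simps power2_eq_square)
  qed
  thus ?thesis by (rule p2_affineI)
qed

lemma p2_affine_uminus [p2_affine_intros]: "p2_affine f \<Longrightarrow> p2_affine (\<lambda>v. - f v)"
  using p2_affine_mult[OF p2_affine_const[of "- 1"], of f] by auto

lemma p2_affine_diff [p2_affine_intros]: "p2_affine f \<Longrightarrow> p2_affine g \<Longrightarrow> p2_affine (\<lambda>v. f v - g v)"
  using p2_affine_add[of f "\<lambda>v. - g v"] p2_affine_uminus[of g] by simp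

lemma p2_affine_inverse [p2_affine_intros]:
  assumes "p2_affine f" "\<And>v. padic_unit (f v)"
  shows "p2_affine (\<lambda>v. inverse (f v))"
proof -
  let ?p = "of_nat CARD('a)"
  obtain A B where f: "\<And>v. f v - to_fract (A + ?p * (\<Sum>i<3. B i * v i)) \<in> padic_ideal 2"
    using assms(1) by (auto simp: p2_affine_def)
  obtain z where z: "f (\<lambda>_. 0) = to_fract z" using p2_affine_padic_ideal_0[OF assms(1)] padic_ideal_0E
      by blast
  have "\<not> ?p dvd A"
  proof
    assume "?p dvd A"
    moreover have "?p ^ 2 dvd z - A"
      using f[of "\<lambda>_. 0"] unfolding z by (simp add: to_fract_in_padic_ideal_iff flip: to_fract_diff)
    hence "?p dvd z - A" by (rule dvd_trans[rotated]) simp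
    ultimately have "?p dvd z" using dvd_add[of ?p "z - A" A] by simp
    thus False using assms(2)[of "\<lambda>_. 0"] by (simp add: z padic_unit_to_fract_iff)
  qed
  then obtain A' where A': "A * A' = 1" using padic_int_unitI by (metis dvdE)
  \<comment> \<open>First-order expansion: modulo p^2 the inverse of A + p l is A' - p A'^2 l, where
    A' is the inverse of A.\<close>
  have "inverse (f v) - to_fract (A' + ?p * (\<Sum>i<3. (- A' * A' * B i) * v i)) \<in> padic_ideal 2" for v
  proof -
    define l where "l = (\<Sum>i<3. B i * v i)"
    let ?X = "A + ?p * l" and ?Z = "A' + ?p * (- A' * A' * l)"
    have s: "(\<Sum>i<3. (- A' * A' * B i) * v i) = - A' * A' * l"
      by (simp add: l_def sum_distrib_left algebra_simps)
    have "?X * ?Z = A * A' + ?p * l * A' * (1 - A * A') - ?p ^ 2 * (A' ^ 2 * l ^ 2)"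
      by (simp add: algebra_simps power2_eq_square)
    hence e: "1 - ?X * ?Z = ?p ^ 2 * (A' ^ 2 * l ^ 2)" unfolding A' by simp
    have "to_fract (1 - ?X * ?Z) \<in> padic_ideal 2"
      unfolding to_fract_in_padic_ideal_iff e by simp
    moreover have "(f v - to_fract ?X) * to_fract ?Z \<in> padic_ideal 2"
      unfolding l_def by (intro padic_ideal_mult_right[OF f] to_fract_padic_ideal_0)
    ultimately have "to_fract (1 - ?X * ?Z) - (f v - to_fract ?X) * to_fract ?Z \<in> padic_ideal 2"
      by (rule padic_ideal_diff)
    also have "to_fract (1 - ?X * ?Z) - (f v - to_fract ?X) * to_fract ?Z = 1 - f v * to_fract ?Z"
      by (simp only: to_fract_diff to_fract_mult to_fract_1) (simp add: left_diff_distrib)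
    finally have "(1 - f v * to_fract ?Z) / f v \<in> padic_ideal 2" using assms(2) by blast
    thus ?thesis unfolding s using padic_unit_nonzero[OF assms(2)[of v]] by (simp add: field_simps)
  qed
  thus ?thesis by (rule p2_affineI)
qed

lemma p2_affine_var [p2_affine_intros]:
  assumes "i < 3"
  shows "p2_affine (\<lambda>v. of_nat CARD('p) * to_fract (v i) :: 'p :: prime_card padic)"
  unfolding p2_affine_def
proof (intro exI allI)
  fix v :: "nat \<Rightarrow> 'p padic_int"
  have "(\<Sum>j<3. (if j = i then 1 else 0) * v j) = (\<Sum>j<3. if j = i then v j else 0)"
    by (intro sum.cong) auto
  hence "(\<Sum>j<3. (if j = i then 1 else 0) * v j) = v i"
    using assms by simp
  thus "of_nat CARD('p) * to_fract (v i) - to_fract (0 + of_nat CARD('p) * (\<Sum>j<3. (if j =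
      i then 1 else 0) * v j)) \<in> padic_ideal 2"
    by simp
qed

lemma p2_affine_sum [p2_affine_intros]:
  "(\<And>i. i \<in> I \<Longrightarrow> p2_affine (f i)) \<Longrightarrow> p2_affine (\<lambda>v. \<Sum>i\<in>I. f i v)"
proof (induction I rule: infinite_finite_induct)
  case (insert x I)
  thus ?case using p2_affine_add[of "f x" "\<lambda>v. \<Sum>i\<in>I. f i v"] by simp
qed (auto intro: p2_affine_const)

lemma p2_affine_zero_var:
  assumes "p2_affine f"
  shows "p2_affine (\<lambda>v. f (v(0 := 0)))"
proof -
  let ?p = "of_nat CARD('a)"
  obtain A B where f: "\<And>v. f v - to_fract (A + ?p * (\<Sum>i<3. B i * v i)) \<in> padic_ideal 2"
    using assms by (auto simp: p2_affine_def)
  have "(\<Sum>i<3. B i * (v(0 := 0)) i) = (\<Sum>i<3. (B(0 := 0)) i * v i)" for v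
    by (intro sum.cong) auto
  hence "f (v(0 := 0)) - to_fract (A + ?p * (\<Sum>i<3. (B(0 := 0)) i * v i)) \<in> padic_ideal 2" for v
    using f[of "v(0 := 0)"] by simp
  thus ?thesis by (rule p2_affineI)
qed

lemma p2_affine_morita_Gamma:
  assumes odd: "odd CARD('p :: prime_card)"
    and F: "\<And>v. F v = u + of_nat CARD('p) * (\<Sum>i<3. B i * v i)"
  shows "p2_affine (\<lambda>v. to_fract (morita_Gamma (F v)) :: 'p padic)"
proof -
  let ?p = "of_nat CARD('p)"
  obtain g where g: "\<And>w. ?p ^ 2 dvd morita_Gamma (u + ?p * w) - (morita_Gamma u + ?p * (g * w))"
    using morita_Gamma_affine[OF odd, of u] by blast
  have "to_fract (morita_Gamma (F v)) - to_fract (morita_Gamma u + ?p * (\<Sum>i<3. g * B i * v i)) \<in>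
      padic_ideal 2" for v
    using g[of "\<Sum>i<3. B i * v i"] unfolding F
    by (simp add: to_fract_in_padic_ideal_iff sum_distrib_left mult.assoc flip: to_fract_diff del:
        to_fract_add to_fract_mult)
  thus ?thesis by (rule p2_affineI)
qed

text \<open>Relative to (1,0,0), the points (2,0,0), (1,1,0), (1,0,1) differ by the three unit
  vectors, so the four values determine all coefficients over the p-adic integers. The points have x
  in {1, 2} and y = 0 or z = 0, which is where Whipple's transformation can be applied.\<close>

lemma p2_affine_zero_criterion:
  fixes f :: "(nat \<Rightarrow> 'p :: prime_card padic_int) \<Rightarrow> 'p padic"
  assumes f: "p2_affine f"
    and z: "f ((\<lambda>_. 0)(0 := 1)) \<in> padic_ideal 2" "f ((\<lambda>_. 0)(0 := 2)) \<in> padic_ideal 2"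
      "f ((\<lambda>_. 0)(0 := 1, 1 := 1)) \<in> padic_ideal 2" "f ((\<lambda>_. 0)(0 := 1, 2 := 1)) \<in> padic_ideal 2"
  shows "f v \<in> padic_ideal 2"
proof -
  let ?p = "of_nat CARD('p)"
  obtain A B where AB: "\<And>v. f v - to_fract (A + ?p * (\<Sum>i<3. B i * v i)) \<in> padic_ideal 2"
    using f by (auto simp: p2_affine_def)
  have dv: "?p ^ 2 dvd A + ?p * (\<Sum>i<3. B i * v i)" if "f v \<in> padic_ideal 2" for v
  proof -
    have "f v - (f v - to_fract (A + ?p * (\<Sum>i<3. B i * v i))) \<in> padic_ideal 2"
      by (intro padic_ideal_diff that AB)
    hence "to_fract (A + ?p * (\<Sum>i<3. B i * v i)) \<in>
        padic_ideal 2" by (simp del: to_fract_add to_fract_mult)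
    thus ?thesis unfolding to_fract_in_padic_ideal_iff .
  qed
  have s: "(\<Sum>i<3. h i) = h 0 + h 1 + (h 2 :: 'p padic_int)" for h :: "nat \<Rightarrow> _"
    by (simp add: numeral_3_eq_3 eval_nat_numeral)
  have d1: "?p ^ 2 dvd A + ?p * B 0" using dv[OF z(1)] by (simp add: s)
  have d2: "?p ^ 2 dvd A + ?p * (2 * B 0)" using dv[OF z(2)] by (simp add: s mult.commute)
  have d3: "?p ^ 2 dvd A + ?p * (B 0 + B 1)" using dv[OF z(3)] by (simp add: s)
  have d4: "?p ^ 2 dvd A + ?p * (B 0 + B 2)" using dv[OF z(4)] by (simp add: s)
  have b0: "?p ^ 2 dvd ?p * B 0" using dvd_diff[OF d2 d1] by (simp add: algebra_simps)
  have b1: "?p ^ 2 dvd ?p * B 1" using dvd_diff[OF d3 d1] by (simp add: algebra_simps)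
  have b2: "?p ^ 2 dvd ?p * B 2" using dvd_diff[OF d4 d1] by (simp add: algebra_simps)
  have a: "?p ^ 2 dvd A" using dvd_diff[OF d1 b0] by simp
  have "?p ^ 2 dvd A + (?p * B 0 * v 0 + ?p * B 1 * v 1 + ?p * B 2 * v 2)"
    by (intro dvd_add a dvd_mult2 b0 b1 b2)
  hence "?p ^ 2 dvd A + ?p * (\<Sum>i<3. B i * v i)" by (simp add: s algebra_simps)
  hence "to_fract (A + ?p * (\<Sum>i<3. B i * v i)) \<in> padic_ideal 2"
    unfolding to_fract_in_padic_ideal_iff .
  from padic_ideal_add[OF AB[of v] this] show ?thesis by simp
qed

section \<open>Exact difference quotients in the first variable\<close>

text \<open>
  The second condition allows division by \<open>p\<cdot>v 0\<close> once the value at \<open>v 0 = 0\<close> is subtracted.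
\<close>

definition p2_affine_quot :: "((nat \<Rightarrow> 'p :: prime_card padic_int) \<Rightarrow> 'p padic) \<Rightarrow> bool" where
  "p2_affine_quot f \<longleftrightarrow> p2_affine f \<and>
     (\<exists>h. p2_affine h \<and> (\<forall>v. f v - f (v(0 := 0)) = of_nat CARD('p) * to_fract (v 0) * h v))"

named_theorems p2_affine_quot_intros

lemma p2_affine_quot_const [p2_affine_quot_intros]: "c \<in> padic_ideal 0 \<Longrightarrow> p2_affine_quot (\<lambda>_. c)"
  unfolding p2_affine_quot_def by (auto intro!: p2_affine_const exI[of _ "\<lambda>_. 0"])

lemma p2_affine_quot_add [p2_affine_quot_intros]:
  assumes "p2_affine_quot f" "p2_affine_quot g"
  shows "p2_affine_quot (\<lambda>v. f v + g v)"
proof -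
  let ?p = "of_nat CARD('a) :: 'a padic"
  obtain h h' where h: "p2_affine h" "\<And>v. f v - f (v(0 := 0)) = ?p * to_fract (v 0) * h v"
      "p2_affine h'" "\<And>v. g v - g (v(0 := 0)) = ?p * to_fract (v 0) * h' v"
    using assms by (auto simp: p2_affine_quot_def)
  have "f v + g v - (f (v(0 := 0)) + g (v(0 := 0))) = ?p * to_fract (v 0) * (h v + h' v)" for v
    using h(2,4)[of v] by (simp add: distrib_left flip: h(2,4))
  thus ?thesis using assms h unfolding p2_affine_quot_def
    by (auto intro!: p2_affine_intros exI[of _ "\<lambda>v. h v + h' v"])
qed

lemma p2_affine_quot_mult [p2_affine_quot_intros]:
  assumes "p2_affine_quot f" "p2_affine_quot g"
  shows "p2_affine_quot (\<lambda>v. f v * g v)"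
proof -
  let ?p = "of_nat CARD('a) :: 'a padic"
  obtain h h' where h: "p2_affine h" "\<And>v. f v - f (v(0 := 0)) = ?p * to_fract (v 0) * h v"
      "p2_affine h'" "\<And>v. g v - g (v(0 := 0)) = ?p * to_fract (v 0) * h' v"
    using assms by (auto simp: p2_affine_quot_def)
  \<comment> \<open>The product rule for difference quotients; the equality is exact, and g at
    \<open>v 0 = 0\<close> is again affine modulo p^2.\<close>
  have "f v * g v - (f (v(0 := 0)) * g (v(0 := 0))) =
      ?p * to_fract (v 0) * (f v * h' v + h v * g (v(0 := 0)))" for v
  proof -
    have "f v * g v - (f (v(0 := 0)) * g (v(0 := 0))) =
        f v * (g v - g (v(0 := 0))) + (f v - f (v(0 := 0))) * g (v(0 := 0))"
      by (simp add: algebra_simps)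
    thus ?thesis unfolding h by (simp add: algebra_simps)
  qed
  moreover have "p2_affine (\<lambda>v. f v * h' v + h v * g (v(0 := 0)))"
    using assms h by (auto simp: p2_affine_quot_def intro!: p2_affine_intros p2_affine_zero_var)
  ultimately show ?thesis using assms unfolding p2_affine_quot_def
    by (auto intro!: p2_affine_mult)
qed

lemma p2_affine_quot_inverse [p2_affine_quot_intros]:
  assumes "p2_affine_quot f" "\<And>v. padic_unit (f v)"
  shows "p2_affine_quot (\<lambda>v. inverse (f v))"
proof -
  let ?p = "of_nat CARD('a) :: 'a padic"
  obtain h where h: "p2_affine h" "\<And>v. f v - f (v(0 := 0)) = ?p * to_fract (v 0) * h v"
    using assms by (auto simp: p2_affine_quot_def)
  have "inverse (f v) - inverse (f (v(0 := 0))) =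
      ?p * to_fract (v 0) * (- (inverse (f v) * inverse (f (v(0 := 0))) * h v))" for v
  proof -
    have nz: "f v \<noteq> 0" "f (v(0 := 0)) \<noteq> 0" using assms(2) padic_unit_nonzero by blast+
    have "inverse (f v) - inverse (f (v(0 := 0))) =
        - (inverse (f v) * inverse (f (v(0 := 0))) * (f v - f (v(0 := 0))))"
      using nz by (simp add: field_simps)
    thus ?thesis unfolding h by (simp add: mult_ac)
  qed
  moreover have "p2_affine (\<lambda>v. - (inverse (f v) * inverse (f (v(0 := 0))) * h v))"
    using assms h p2_affine_zero_var[OF p2_affine_inverse[of f]]
    by (auto simp: p2_affine_quot_def intro!: p2_affine_intros)
  ultimately show ?thesis using assms unfolding p2_affine_quot_def
    by (auto intro!: p2_affine_inverse)
qed

lemma p2_affine_quot_uminus [p2_affine_quot_intros]: "p2_affine_quot f \<Longrightarrow> p2_affine_quot (\<lambda>v. - f v)"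
  using p2_affine_quot_mult[OF p2_affine_quot_const[of "- 1"], of f] by auto

lemma p2_affine_quot_diff [p2_affine_quot_intros]:
  "p2_affine_quot f \<Longrightarrow> p2_affine_quot g \<Longrightarrow> p2_affine_quot (\<lambda>v. f v - g v)"
  using p2_affine_quot_add[of f "\<lambda>v. - g v"] p2_affine_quot_uminus[of g] by simp

lemma p2_affine_quot_divide [p2_affine_quot_intros]:
  "p2_affine_quot f \<Longrightarrow> p2_affine_quot g \<Longrightarrow> (\<And>v. padic_unit (g v)) \<Longrightarrow> p2_affine_quot (\<lambda>v. f v / g v)"
  unfolding divide_inverse by (intro p2_affine_quot_intros)

lemma p2_affine_divide [p2_affine_intros]:
  "p2_affine f \<Longrightarrow> p2_affine g \<Longrightarrow> (\<And>v. padic_unit (g v)) \<Longrightarrow> p2_affine (\<lambda>v. f v / g v)"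
  unfolding divide_inverse by (intro p2_affine_intros)

lemma p2_affine_quot_pochhammer [p2_affine_quot_intros]:
  "p2_affine_quot f \<Longrightarrow> p2_affine_quot (\<lambda>v. pochhammer (f v) k)"
  by (induction k) (auto simp: pochhammer_Suc intro!: p2_affine_quot_intros)

lemma p2_affine_quot_power [p2_affine_quot_intros]:
  "p2_affine_quot f \<Longrightarrow> p2_affine_quot (\<lambda>v. f v ^ k)"
  by (induction k) (auto intro!: p2_affine_quot_intros)

lemma p2_affine_quot_var [p2_affine_quot_intros]:
  assumes "i < 3"
  shows "p2_affine_quot (\<lambda>v. of_nat CARD('p) * to_fract (v i) :: 'p :: prime_card padic)"
  unfolding p2_affine_quot_def
proof (intro conjI p2_affine_var assms exI allI)
  show "p2_affine (\<lambda>_. if i = 0 then 1 else 0 :: 'p padic)"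
    by (auto intro!: p2_affine_const)
qed auto

lemma p2_affine_quotD: "p2_affine_quot f \<Longrightarrow> p2_affine f"
  by (simp add: p2_affine_quot_def)

section \<open>The summands and the gamma factor\<close>

lemma padic_ideal_divideI:
  fixes x y :: "'p :: prime_card padic"
  assumes "x \<in> padic_ideal (Suc m)" "of_nat CARD('p) / y \<in> padic_ideal 0"
  shows "x / y \<in> padic_ideal m"
proof -
  have p: "(of_nat CARD('p) :: 'p padic) \<noteq> 0" by simp
  have "of_nat CARD('p) * (x / of_nat CARD('p)) \<in> padic_ideal (Suc m)" using assms(1) by simp
  hence "x / of_nat CARD('p) \<in> padic_ideal m" unfolding p_mult_padic_ideal_iff .
  from padic_ideal_mult_right[OF this assms(2)] show ?thesis by simp
qed

text \<open>A denominator divisible by p costs one p and guarantees one in each of the other two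
  numerators. If there is only one such denominator, a neighbouring quotient lends its p; if there
  are two or three, each of them is paid for by its own numerator.\<close>

lemma padic_ideal_prod3_divide:
  fixes N1 N2 N3 D1 D2 D3 :: "'p :: prime_card padic"
  defines "p \<equiv> of_nat CARD('p) :: 'p padic"
  assumes N: "N1 \<in> padic_ideal 0" "N2 \<in> padic_ideal 0" "N3 \<in> padic_ideal 0"
    and D1: "padic_unit D1 \<or> p / D1 \<in> padic_ideal 0 \<and> N2 \<in> padic_ideal 1 \<and> N3 \<in> padic_ideal 1"
    and D2: "padic_unit D2 \<or> p / D2 \<in> padic_ideal 0 \<and> N1 \<in> padic_ideal 1 \<and> N3 \<in> padic_ideal 1"
    and D3: "padic_unit D3 \<or> p / D3 \<in> padic_ideal 0 \<and> N1 \<in> padic_ideal 1 \<and> N2 \<in> padic_ideal 1"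
  shows "N1 / D1 * (N2 / D2) * (N3 / D3) \<in> padic_ideal 0"
proof -
  have u: "x / y \<in> padic_ideal m" if "x \<in> padic_ideal m" "padic_unit y" for x y :: "'p padic" and m
    using that by blast
  have v: "x / y \<in> padic_ideal 0" if "x \<in> padic_ideal 1" "p / y \<in> padic_ideal 0" for x y
    using padic_ideal_divideI[of x 0 y] that by (simp add: p_def)
  consider "padic_unit D1" "padic_unit D2" "padic_unit D3"
    | "p / D1 \<in> padic_ideal 0" "N2 / D2 \<in> padic_ideal 1" "N3 / D3 \<in> padic_ideal 0"
    | "p / D2 \<in> padic_ideal 0" "N1 / D1 \<in> padic_ideal 1" "N3 / D3 \<in> padic_ideal 0"
    | "p / D3 \<in> padic_ideal 0" "N1 / D1 \<in> padic_ideal 1" "N2 / D2 \<in> padic_ideal 0"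
    | "N1 / D1 \<in> padic_ideal 0" "N2 / D2 \<in> padic_ideal 0" "N3 / D3 \<in> padic_ideal 0"
    using D1 D2 D3 N u v by meson
  thus ?thesis
  proof cases
    case 1
    thus ?thesis by (intro padic_ideal_mult_left u N)
  next
    case 2
    have "N1 * (N2 / D2) \<in> padic_ideal 1" by (intro padic_ideal_mult_left N 2)
    from padic_ideal_mult_left[OF v[OF this 2(1)] 2(3)] show ?thesis by (simp add: mult_ac)
  next
    case 3
    have "N2 * (N1 / D1) \<in> padic_ideal 1" by (intro padic_ideal_mult_left N 3)
    from padic_ideal_mult_left[OF v[OF this 3(1)] 3(3)] show ?thesis by (simp add: mult_ac)
  next
    case 4
    have "N3 * (N1 / D1) \<in> padic_ideal 1" by (intro padic_ideal_mult_left N 4)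
    from padic_ideal_mult_left[OF v[OF this 4(1)] 4(3)] show ?thesis by (simp add: mult_ac)
  next
    case 5
    thus ?thesis by (intro padic_ideal_mult_left)
  qed
qed

lemma not_dvd_between:
  fixes q m :: int
  assumes "t * q < m" "m < (t + 1) * q"
  shows "\<not> q dvd m"
proof
  assume "q dvd m"
  then obtain s where s: "m = q * s" ..
  show False
  proof (cases "q > 0")
    case True
    have "q * t < q * s" "q * s < q * (t + 1)" using assms s by (simp_all add: mult.commute)
    thus False using True by (simp add: mult_less_cancel_left_pos)
  next
    case False
    have "q * t < q * (t + 1)" using assms by (simp add: mult.commute)
    thus False using False by (simp add: distrib_left)
  qed
qed

text \<open>\<open>vwp_weight\<close> contains one (\<alpha>)_k together with the ratio (1 +
  \<alpha>/2)_k / (\<alpha>/2)_k, and \<open>fact k ^ 2\<close> is k! times the lower symbol (1)_k.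
  The last three quotients are bracketed to fit \<open>padic_ideal_prod3_divide\<close>.\<close>

definition whipple_7F6_term :: "'a :: field_char_0 \<Rightarrow> 'a \<Rightarrow> 'a \<Rightarrow> 'a \<Rightarrow> 'a \<Rightarrow> nat \<Rightarrow> 'a" where
  "whipple_7F6_term \<alpha> \<beta> \<gamma> \<delta> \<epsilon> k = vwp_weight \<alpha> k * pochhammer \<alpha> k / fact k ^ 2 *
     (pochhammer \<beta> k / pochhammer (\<alpha> - \<beta> + 1) k) *
     (pochhammer \<gamma> k / pochhammer (\<alpha> - \<gamma> + 1) k * (pochhammer \<delta> k / pochhammer (\<alpha> - \<delta> + 1) k) *
     (pochhammer \<epsilon> k / pochhammer (\<alpha> - \<epsilon> + 1) k))"

definition whipple_4F3_term :: "'a :: field_char_0 \<Rightarrow> 'a \<Rightarrow> 'a \<Rightarrow> 'a \<Rightarrow> 'a \<Rightarrow> nat \<Rightarrow> 'a" where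
  "whipple_4F3_term \<alpha> \<beta> \<gamma> \<delta> \<epsilon> k = pochhammer (1 - \<epsilon>) k / pochhammer (\<alpha> - \<epsilon> + 1) k *
     (pochhammer \<beta> k * pochhammer \<gamma> k * pochhammer \<delta> k / pochhammer (\<beta> + \<gamma> + \<delta> - \<alpha>) k) / fact k ^ 2"

lemma whipple_7F6_term_commute: "whipple_7F6_term \<alpha> \<beta> \<gamma> \<delta> \<epsilon> k = whipple_7F6_term \<alpha> \<beta> \<delta> \<gamma> \<epsilon> k"
  by (simp add: whipple_7F6_term_def mult_ac)

lemma whipple_4F3_term_commute: "whipple_4F3_term \<alpha> \<beta> \<gamma> \<delta> \<epsilon> k = whipple_4F3_term \<alpha> \<beta> \<delta> \<gamma> \<epsilon> k"
  by (simp add: whipple_4F3_term_def add_ac mult_ac)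

definition Gamma_factor :: "nat \<Rightarrow> nat \<Rightarrow> 'p :: prime_card padic_int \<Rightarrow> 'p padic_int \<Rightarrow> 'p padic_int \<Rightarrow>
    'p padic_int \<Rightarrow> 'p padic" where
  "Gamma_factor a b \<alpha> \<beta> \<gamma> \<delta> = of_int (int a) / of_int (int a - int b) *
     (to_fract (morita_Gamma (\<alpha> - \<beta> + 1) * morita_Gamma (\<alpha> - \<gamma> + 1) *
                morita_Gamma (\<alpha> - \<delta> + 1) * morita_Gamma (\<alpha> - \<beta> - \<gamma> - \<delta> + 1)) /
      to_fract (morita_Gamma (\<alpha> + 1) * morita_Gamma (\<alpha> - \<beta> - \<gamma> + 1) *
                morita_Gamma (\<alpha> - \<beta> - \<delta> + 1) * morita_Gamma (\<alpha> - \<gamma> - \<delta> + 1)))"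

lemma Gamma_factor_commute: "Gamma_factor a b \<alpha> \<beta> \<gamma> \<delta> = Gamma_factor a b \<alpha> \<beta> \<delta> \<gamma>"
  by (simp add: Gamma_factor_def mult_ac diff_diff_eq add_ac)

lemma small_dvd_iff: "\<bar>m\<bar> < q \<Longrightarrow> q dvd m \<longleftrightarrow> m = (0 :: int)"
  using zdvd_not_zless[of "\<bar>m\<bar>" q] by auto

lemma p_dvd_plus_of_nat_iff:
  fixes u :: "'p :: prime_card padic_int"
  assumes "padic_cong 1 (to_fract u) (of_int n)"
  shows "of_nat CARD('p) dvd u + of_nat j \<longleftrightarrow> int CARD('p) dvd n + int j"
proof -
  have "to_fract (u - of_int n) \<in> (padic_ideal 1 :: 'p padic set)"
    using assms by (simp add: padic_cong_iff)
  hence "of_nat CARD('p) dvd u - of_int n"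
    unfolding to_fract_in_padic_ideal_iff power_one_right .
  from dvd_add_right_iff[OF this, of "of_int (n + int j)"]
  have "of_nat CARD('p) dvd u + of_nat j \<longleftrightarrow> of_nat CARD('p) dvd (of_int (n + int j) :: 'p padic_int)"
    by simp
  thus ?thesis unfolding p_dvd_of_int_iff .
qed

lemma padic_unit_of_nat:
  assumes "0 < n" "n < CARD('p)"
  shows "padic_unit (of_nat n :: 'p :: prime_card padic)"
  by (rule padic_unit_if_cong_int[of _ "int n"], simp, rule not_dvd_between[of 0])
      (use assms in simp_all)

lemma p_divide_pochhammer_integral:
  assumes "pochhammer x k =
      (of_nat CARD('p) * w) * u" "padic_unit w" "padic_unit (u :: 'p :: prime_card padic)"
  shows "of_nat CARD('p) / pochhammer x k \<in> padic_ideal 0" "pochhammer x k \<noteq> 0"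
proof -
  have "of_nat CARD('p) / pochhammer x k = inverse (w * u)"
    unfolding assms(1) by (simp add: field_simps)
  thus "of_nat CARD('p) / pochhammer x k \<in> padic_ideal 0"
    using padic_unit_inverse_integral[OF padic_unit_mult[OF assms(2,3)]] by simp
  show "pochhammer x k \<noteq> 0"
    using assms(1) padic_unit_nonzero[OF assms(2)] padic_unit_nonzero[OF assms(3)] by simp
qed

text \<open>Only \<epsilon> and \<kappa> = b/a are fixed p-adic data; \<alpha>, \<beta>, \<gamma>,
  \<delta> will vary inside their residue classes. The assumptions are symmetric in c and d, so that
  \<gamma> and \<delta> can later exchange roles.\<close>

locale whipple_residues =
  fixes a b c d e :: nat and \<kappa> \<epsilon> :: "'p :: prime_card padic_int"
  assumes odd_p: "odd CARD('p)"
    and b_pos: "0 < b" and b_less_a: "b < a" and a_le: "a \<le> c" "a \<le> d" "a \<le> e"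
    and less_p: "c < CARD('p)" "d < CARD('p)" "e < CARD('p)"
    and ce: "c + e < CARD('p) + a" and de: "d + e < CARD('p) + a" and bcd: "b + c + d < CARD('p) + a"
    and kappa: "of_nat a * \<kappa> = of_nat b"
    and eps: "of_nat CARD('p) dvd \<epsilon> + of_nat e"
begin

abbreviation E where "E \<equiv> to_fract \<epsilon>"

lemma eps_cong: "padic_cong 1 E (of_int (- int e))"
proof -
  have "to_fract (\<epsilon> + of_nat e) \<in> (padic_ideal 1 :: 'p padic set)"
    unfolding to_fract_in_padic_ideal_iff power_one_right by (rule eps)
  thus ?thesis by (simp add: padic_cong_iff)
qed

lemma p_ge_5: "CARD('p) \<ge> 5"
proof -
  \<comment> \<open>Here b + d \<le> b + c + d - a < p, with b \<ge> 1 and d \<ge> 2.\<close>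
  have "CARD('p) > 3" using b_pos b_less_a a_le less_p bcd by linarith
  moreover have "CARD('p) \<noteq> 4" using odd_p by auto
  ultimately show ?thesis by linarith
qed

lemma fact_unit: "k < CARD('p) \<Longrightarrow> padic_unit (fact k :: 'p padic)"
  unfolding pochhammer_fact
  by (rule pochhammer_unit[of _ 1], simp, rule not_dvd_between[of 0]) simp_all

section \<open>Divisibility of the discarded terms by p^2\<close>

context
  fixes \<alpha> \<beta> \<gamma> \<delta> :: "'p padic"
  assumes \<alpha>: "padic_cong 1 \<alpha> (of_int (- int a))"
    and \<beta>: "padic_cong 1 \<beta> (of_int (- int b))"
    and \<gamma>: "padic_cong 1 \<gamma> (of_int (- int c))"
    and \<delta>: "padic_cong 1 \<delta> (of_int (- int d))"
begin

lemma param_cong: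
  "padic_cong 1 (\<alpha> + 1) (of_int (1 - int a))"
  "padic_cong 1 (\<alpha> - \<beta> + 1) (of_int (int b - int a + 1))"
  "padic_cong 1 (\<alpha> - \<gamma> + 1) (of_int (int c - int a + 1))"
  "padic_cong 1 (\<alpha> - \<delta> + 1) (of_int (int d - int a + 1))"
  "padic_cong 1 (\<alpha> - E + 1) (of_int (int e - int a + 1))"
  "padic_cong 1 (1 - E) (of_int (1 + int e))"
  "padic_cong 1 (\<beta> + \<gamma> + \<delta> - \<alpha>) (of_int (int a - int b - int c - int d))"
proof -
  note [intro] = padic_cong_add padic_cong_diff \<alpha> \<beta> \<gamma> \<delta> eps_cong padic_cong_refl
  have "padic_cong 1 (\<alpha> + 1) (of_int (- int a) + 1)" by blast
  thus "padic_cong 1 (\<alpha> + 1) (of_int (1 - int a))" by (simp add: algebra_simps)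
  have "padic_cong 1 (\<alpha> - \<beta> + 1) (of_int (- int a) - of_int (- int b) + 1)" by blast
  thus "padic_cong 1 (\<alpha> - \<beta> + 1) (of_int (int b - int a + 1))" by (simp add: algebra_simps)
  have "padic_cong 1 (\<alpha> - \<gamma> + 1) (of_int (- int a) - of_int (- int c) + 1)" by blast
  thus "padic_cong 1 (\<alpha> - \<gamma> + 1) (of_int (int c - int a + 1))" by (simp add: algebra_simps)
  have "padic_cong 1 (\<alpha> - \<delta> + 1) (of_int (- int a) - of_int (- int d) + 1)" by blast
  thus "padic_cong 1 (\<alpha> - \<delta> + 1) (of_int (int d - int a + 1))" by (simp add: algebra_simps)
  have "padic_cong 1 (\<alpha> - E + 1) (of_int (- int a) - of_int (- int e) + 1)" by blast
  thus "padic_cong 1 (\<alpha> - E + 1) (of_int (int e - int a + 1))" by (simp add: algebra_simps)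
  have "padic_cong 1 (1 - E) (1 - of_int (- int e))" by blast
  thus "padic_cong 1 (1 - E) (of_int (1 + int e))" by (simp add: algebra_simps)
  have "padic_cong 1 (\<beta> + \<gamma> + \<delta> - \<alpha>) (of_int (- int b) + of_int (- int c) + of_int (- int d) -
      of_int (- int a))" by blast
  thus "padic_cong 1 (\<beta> + \<gamma> + \<delta> - \<alpha>) (of_int (int a - int b - int c - int d))" by
      (simp add: algebra_simps)
qed

lemma param_integral:
  "\<alpha> \<in> padic_ideal 0" "\<beta> \<in> padic_ideal 0" "\<gamma> \<in> padic_ideal 0" "\<delta> \<in> padic_ideal 0" "E \<in> padic_ideal 0"
proof -
  have "x \<in> padic_ideal 0" if "padic_cong 1 x (of_int n)" for x :: "'p padic" and n
  proof -
    have "x - of_int n \<in> padic_ideal 0"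
      using that padic_ideal_antimono[of 0 1] by (auto simp: padic_cong_iff)
    from padic_ideal_add[OF this padic_ideal_of_int[of n]] show ?thesis by simp
  qed
  thus "\<alpha> \<in> padic_ideal 0" "\<beta> \<in> padic_ideal 0" "\<gamma> \<in> padic_ideal 0" "\<delta> \<in> padic_ideal 0" "E \<in>
      padic_ideal 0"
    using \<alpha> \<beta> \<gamma> \<delta> eps_cong by blast+
qed

lemma alpha_unit: "padic_unit \<alpha>"
  by (rule padic_unit_if_cong_int[OF \<alpha>], rule not_dvd_between[of "- 1"])
     (use b_less_a a_le less_p in auto)

text \<open>Each bound on k keeps the integer representatives of the factors strictly between
  consecutive multiples of p: between -p and 0 for (\<alpha> - \<beta> + 1)_k and (\<beta> +
  \<gamma> + \<delta> - \<alpha>)_k, between 0 and p for the other three.\<close>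

lemma denominator_units:
  "k + b < a \<Longrightarrow> padic_unit (pochhammer (\<alpha> - \<beta> + 1) k)"
  "k + c < CARD('p) + a \<Longrightarrow> padic_unit (pochhammer (\<alpha> - \<gamma> + 1) k)"
  "k + d < CARD('p) + a \<Longrightarrow> padic_unit (pochhammer (\<alpha> - \<delta> + 1) k)"
  "k + e < CARD('p) + a \<Longrightarrow> padic_unit (pochhammer (\<alpha> - E + 1) k)"
  "k + a \<le> b + c + d \<Longrightarrow> padic_unit (pochhammer (\<beta> + \<gamma> + \<delta> - \<alpha>) k)"
proof -
  show "padic_unit (pochhammer (\<alpha> - \<beta> + 1) k)" if "k + b < a"
    by (rule pochhammer_unit[OF param_cong(2)], rule not_dvd_between[of "- 1"])
       (use that a_le less_p in auto)
  show "padic_unit (pochhammer (\<alpha> - \<gamma> + 1) k)" if "k + c < CARD('p) + a"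
    by (rule pochhammer_unit[OF param_cong(3)], rule not_dvd_between[of 0])
       (use that a_le in auto)
  show "padic_unit (pochhammer (\<alpha> - \<delta> + 1) k)" if "k + d < CARD('p) + a"
    by (rule pochhammer_unit[OF param_cong(4)], rule not_dvd_between[of 0])
       (use that a_le in auto)
  show "padic_unit (pochhammer (\<alpha> - E + 1) k)" if "k + e < CARD('p) + a"
    by (rule pochhammer_unit[OF param_cong(5)], rule not_dvd_between[of 0])
       (use that a_le in auto)
  show "padic_unit (pochhammer (\<beta> + \<gamma> + \<delta> - \<alpha>) k)" if "k + a \<le> b + c + d"
    by (rule pochhammer_unit[OF param_cong(7)], rule not_dvd_between[of "- 1"])
       (use that bcd in auto)
qed

lemma numerator_divisible:
  "a < k \<Longrightarrow> pochhammer \<alpha> k \<in> padic_ideal 1"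
  "b < k \<Longrightarrow> pochhammer \<beta> k \<in> padic_ideal 1"
  "c < k \<Longrightarrow> pochhammer \<gamma> k \<in> padic_ideal 1"
  "d < k \<Longrightarrow> pochhammer \<delta> k \<in> padic_ideal 1"
  "e < k \<Longrightarrow> pochhammer E k \<in> padic_ideal 1"
  using pochhammer_in_padic_ideal_1[OF \<alpha>, of a k] pochhammer_in_padic_ideal_1[OF \<beta>, of b k]
    pochhammer_in_padic_ideal_1[OF \<gamma>, of c k] pochhammer_in_padic_ideal_1[OF \<delta>, of d k]
    pochhammer_in_padic_ideal_1[OF eps_cong, of e k]
  by simp_all

text \<open>For k > a the weight and (\<alpha>)_k contribute a factor p each, so the remaining
  quotients only have to be integral. (\<beta>)_k pays for (\<alpha> - \<beta> + 1)_k, and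
  hypothesis (ii) puts the other three in the situation of
  \<open>padic_ideal_prod3_divide\<close>.\<close>

lemma whipple_7F6_term_tail:
  assumes k: "a < k" "k < CARD('p)"
    and 1: "of_nat CARD('p) / pochhammer (\<alpha> - \<beta> + 1) k \<in> padic_ideal 0"
    and 2: "k + c < CARD('p) + a \<or> of_nat CARD('p) / pochhammer (\<alpha> - \<gamma> + 1) k \<in> padic_ideal 0"
    and 3: "k + d < CARD('p) + a \<or> of_nat CARD('p) / pochhammer (\<alpha> - \<delta> + 1) k \<in> padic_ideal 0"
    and 4: "k + e < CARD('p) + a \<or> of_nat CARD('p) / pochhammer (\<alpha> - E + 1) k \<in> padic_ideal 0"
  shows "whipple_7F6_term \<alpha> \<beta> \<gamma> \<delta> E k \<in> padic_ideal 2"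
proof -
  have w: "vwp_weight \<alpha> k \<in> padic_ideal 1"
  proof -
    have "(\<alpha> / 2 + of_nat k) / (\<alpha> / 2) = (\<alpha> + 2 * of_nat k) / \<alpha>"
      using padic_unit_nonzero[OF alpha_unit] by (simp add: add_divide_distrib mult.commute)
    also have "\<dots> \<in> padic_ideal 0"
      using padic_ideal_of_nat[of "2 * k"]
      by (intro padic_ideal_divide_unit padic_ideal_add param_integral alpha_unit) simp
    finally show ?thesis
      unfolding vwp_weight_eq[OF padic_unit_nonzero[OF alpha_unit]]
      by (rule padic_ideal_mult_left) (rule numerator_divisible(1)[OF k(1)])
  qed
  have "vwp_weight \<alpha> k * pochhammer \<alpha> k \<in> padic_ideal (1 + 1)"
    by (rule padic_ideal_mult[OF w numerator_divisible(1)[OF k(1)]])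
  hence A: "vwp_weight \<alpha> k * pochhammer \<alpha> k / fact k ^ 2 \<in> padic_ideal 2"
    unfolding one_add_one by (rule padic_ideal_divide_unit[OF _ padic_unit_power[OF fact_unit[OF k(2)]]])
  have B: "pochhammer \<beta> k / pochhammer (\<alpha> - \<beta> + 1) k \<in> padic_ideal 0"
    using numerator_divisible(2)[of k] k b_less_a 1 by - (rule padic_ideal_divideI[rotated], simp_all)
  have "pochhammer \<gamma> k / pochhammer (\<alpha> - \<gamma> + 1) k * (pochhammer \<delta> k / pochhammer (\<alpha> - \<delta> + 1) k) *
     (pochhammer E k / pochhammer (\<alpha> - E + 1) k) \<in> padic_ideal 0"
  proof (rule padic_ideal_prod3_divide)
    show "padic_unit (pochhammer (\<alpha> - \<gamma> + 1) k) \<or> of_nat CARD('p) / pochhammer (\<alpha> - \<gamma> + 1) k \<in>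
        padic_ideal 0 \<and>
        pochhammer \<delta> k \<in> padic_ideal 1 \<and> pochhammer E k \<in> padic_ideal 1"
    proof (cases "k + c < CARD('p) + a")
      case False
      \<comment> \<open>Here k + c \<ge> p + a, which exceeds both b + c + d and c + e.\<close>
      hence "d < k" "e < k" using bcd ce b_pos by linarith+
      thus ?thesis using False 2 numerator_divisible by blast
    qed (use denominator_units in blast)
    show "padic_unit (pochhammer (\<alpha> - \<delta> + 1) k) \<or> of_nat CARD('p) / pochhammer (\<alpha> - \<delta> + 1) k \<in>
        padic_ideal 0 \<and>
        pochhammer \<gamma> k \<in> padic_ideal 1 \<and> pochhammer E k \<in> padic_ideal 1"
    proof (cases "k + d < CARD('p) + a")
      case False
      hence "c < k" "e < k" using bcd de b_pos by linarith+
      thus ?thesis using False 3 numerator_divisible by blast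
    qed (use denominator_units in blast)
    show "padic_unit (pochhammer (\<alpha> - E + 1) k) \<or> of_nat CARD('p) / pochhammer (\<alpha> - E + 1) k \<in>
        padic_ideal 0 \<and>
        pochhammer \<gamma> k \<in> padic_ideal 1 \<and> pochhammer \<delta> k \<in> padic_ideal 1"
    proof (cases "k + e < CARD('p) + a")
      case False
      hence "c < k" "d < k" using ce de b_pos by linarith+
      thus ?thesis using False 4 numerator_divisible by blast
    qed (use denominator_units in blast)
  qed (intro pochhammer_in_padic_ideal_0 param_integral)+
  thus ?thesis unfolding whipple_7F6_term_def by
      (intro padic_ideal_mult_right[OF padic_ideal_mult_right[OF A B]])
qed

text \<open>For k > min c d, p divides (\<beta>)_k and one of (\<gamma>)_k and (\<delta>)_k. Once
  the lower symbol (\<beta> + \<gamma> + \<delta> - \<alpha>)_k can contain a p, k exceeds both c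
  and d, and a third factor p is available. In the same way (1 - \<epsilon>)_k compensates (\<alpha>
  - \<epsilon> + 1)_k.\<close>

lemma whipple_4F3_term_tail:
  assumes k: "min c d < k" "k < CARD('p)"
    and 1: "k + e < CARD('p) + a \<or> of_nat CARD('p) / pochhammer (\<alpha> - E + 1) k \<in> padic_ideal 0"
    and 2: "k + a \<le> b + c + d \<or> of_nat CARD('p) / pochhammer (\<beta> + \<gamma> + \<delta> - \<alpha>) k \<in> padic_ideal 0"
  shows "whipple_4F3_term \<alpha> \<beta> \<gamma> \<delta> E k \<in> padic_ideal 2"
proof -
  have bk: "b < k" using k a_le b_less_a by linarith
  have A: "pochhammer (1 - E) k / pochhammer (\<alpha> - E + 1) k \<in> padic_ideal 0"
  proof (cases "k + e < CARD('p) + a")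
    case True
    thus ?thesis using denominator_units(4)[OF True] param_integral
      by (intro padic_ideal_divide_unit pochhammer_in_padic_ideal_0 padic_ideal_diff) simp_all
  next
    case False
    \<comment> \<open>\<open>pochhammer_in_padic_ideal_1\<close> asks for a representative of the
      form -j, hence 1 + e - p instead of 1 + e; the vanishing index is p - e - 1.\<close>
    have "padic_cong 1 (1 - E) (of_int (1 + int e - int CARD('p)))"
    proof -
      have "(1 - E - of_int (1 + int e)) + of_nat CARD('p) \<in> padic_ideal 1"
        by (rule padic_ideal_add[OF param_cong(6)[unfolded padic_cong_iff] p_in_padic_ideal])
      thus ?thesis by (simp add: padic_cong_iff algebra_simps)
    qed
    hence "pochhammer (1 - E) k \<in> padic_ideal 1"
      by (rule pochhammer_in_padic_ideal_1[of _ _ "CARD('p) - e - 1"])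
          (use False less_p b_pos b_less_a in \<open>simp_all add: of_nat_diff\<close>)
    thus ?thesis using False 1 by - (rule padic_ideal_divideI[rotated], simp_all)
  qed
  have B: "pochhammer \<beta> k * pochhammer \<gamma> k * pochhammer \<delta> k / pochhammer (\<beta> + \<gamma> + \<delta> - \<alpha>) k \<in>
      padic_ideal 2"
  proof (cases "k + a \<le> b + c + d")
    case True
    have "pochhammer \<beta> k * pochhammer \<gamma> k * pochhammer \<delta> k \<in> padic_ideal 2"
    proof (cases "c < k")
      case True
      have "pochhammer \<beta> k * pochhammer \<gamma> k \<in> padic_ideal (1 + 1)"
        by (intro padic_ideal_mult numerator_divisible bk True)
      thus ?thesis using pochhammer_in_padic_ideal_0[OF param_integral(4), of k]
        unfolding one_add_one by (rule padic_ideal_mult_right)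
    next
      case False
      hence "d < k" using k by linarith
      hence "pochhammer \<beta> k * pochhammer \<delta> k \<in> padic_ideal (1 + 1)"
        by (intro padic_ideal_mult numerator_divisible bk)
      from padic_ideal_mult_left[OF pochhammer_in_padic_ideal_0[OF param_integral(3), of k] this]
      show ?thesis unfolding one_add_one by (simp add: mult_ac)
    qed
    thus ?thesis by (rule padic_ideal_divide_unit[OF _ denominator_units(5)[OF True]])
  next
    case False
    hence "c < k" "d < k" using a_le by linarith+
    hence "pochhammer \<beta> k * pochhammer \<gamma> k * pochhammer \<delta> k \<in> padic_ideal (1 + 1 + 1)"
      by (intro padic_ideal_mult numerator_divisible bk)
    thus ?thesis using False 2 by - (rule padic_ideal_divideI[rotated], simp_all add: numeral_2_eq_2)
  qed
  show ?thesis unfolding whipple_4F3_term_def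
    by (rule padic_ideal_divide_unit[OF padic_ideal_mult_left[OF A B]
        padic_unit_power[OF fact_unit[OF k(2)]]])
qed

end

end

section \<open>The congruence for a terminating series\<close>

context whipple_residues begin

lemma one_minus_kappa: "of_nat a * (1 - to_fract \<kappa>) = (of_nat a - of_nat b :: 'p padic)"
  "padic_unit (1 - to_fract \<kappa>)"
proof -
  have "to_fract (of_nat a * \<kappa>) = (of_nat b :: 'p padic)" unfolding kappa by simp
  thus *: "of_nat a * (1 - to_fract \<kappa>) = (of_nat a - of_nat b :: 'p padic)"
    by (simp add: algebra_simps)
  have "(1 - to_fract \<kappa> :: 'p padic) = of_nat (a - b) / of_nat a"
    using * b_less_a by (simp add: field_simps of_nat_diff)
  thus "padic_unit (1 - to_fract \<kappa> :: 'p padic)"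
    using b_less_a a_le less_p by (simp only:) (intro padic_unit_divide padic_unit_of_nat, auto)
qed

lemma of_int_a_units: "padic_unit (of_int (int a) :: 'p padic)" "padic_unit
    (of_int (int a - int b) :: 'p padic)"
proof -
  show "padic_unit (of_int (int a) :: 'p padic)"
    using padic_unit_of_nat[of a, where 'p = 'p] b_less_a a_le less_p by simp
  have "padic_unit (of_nat (a - b) :: 'p padic)"
    using b_less_a a_le less_p by (intro padic_unit_of_nat) auto
  thus "padic_unit (of_int (int a - int b) :: 'p padic)"
    using b_less_a by (simp add: of_nat_diff)
qed

lemma morita_Gamma_unit: "padic_unit (to_fract (morita_Gamma u) :: 'p padic)"
  using not_p_dvd_morita_Gamma[OF odd_p] by (simp add: padic_unit_to_fract_iff)

lemma Gamma_factor_unit: "padic_unit (Gamma_factor a b \<alpha> \<beta> \<gamma> \<delta> :: 'p padic)"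
  unfolding Gamma_factor_def to_fract_mult
  by (intro padic_unit_mult padic_unit_divide of_int_a_units morita_Gamma_unit)

lemma alpha_beta_pochhammer:
  fixes \<alpha> \<beta> x :: "'p padic"
  assumes x: "\<alpha> = - of_nat a + of_nat CARD('p) * x" "\<beta> =
      - of_nat b + of_nat CARD('p) * (to_fract \<kappa> * x)" "x \<in> padic_ideal 0"
    and k: "a \<le> b + k" "k < CARD('p)"
  obtains u where "padic_unit u" "pochhammer (\<alpha> - \<beta> + 1) k =
      (of_nat CARD('p) * ((1 - to_fract \<kappa>) * x)) * u"
proof -
  have "of_nat CARD('p) * ((1 - to_fract \<kappa>) * x) \<in> padic_ideal 1"
    by (intro padic_ideal_mult_right p_in_padic_ideal padic_ideal_mult_left x
        padic_unit_integral one_minus_kappa)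
  hence "padic_cong 1 (\<alpha> - \<beta> + 1) (of_int (int b - int a + 1))"
    by (simp add: x(1,2) padic_cong_iff algebra_simps)
  then obtain u where u: "padic_unit u" "pochhammer (\<alpha> - \<beta> + 1) k = (\<alpha> - \<beta> + 1 + of_nat (a - b - 1)) * u"
  proof (rule pochhammer_eq_factor_times_unit)
    show "a - b - 1 < k" using k b_less_a by linarith
    show "\<not> int CARD('p) dvd int b - int a + 1 + int j" if "j < k" "j \<noteq> a - b - 1" for j
      using that k b_less_a a_le less_p by (subst small_dvd_iff) auto
  qed
  moreover have "\<alpha> - \<beta> + 1 + of_nat (a - b - 1) = of_nat CARD('p) * ((1 - to_fract \<kappa>) * x)"
    using b_less_a by (simp add: x(1,2) algebra_simps of_nat_diff)
  ultimately show thesis using that by simp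
qed

text \<open>
  For \<open>x = 1\<close> and \<open>x = 2\<close> the only factor of \<open>(\<alpha> + c + 1)\<^sub>k\<close> that can be divisible by \<open>p\<close> is
  \<open>\<alpha> + a + p = p (x + 1)\<close>, which is not divisible by \<open>p\<^sup>2\<close> since \<open>p \<ge> 5\<close>.  Other values of \<open>x\<close>
  could make it vanish.
\<close>

lemma congruence_gamma_terminating:
  fixes \<alpha> \<beta> \<gamma> \<delta> x :: "'p padic_int"
  assumes x: "x = 1 \<or> x = 2" and \<alpha>: "\<alpha> = - of_nat a + of_nat CARD('p) * x"
    and \<beta>: "\<beta> = - of_nat b + of_nat CARD('p) * (\<kappa> * x)"
    and \<gamma>: "\<gamma> = - of_nat c" and \<delta>: "of_nat CARD('p) dvd \<delta> + of_nat d"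
  shows "(\<Sum>k\<le>a. whipple_7F6_term (to_fract \<alpha>) (to_fract \<beta>) (to_fract \<gamma>) (to_fract \<delta>) E k) -
     Gamma_factor a b \<alpha> \<beta> \<gamma> \<delta> *
     (\<Sum>k\<le>min c d. whipple_4F3_term (to_fract \<alpha>) (to_fract \<beta>) (to_fract \<gamma>) (to_fract \<delta>) E k) \<in>
         padic_ideal 2"
proof -
  let ?P = "of_nat CARD('p) :: 'p padic"
  define A B D X \<omega> where "A = to_fract \<alpha>" and "B = to_fract \<beta>" and "D = to_fract \<delta>" and "X = to_fract x"
    and "\<omega> = 1 - to_fract \<kappa>"
  have C: "to_fract \<gamma> = - of_nat c" by (simp add: \<gamma>)
  have A: "A = - of_nat a + ?P * X" by (simp add: A_def X_def \<alpha>)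
  have B: "B = - of_nat b + ?P * (to_fract \<kappa> * X)" by (simp add: B_def X_def \<beta>)
  have X: "padic_unit X" "padic_unit (X + 1)"
  proof -
    obtain n where n: "n = 1 \<or> n = 2" "x = of_nat n"
      using x that[of 1] that[of 2] by auto
    have "X = of_nat n" "X + 1 = of_nat (n + 1)" by (simp_all add: X_def n(2))
    thus "padic_unit X" "padic_unit (X + 1)"
      using n(1) p_ge_5 by (simp_all only:) (rule padic_unit_of_nat; auto)+
  qed
  have X0: "X \<in> padic_ideal 0" by (simp add: X_def)
  have p1: "?P * y \<in> padic_ideal 1" if "y \<in> padic_ideal 0" for y
    using that by (intro padic_ideal_mult_right p_in_padic_ideal)
  have Ac: "padic_cong 1 A (of_int (- int a))"
    using p1[OF X0] by (simp add: A padic_cong_iff)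
  have Bc: "padic_cong 1 B (of_int (- int b))"
    using p1[OF padic_ideal_mult_left[OF to_fract_padic_ideal_0 X0], of \<kappa>] by
        (simp add: B padic_cong_iff)
  have Cc: "padic_cong 1 (- of_nat c :: 'p padic) (of_int (- int c))" by simp
  have Dc: "padic_cong 1 D (of_int (- int d))"
  proof -
    have "to_fract (\<delta> + of_nat d) \<in> (padic_ideal 1 :: 'p padic set)"
      unfolding to_fract_in_padic_ideal_iff power_one_right by (rule \<delta>)
    thus ?thesis by (simp add: padic_cong_iff D_def)
  qed
  note pc = param_cong[OF Ac Bc Cc Dc]
  note du = denominator_units[OF Ac Bc Cc Dc]
  have c_small: "c + d < CARD('p) + a" using bcd by linarith
  have ABu: "\<exists>u. padic_unit u \<and> pochhammer (A - B + 1) k =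
      (?P * (\<omega> * X)) * u" if "a \<le> b + k" "k < CARD('p)" for k
    using alpha_beta_pochhammer[OF A B X0 that] unfolding \<omega>_def by metis
  have \<omega>: "padic_unit (\<omega> * X)" unfolding \<omega>_def by (intro padic_unit_mult one_minus_kappa X)
  have AB: "?P / pochhammer (A - B + 1) k \<in> padic_ideal 0" "pochhammer (A - B + 1) k \<noteq> 0"
    if k: "a \<le> b + k" "k < CARD('p)" for k
    using ABu[OF k] p_divide_pochhammer_integral[OF _ \<omega>] by blast+
  have AC: "?P / pochhammer (A - (- of_nat c) + 1) k \<in> padic_ideal 0" "pochhammer (A - (- of_nat c) +
      1) k \<noteq> 0"
    if k: "\<not> k + c < CARD('p) + a" "k < CARD('p)" for k
  proof -
    obtain u where u: "padic_unit u" "pochhammer (A - (- of_nat c) + 1) k =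
        (A - (- of_nat c) + 1 + of_nat (CARD('p) + a - c - 1)) * u"
    proof (rule pochhammer_eq_factor_times_unit[OF pc(3)])
      show "CARD('p) + a - c - 1 < k" using k less_p by linarith
      show "\<not> int CARD('p) dvd int c - int a + 1 + int j" if "j < k" "j \<noteq> CARD('p) + a - c - 1" for j
      proof -
        \<comment> \<open>The representatives lie strictly between 0 and 2p, so after subtracting p
          they are smaller than p in absolute value.\<close>
        have "\<not> int CARD('p) dvd int c - int a + 1 + int j - int CARD('p)"
          using that k a_le less_p b_less_a by (subst small_dvd_iff) auto
        thus ?thesis by (metis dvd_refl dvd_diff)
      qed
    qed
    have "A - (- of_nat c) + 1 + of_nat (CARD('p) + a - c - 1) = ?P * (X + 1)"
      using less_p b_less_a by (simp add: A of_nat_diff algebra_simps)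
    note p_divide_pochhammer_integral[OF u(2)[unfolded this] X(2) u(1)]
    thus "?P / pochhammer (A - (- of_nat c) + 1) k \<in> padic_ideal 0" "pochhammer (A - (- of_nat c) + 1)
        k \<noteq> 0" by blast+
  qed
  \<comment> \<open>Whipple's transformation concerns the sums up to the terminating index c, so the
    terms beyond a on the left and beyond min c d on the right have to be discarded first.\<close>
  have sum7: "(\<Sum>k\<le>c. whipple_7F6_term A B (- of_nat c) D E k) -
      (\<Sum>k\<le>a. whipple_7F6_term A B (- of_nat c) D E k) \<in> padic_ideal 2"
  proof -
    have "(\<Sum>k\<le>c. whipple_7F6_term A B (- of_nat c) D E k) -
        (\<Sum>k\<le>a. whipple_7F6_term A B (- of_nat c) D E k) =
        (\<Sum>k\<in>{..c} - {..a}. whipple_7F6_term A B (- of_nat c) D E k)"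
      using a_le by (subst sum_diff) auto
    also have "\<dots> \<in> padic_ideal 2"
    proof (rule padic_ideal_sum)
      fix k assume k: "k \<in> {..c} - {..a}"
      show "whipple_7F6_term A B (- of_nat c) D E k \<in> padic_ideal 2"
        by (rule whipple_7F6_term_tail[OF Ac Bc Cc Dc]) (use k AB(1)[of k] AC(1)[of k] less_p ce
            c_small in auto)
    qed
    finally show ?thesis .
  qed
  have sum4: "(\<Sum>k\<le>c. whipple_4F3_term A B (- of_nat c) D E k) -
      (\<Sum>k\<le>min c d. whipple_4F3_term A B (- of_nat c) D E k) \<in> padic_ideal 2"
  proof -
    have "(\<Sum>k\<le>c. whipple_4F3_term A B (- of_nat c) D E k) -
        (\<Sum>k\<le>min c d. whipple_4F3_term A B (- of_nat c) D E k) =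
        (\<Sum>k\<in>{..c} - {..min c d}. whipple_4F3_term A B (- of_nat c) D E k)"
      by (subst sum_diff) auto
    also have "\<dots> \<in> padic_ideal 2"
    proof (rule padic_ideal_sum)
      fix k assume k: "k \<in> {..c} - {..min c d}"
      show "whipple_4F3_term A B (- of_nat c) D E k \<in> padic_ideal 2"
        by (rule whipple_4F3_term_tail[OF Ac Bc Cc Dc]) (use k less_p ce a_le in auto)
    qed
    finally show ?thesis .
  qed
  define W where "W = pochhammer (A + 1) c * pochhammer (A - B - D + 1) c /
      (pochhammer (A - B + 1) c * pochhammer (A - D + 1) c)"
  have whipple: "(\<Sum>k\<le>c. whipple_7F6_term A B (- of_nat c) D E k) =
      W * (\<Sum>k\<le>c. whipple_4F3_term A B (- of_nat c) D E k)"
  proof -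
    \<comment> \<open>In \<open>whipple_7F6_4F3\<close> the expanded pair is the second \<alpha>
      together with \<epsilon>, which turns a - b - c + 1 into 1 - \<epsilon> and a - b + 1 into 1.
      \<beta> and \<delta> take the places of d and e, and \<gamma> = -c terminates the
      series.\<close>
    have nz: "pochhammer (A - A + 1) c \<noteq> 0" "pochhammer (A - E + 1) c \<noteq> 0" "pochhammer (A - B + 1) c \<noteq> 0"
      "pochhammer (A - D + 1) c \<noteq> 0" "pochhammer (A + of_nat c + 1) c \<noteq> 0" "pochhammer (B + D - A -
          of_nat c) c \<noteq> 0"
      using du(4)[of c, THEN padic_unit_nonzero] AB(2)[of c] du(3)[of c, THEN padic_unit_nonzero]
        du(2)[of c, THEN padic_unit_nonzero] AC(2)[of c] du(5)[of c, THEN padic_unit_nonzero]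
        less_p ce c_small a_le
      by (auto simp: pochhammer_fact[symmetric] algebra_simps)
    have t7: "vwp_weight A k / fact k * (pochhammer A k * pochhammer E k / (pochhammer (A - A + 1) k *
        pochhammer (A - E + 1) k)) *
            (pochhammer B k * pochhammer D k * pochhammer (- of_nat c) k /
              (pochhammer (A - B + 1) k * pochhammer (A - D + 1) k * pochhammer (A + of_nat c + 1) k)) =
        whipple_7F6_term A B (- of_nat c) D E k" for k
      by (simp add: whipple_7F6_term_def pochhammer_fact[symmetric] power2_eq_square mult_ac)
    have t4: "pochhammer (A - A - E + 1) k * pochhammer B k * pochhammer D k * pochhammer (- of_nat c)
        k /
            (fact k * pochhammer (A - A + 1) k * pochhammer (A - E + 1) k * pochhammer (B + D - A -
                of_nat c) k) =
        whipple_4F3_term A B (- of_nat c) D E k" for k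
    proof -
      have "A - A - E + 1 = 1 - E" "B + D - A - of_nat c = B + - of_nat c + D - A" by simp_all
      thus ?thesis by (simp only: whipple_4F3_term_def) (simp add: pochhammer_fact[symmetric]
          power2_eq_square mult_ac)
    qed
    show ?thesis using whipple_7F6_4F3[OF nz] unfolding t7 t4 W_def .
  qed
  \<comment> \<open>Because \<gamma> = -c, the eight arguments of Gamma_p form four pairs u, u + c,
    and each pair yields a symbol (u)_c. For u = \<alpha> + 1 and u = \<alpha> - \<beta> + 1 the
    skipped factors are p x and (1 - \<kappa>) p x; their quotient 1 - \<kappa> is cancelled by a/(a
    - b).\<close>
  have Q: "Gamma_factor a b \<alpha> \<beta> \<gamma> \<delta> = W"
  proof -
    let ?g = "\<lambda>u. to_fract (morita_Gamma u) :: 'p padic"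
    have g0: "?g u \<noteq> 0" for u
      using not_p_dvd_morita_Gamma[OF odd_p, of u] by auto
    have dv: "of_nat CARD('p) dvd u + of_nat j \<longleftrightarrow> n + int j = 0"
      if "padic_cong 1 (to_fract u) (of_int n)" "\<bar>n + int j\<bar> < int CARD('p)" for u :: "'p padic_int"
          and n j
      unfolding p_dvd_plus_of_nat_iff[OF that(1)] small_dvd_iff[OF that(2)] ..
    have c1: "padic_cong 1 (to_fract (\<alpha> + 1)) (of_int (1 - int a))" using pc(1) by (simp add: A_def)
    have c2: "padic_cong 1 (to_fract (\<alpha> - \<beta> + 1)) (of_int (int b - int a + 1))" using pc(2) by
        (simp add: A_def B_def)
    have c3: "padic_cong 1 (to_fract (\<alpha> - \<delta> + 1)) (of_int (int d - int a + 1))" using pc(4) by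
        (simp add: A_def D_def)
    have c4: "padic_cong 1 (to_fract (\<alpha> - \<beta> - \<delta> + 1)) (of_int (int b - int a + 1 + int d))"
      using padic_cong_diff[OF pc(2) Dc] by (simp add: A_def B_def D_def algebra_simps)
    have "morita_Gamma (\<alpha> + 1 + of_nat c) * (\<alpha> + 1 + of_nat (a - 1)) =
        (-1) ^ c * pochhammer (\<alpha> + 1) c * morita_Gamma (\<alpha> + 1)"
      by (rule morita_Gamma_plus_of_nat_skip[OF odd_p], subst dv[OF c1]) (use a_le b_less_a less_p in
          auto)
    moreover have "\<alpha> + 1 + of_nat (a - 1) =
        of_nat CARD('p) * x" using b_less_a by (simp add: \<alpha> of_nat_diff)
    ultimately have "to_fract (morita_Gamma (\<alpha> + 1 + of_nat c) * (of_nat CARD('p) * x)) =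
        (to_fract ((-1) ^ c * pochhammer (\<alpha> + 1) c * morita_Gamma (\<alpha> + 1)) :: 'p padic)"
      by simp
    hence e1: "?g (\<alpha> + 1 + of_nat c) * (?P * X) = (-1) ^ c * pochhammer (A + 1) c * ?g (\<alpha> + 1)"
      by (simp add: to_fract_power to_fract_pochhammer A_def X_def)
    have "morita_Gamma (\<alpha> - \<beta> + 1 + of_nat c) * (\<alpha> - \<beta> + 1 + of_nat (a - b - 1)) =
        (-1) ^ c * pochhammer (\<alpha> - \<beta> + 1) c * morita_Gamma (\<alpha> - \<beta> + 1)"
      by (rule morita_Gamma_plus_of_nat_skip[OF odd_p], subst dv[OF c2])
          (use a_le b_less_a less_p b_pos in auto)
    moreover have "\<alpha> - \<beta> + 1 + of_nat (a - b - 1) = of_nat CARD('p) * ((1 - \<kappa>) * x)"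
      using b_less_a by (simp add: \<alpha> \<beta> of_nat_diff algebra_simps)
    ultimately have "to_fract (morita_Gamma (\<alpha> - \<beta> + 1 + of_nat c) *
        (of_nat CARD('p) * ((1 - \<kappa>) * x))) =
        (to_fract ((-1) ^ c * pochhammer (\<alpha> - \<beta> + 1) c * morita_Gamma (\<alpha> - \<beta> + 1)) :: 'p padic)"
      by simp
    hence e2: "?g (\<alpha> - \<beta> + 1 + of_nat c) * (?P * (\<omega> * X)) =
        (-1) ^ c * pochhammer (A - B + 1) c * ?g (\<alpha> - \<beta> + 1)"
      by (simp add: to_fract_power to_fract_pochhammer A_def B_def X_def \<omega>_def)
    have "morita_Gamma (\<alpha> - \<delta> + 1 + of_nat c) =
        (-1) ^ c * pochhammer (\<alpha> - \<delta> + 1) c * morita_Gamma (\<alpha> - \<delta> + 1)"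
      by (rule morita_Gamma_plus_of_nat[OF odd_p], subst dv[OF c3]) (use a_le b_less_a less_p c_small
          in auto)
    hence e3: "?g (\<alpha> - \<delta> + 1 + of_nat c) = (-1) ^ c * pochhammer (A - D + 1) c * ?g (\<alpha> - \<delta> + 1)"
      by (simp add: to_fract_power to_fract_pochhammer A_def D_def)
    have "morita_Gamma (\<alpha> - \<beta> - \<delta> + 1 + of_nat c) = (-1) ^ c * pochhammer (\<alpha> - \<beta> - \<delta> + 1) c *
        morita_Gamma (\<alpha> - \<beta> - \<delta> + 1)"
      by (rule morita_Gamma_plus_of_nat[OF odd_p], subst dv[OF c4]) (use a_le b_less_a less_p bcd in
          auto)
    hence e4: "?g (\<alpha> - \<beta> - \<delta> + 1 + of_nat c) = (-1) ^ c * pochhammer (A - B - D + 1) c *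
        ?g (\<alpha> - \<beta> - \<delta> + 1)"
      by (simp add: to_fract_power to_fract_pochhammer A_def B_def D_def)
    have arg: "\<alpha> - \<gamma> + 1 = \<alpha> + 1 + of_nat c" "\<alpha> - \<beta> - \<gamma> - \<delta> + 1 = \<alpha> - \<beta> - \<delta> + 1 + of_nat c"
      "\<alpha> - \<beta> - \<gamma> + 1 = \<alpha> - \<beta> + 1 + of_nat c" "\<alpha> - \<gamma> - \<delta> + 1 = \<alpha> - \<delta> + 1 + of_nat c"
      by (simp_all add: \<gamma> algebra_simps)
    define s :: "'p padic" where "s = (-1) ^ c"
    have s: "s \<noteq> 0" by (simp add: s_def)
    have nz: "?P * X \<noteq> 0" "?P * (\<omega> * X) \<noteq> 0" using padic_unit_nonzero[OF X(1)]
        padic_unit_nonzero[OF \<omega>] by auto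
    have f1: "?g (\<alpha> + 1 + of_nat c) = s * pochhammer (A + 1) c * ?g (\<alpha> + 1) / (?P * X)"
      using e1 nz(1) unfolding s_def by (simp add: eq_divide_eq)
    have f2: "?g (\<alpha> - \<beta> + 1 + of_nat c) = s * pochhammer (A - B + 1) c * ?g (\<alpha> - \<beta> + 1) / (?P * (\<omega> * X))"
      using e2 nz(2) unfolding s_def by (simp add: eq_divide_eq)
    have ab: "(of_int (int a) / of_int (int a - int b) :: 'p padic) = inverse \<omega>"
    proof -
      have "(of_nat a :: 'p padic) \<noteq> 0" "\<omega> \<noteq> 0" using b_less_a padic_unit_nonzero[OF \<omega>] by auto
      thus ?thesis using one_minus_kappa(1) b_less_a unfolding \<omega>_def[symmetric] by
          (simp add: field_simps)
    qed
    have "Gamma_factor a b \<alpha> \<beta> \<gamma> \<delta> = inverse \<omega> *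
       (?g (\<alpha> - \<beta> + 1) * (s * pochhammer (A + 1) c * ?g (\<alpha> + 1) / (?P * X)) *
                ?g (\<alpha> - \<delta> + 1) * (s * pochhammer (A - B - D + 1) c * ?g (\<alpha> - \<beta> - \<delta> + 1)) /
      (?g (\<alpha> + 1) * (s * pochhammer (A - B + 1) c * ?g (\<alpha> - \<beta> + 1) / (?P * (\<omega> * X))) *
                ?g (\<alpha> - \<beta> - \<delta> + 1) * (s * pochhammer (A - D + 1) c * ?g (\<alpha> - \<delta> + 1))))"
      unfolding Gamma_factor_def ab arg to_fract_mult f1 f2 e3 e4 s_def[symmetric] ..
    also have "\<dots> = W"
      unfolding W_def using g0 s nz by (simp add: field_simps)
    finally show ?thesis .
  qed
  have W: "W \<in> padic_ideal 0"
    unfolding Q[symmetric] by (rule padic_unit_integral[OF Gamma_factor_unit])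
  \<comment> \<open>By Whipple's identity for the sums up to c, the difference in question is W
    times the discarded 4F3 terms minus the discarded 7F6 terms.\<close>
  have "W * ((\<Sum>k\<le>c. whipple_4F3_term A B (- of_nat c) D E k) -
      (\<Sum>k\<le>min c d. whipple_4F3_term A B (- of_nat c) D E k))
      - ((\<Sum>k\<le>c. whipple_7F6_term A B (- of_nat c) D E k) -
          (\<Sum>k\<le>a. whipple_7F6_term A B (- of_nat c) D E k)) \<in> padic_ideal 2"
    by (intro padic_ideal_diff[OF padic_ideal_mult_left[OF W sum4] sum7])
  thus ?thesis
    unfolding Q C A_def[symmetric] B_def[symmetric] D_def[symmetric] whipple by (simp add: algebra_simps)
qed

lemma congruence_delta_terminating:
  fixes \<alpha> \<beta> \<gamma> \<delta> x :: "'p padic_int"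
  assumes "x = 1 \<or> x = 2" "\<alpha> = - of_nat a + of_nat CARD('p) * x"
    "\<beta> = - of_nat b + of_nat CARD('p) * (\<kappa> * x)"
    "\<delta> = - of_nat d" "of_nat CARD('p) dvd \<gamma> + of_nat c"
  shows "(\<Sum>k\<le>a. whipple_7F6_term (to_fract \<alpha>) (to_fract \<beta>) (to_fract \<gamma>) (to_fract \<delta>) E k) -
     Gamma_factor a b \<alpha> \<beta> \<gamma> \<delta> *
     (\<Sum>k\<le>min c d. whipple_4F3_term (to_fract \<alpha>) (to_fract \<beta>) (to_fract \<gamma>) (to_fract \<delta>) E k) \<in>
         padic_ideal 2"
proof -
  interpret swap: whipple_residues a b d c e \<kappa> \<epsilon>
    using odd_p b_pos b_less_a a_le less_p ce de bcd kappa eps by unfold_locales auto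
  show ?thesis
    using swap.congruence_gamma_terminating[OF assms]
    by (simp add: whipple_7F6_term_commute[of _ _ "to_fract \<delta>"] whipple_4F3_term_commute[of _ _
        "to_fract \<delta>"] Gamma_factor_commute[of _ _ _ _ \<delta>] min.commute[of d])
qed

end

section \<open>Cancellation of the pole\<close>

lemma pochhammer_reflect:
  fixes x :: "'a :: field_char_0"
  assumes "k \<le> n"
  shows "pochhammer x (n - k) * pochhammer (1 - of_nat n - x) k = (-1) ^ k * pochhammer x n"
proof -
  have "pochhammer (1 - of_nat n - x) k = (-1) ^ k * pochhammer (x + of_nat (n - k)) k"
    using pochhammer_minus[of "of_nat n + x - 1" k] assms by (simp add: of_nat_diff algebra_simps)
  thus ?thesis
    using pochhammer_split[of "n - k" n x] assms by simp
qed

text \<open>For \<alpha> = -n the well-poised partner \<alpha> - x + 1 of x is 1 - n - x, so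
  reversing the summation changes such a quotient only by the sign (-1)^n.\<close>

lemma pochhammer_ratio_reflect:
  fixes x :: "'a :: field_char_0"
  assumes "k \<le> n" "pochhammer x n \<noteq> 0"
  shows "pochhammer x (n - k) / pochhammer (1 - of_nat n - x) (n - k) =
         (-1) ^ n * (pochhammer x k / pochhammer (1 - of_nat n - x) k)"
proof -
  let ?y = "1 - of_nat n - x"
  have 1: "pochhammer x (n - k) * pochhammer ?y k = (-1) ^ k * pochhammer x n"
    by (rule pochhammer_reflect[OF assms(1)])
  have 2: "pochhammer x k * pochhammer ?y (n - k) = (-1) ^ (n - k) * pochhammer x n"
    using pochhammer_reflect[of "n - k" n x] assms(1) by simp
  have nz: "pochhammer ?y k \<noteq> 0" "pochhammer ?y (n - k) \<noteq> 0" using 1 2 assms(2) by auto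
  have s: "(-1 :: 'a) ^ n * (-1) ^ (n - k) = (-1) ^ k"
  proof -
    have "(-1 :: 'a) ^ n = (-1) ^ k * (-1) ^ (n - k)" using assms(1) by (simp flip: power_add)
    thus ?thesis by (simp add: mult.assoc flip: power_mult_distrib)
  qed
  have "pochhammer x (n - k) * pochhammer ?y k = (-1) ^ n * (pochhammer x k * pochhammer ?y (n - k))"
    unfolding 1 2 s[symmetric] by (simp add: mult.assoc)
  thus ?thesis using nz by (simp add: field_simps)
qed

lemma p2_affine_morita_Gamma3:
  assumes "odd CARD('p :: prime_card)"
    "\<And>v. F v = u + of_nat CARD('p) * (B0 * v 0 + B1 * v 1 + B2 * v 2)"
  shows "p2_affine (\<lambda>v. to_fract (morita_Gamma (F v)) :: 'p padic)"
proof (rule p2_affine_morita_Gamma[OF assms(1)])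
  fix v
  have "(\<Sum>i<3. (if i = 0 then B0 else if i = 1 then B1 else B2) * v i) =
      B0 * v 0 + B1 * v 1 + B2 * v (2 :: nat)"
    by (simp add: numeral_3_eq_3 numeral_2_eq_2)
  thus "F v = u + of_nat CARD('p) * (\<Sum>i<3. (if i = 0 then B0 else if i = 1 then B1 else B2) * v i)"
    by (simp add: assms(2))
qed

section \<open>The parameters as functions of x, y, z\<close>

context whipple_residues
begin

definition alpha :: "(nat \<Rightarrow> 'p padic_int) \<Rightarrow> 'p padic_int" where
  "alpha v = - of_nat a + of_nat CARD('p) * v 0"
definition beta :: "(nat \<Rightarrow> 'p padic_int) \<Rightarrow> 'p padic_int" where
  "beta v = - of_nat b + of_nat CARD('p) * (\<kappa> * v 0)"
definition gamma :: "(nat \<Rightarrow> 'p padic_int) \<Rightarrow> 'p padic_int" where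
  "gamma v = - of_nat c + of_nat CARD('p) * v 1"
definition delta :: "(nat \<Rightarrow> 'p padic_int) \<Rightarrow> 'p padic_int" where
  "delta v = - of_nat d + of_nat CARD('p) * v 2"

abbreviation "A v \<equiv> to_fract (alpha v)"
abbreviation "B v \<equiv> to_fract (beta v)"
abbreviation "C v \<equiv> to_fract (gamma v)"
abbreviation "D v \<equiv> to_fract (delta v)"

lemma padic_cong_1_shift: "padic_cong 1 (to_fract (- of_nat n + of_nat CARD('p) * z) :: 'p padic)
    (of_int (- int n))"
proof -
  have "of_nat CARD('p) * to_fract z \<in> (padic_ideal 1 :: 'p padic set)"
    by (intro padic_ideal_mult_right p_in_padic_ideal) simp
  thus ?thesis by (simp add: padic_cong_iff)
qed

lemma param_v_cong:
  "padic_cong 1 (A v) (of_int (- int a))" "padic_cong 1 (B v) (of_int (- int b))"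
  "padic_cong 1 (C v) (of_int (- int c))" "padic_cong 1 (D v) (of_int (- int d))"
  unfolding alpha_def beta_def gamma_def delta_def by (rule padic_cong_1_shift)+

lemmas units = denominator_units[OF param_v_cong[of v]] for v

lemma param_v_quot:
  "p2_affine_quot A" "p2_affine_quot B" "p2_affine_quot C" "p2_affine_quot D"
proof -
  have k: "of_nat CARD('p) * (to_fract \<kappa> * to_fract (v 0)) =
      to_fract \<kappa> * (of_nat CARD('p) * to_fract (v 0) :: 'p padic)" for v :: "nat \<Rightarrow> 'p padic_int"
    by simp
  note i = p2_affine_quot_intros padic_ideal_uminus padic_ideal_of_nat to_fract_padic_ideal_0
  show "p2_affine_quot A"
    unfolding alpha_def to_fract_add to_fract_mult to_fract_uminus to_fract_of_nat by (intro i) simp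
  show "p2_affine_quot B"
    unfolding beta_def to_fract_add to_fract_mult to_fract_uminus to_fract_of_nat k by (intro i) simp
  show "p2_affine_quot C"
    unfolding gamma_def to_fract_add to_fract_mult to_fract_uminus to_fract_of_nat by (intro i) simp
  show "p2_affine_quot D"
    unfolding delta_def to_fract_add to_fract_mult to_fract_uminus to_fract_of_nat by (intro i) simp
qed

lemma p2_affine_Gamma_factor:
  "p2_affine (\<lambda>v. Gamma_factor a b (alpha v) (beta v) (gamma v) (delta v) :: 'p padic)"
proof -
  note d = alpha_def beta_def gamma_def delta_def
  note G = p2_affine_morita_Gamma3[OF odd_p]
  have g1: "p2_affine (\<lambda>v. to_fract (morita_Gamma (alpha v - beta v + 1)) :: 'p padic)"
    by (rule G[of _ "1 - of_nat a + of_nat b" "1 - \<kappa>" 0 0]) (simp add: d algebra_simps)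
  have g2: "p2_affine (\<lambda>v. to_fract (morita_Gamma (alpha v - gamma v + 1)) :: 'p padic)"
    by (rule G[of _ "1 - of_nat a + of_nat c" 1 "- 1" 0]) (simp add: d algebra_simps)
  have g3: "p2_affine (\<lambda>v. to_fract (morita_Gamma (alpha v - delta v + 1)) :: 'p padic)"
    by (rule G[of _ "1 - of_nat a + of_nat d" 1 0 "- 1"]) (simp add: d algebra_simps)
  have g4: "p2_affine (\<lambda>v. to_fract (morita_Gamma (alpha v - beta v - gamma v - delta v + 1)) :: 'p
      padic)"
    by (rule G[of _ "1 - of_nat a + of_nat b + of_nat c + of_nat d" "1 - \<kappa>" "- 1" "- 1"])
        (simp add: d algebra_simps)
  have g5: "p2_affine (\<lambda>v. to_fract (morita_Gamma (alpha v + 1)) :: 'p padic)"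
    by (rule G[of _ "1 - of_nat a" 1 0 0]) (simp add: d algebra_simps)
  have g6: "p2_affine (\<lambda>v. to_fract (morita_Gamma (alpha v - beta v - gamma v + 1)) :: 'p padic)"
    by (rule G[of _ "1 - of_nat a + of_nat b + of_nat c" "1 - \<kappa>" "- 1" 0]) (simp add: d algebra_simps)
  have g7: "p2_affine (\<lambda>v. to_fract (morita_Gamma (alpha v - beta v - delta v + 1)) :: 'p padic)"
    by (rule G[of _ "1 - of_nat a + of_nat b + of_nat d" "1 - \<kappa>" 0 "- 1"]) (simp add: d algebra_simps)
  have g8: "p2_affine (\<lambda>v. to_fract (morita_Gamma (alpha v - gamma v - delta v + 1)) :: 'p padic)"
    by (rule G[of _ "1 - of_nat a + of_nat c + of_nat d" 1 "- 1" "- 1"]) (simp add: d algebra_simps)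
  show ?thesis
    unfolding Gamma_factor_def to_fract_mult
    by (intro p2_affine_mult p2_affine_divide p2_affine_const g1 g2 g3 g4 g5 g6 g7 g8
        padic_unit_mult padic_unit_divide morita_Gamma_unit of_int_a_units padic_ideal_of_int)
qed

lemma p2_affine_whipple_4F3_term:
  assumes "k \<le> min c d"
  shows "p2_affine (\<lambda>v. whipple_4F3_term (A v) (B v) (C v) (D v) E k)"
proof -
  have "padic_unit (pochhammer (A v - E + 1) k)" for v
    by (rule units) (use assms ce de in linarith)
  moreover have "padic_unit (pochhammer (B v + C v + D v - A v) k)" for v
    by (rule units) (use assms a_le b_pos in linarith)
  moreover have "padic_unit (fact k :: 'p padic)" using assms less_p by (intro fact_unit) auto
  \<comment> \<open>The closure rules for Pochhammer symbols and powers are stated for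
    \<open>p2_affine_quot\<close>, which implies \<open>p2_affine\<close>.\<close>
  ultimately have "p2_affine_quot (\<lambda>v. whipple_4F3_term (A v) (B v) (C v) (D v) E k)"
    unfolding whipple_4F3_term_def
    by (intro p2_affine_quot_mult p2_affine_quot_divide p2_affine_quot_pochhammer p2_affine_quot_add
        p2_affine_quot_diff p2_affine_quot_power p2_affine_quot_const param_v_quot padic_unit_power
        padic_ideal_one to_fract_padic_ideal_0 padic_unit_integral)
  thus ?thesis by (rule p2_affine_quotD)
qed

text \<open>
  The summand of the left-hand side is \<open>regular_part * polar_part / (p\<cdot>v 0)\<close>: for \<open>k \<ge> a - b\<close> the
  factor \<open>\<alpha> - \<beta> + a - b = (1 - \<kappa>) p\<cdot>v 0\<close> has been taken out of \<open>(\<alpha> - \<beta> + 1)\<^sub>k\<close>.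
\<close>

definition regular_part :: "nat \<Rightarrow> (nat \<Rightarrow> 'p padic_int) \<Rightarrow> 'p padic" where
  "regular_part k v = vwp_weight (A v) k * pochhammer (A v) k / fact k ^ 2 *
     (pochhammer (C v) k / pochhammer (A v - C v + 1) k *
         (pochhammer (D v) k / pochhammer (A v - D v + 1) k) *
     (pochhammer E k / pochhammer (A v - E + 1) k))"

definition polar_part :: "nat \<Rightarrow> (nat \<Rightarrow> 'p padic_int) \<Rightarrow> 'p padic" where
  "polar_part k v = pochhammer (B v) k *
     (if k < a - b then of_nat CARD('p) * to_fract (v 0) / pochhammer (A v - B v + 1) k
      else 1 / ((1 - to_fract \<kappa>) * pochhammer (A v - B v + 1) (a - b - 1) * pochhammer (A v - B v +
          1 + of_nat (a - b)) (k - (a - b))))"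

text \<open>Past the factor with index a - b - 1 the integer representatives start again at 1 and,
  for k \<le> a, do not exceed b, which is less than p.\<close>

lemma pochhammer_shifted_unit:
  assumes "k \<le> a"
  shows "padic_unit (pochhammer (A v - B v + 1 + of_nat (a - b)) (k - (a - b)))"
proof (rule pochhammer_unit)
  show "padic_cong 1 (A v - B v + 1 + of_nat (a - b)) (of_int (int b - int a + 1 + int (a - b)))"
    using padic_cong_add[OF param_cong(2)[OF param_v_cong] padic_cong_refl[of _ "of_nat (a - b)"], of
        v] by simp
  show "\<not> int CARD('p) dvd int b - int a + 1 + int (a - b) + int j" if "j < k - (a - b)" for j
    by (rule not_dvd_between[of 0]) (use that assms b_less_a a_le less_p in auto)
qed

lemma whipple_7F6_term_split:
  assumes "v 0 \<noteq> 0"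
  shows "whipple_7F6_term (A v) (B v) (C v) (D v) E k =
      regular_part k v * polar_part k v / (of_nat CARD('p) * to_fract (v 0))"
proof -
  have nz: "of_nat CARD('p) * to_fract (v 0) \<noteq> (0 :: 'p padic)" using assms by simp
  show ?thesis
  proof (cases "k < a - b")
    case True
    thus ?thesis using nz by (simp add: whipple_7F6_term_def regular_part_def polar_part_def mult_ac)
  next
    case False
    have k: "k = Suc (a - b - 1) + (k - (a - b))" using False b_less_a by simp
    have AB: "A v - B v + 1 + of_nat (a - b - 1) = (1 - to_fract \<kappa>) * (of_nat CARD('p) * to_fract (v 0))"
      using b_less_a by (simp add: alpha_def beta_def of_nat_diff algebra_simps)
    have "pochhammer (A v - B v + 1) k = pochhammer (A v - B v + 1) (Suc (a - b - 1)) *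
        pochhammer (A v - B v + 1 + of_nat (Suc (a - b - 1))) (k - (a - b))"
      by (subst k, rule pochhammer_product')
    also have Suc: "Suc (a - b - 1) = a - b" using b_less_a by simp
    also have "pochhammer (A v - B v + 1) (a - b) = pochhammer (A v - B v + 1) (a - b - 1) *
        ((1 - to_fract \<kappa>) * (of_nat CARD('p) * to_fract (v 0)))"
      by (rule pochhammer_Suc[of "A v - B v + 1" "a - b - 1", unfolded Suc AB])
    finally show ?thesis using False nz
      by (simp add: whipple_7F6_term_def regular_part_def polar_part_def mult_ac)
  qed
qed

text \<open>With the factor (1 - \<kappa>) p x taken out, all remaining denominators are units for k
  \<le> a, so the closure rules apply.\<close>

lemma p2_affine_quot_parts:
  assumes "k \<le> a"
  shows "p2_affine_quot (\<lambda>v. regular_part k v * polar_part k v)"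
proof -
  have u: "padic_unit (pochhammer (A v - C v + 1) k)" "padic_unit (pochhammer (A v - D v + 1) k)"
      "padic_unit (pochhammer (A v - E + 1) k)" "padic_unit (pochhammer (A v - B v + 1) (a - b - 1))"
      "padic_unit (fact k :: 'p padic)" for v
    by (rule units fact_unit, use assms less_p a_le b_less_a in linarith)+
  note r = p2_affine_quot_mult p2_affine_quot_divide p2_affine_quot_pochhammer p2_affine_quot_add
        p2_affine_quot_diff p2_affine_quot_power p2_affine_quot_const param_v_quot padic_unit_power
        padic_ideal_one to_fract_padic_ideal_0 padic_unit_integral padic_ideal_of_nat
  have "p2_affine_quot (regular_part k)"
    unfolding regular_part_def vwp_weight_def by (intro r u)
  moreover have "p2_affine_quot (polar_part k)"
  proof (cases "k < a - b")
    case True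
    hence "padic_unit (pochhammer (A v - B v + 1) k)" for v by (intro units) linarith
    thus ?thesis using True unfolding polar_part_def by (simp only: if_True)
        (intro r p2_affine_quot_var, auto)
  next
    case False
    show ?thesis using False unfolding polar_part_def
      by (simp only: if_False) (intro r u padic_unit_mult one_minus_kappa pochhammer_shifted_unit assms)
  qed
  ultimately show ?thesis by (rule p2_affine_quot_mult)
qed

text \<open>At x = 0 one has \<alpha> = -a and \<beta> = -b. The weight part changes sign under k ->
  a - k; each of the three quotients in \<open>regular_part\<close> contributes (-1)^a by
  reflection, and so does \<open>polar_part\<close>. These four signs multiply to 1.\<close>

lemma parts_antisymmetric:
  assumes "k \<le> a" "v 0 = 0"
  shows "regular_part (a - k) v * polar_part (a - k) v = - (regular_part k v * polar_part k v)"
proof -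
  have A: "A v = - of_nat a" and B: "B v =
      - of_nat b" using assms(2) by (simp_all add: alpha_def beta_def)
  have ka: "(of_nat (a - k) :: 'p padic) = of_nat a - of_nat k" using assms(1) by (simp add: of_nat_diff)
  define w :: "nat \<Rightarrow> 'p padic" where "w k = vwp_weight (- of_nat a) k * pochhammer (- of_nat a) k /
      fact k ^ 2" for k
  define r where "r x k = pochhammer x k / pochhammer (- of_nat a - x + 1) k" for x :: "'p padic" and k
  define s :: "'p padic" where "s = (-1) ^ a"
  have ss: "s * s = 1" by (simp add: s_def flip: power_mult_distrib)
  have a0: "(of_nat a :: 'p padic) \<noteq> 0" using b_less_a by simp
  \<comment> \<open>The two symbols (-a)_k over k!^2 give the squared binomial coefficient, which is
    symmetric; the ratio (a - 2k)/a coming from the weight is antisymmetric.\<close>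
  have w: "w k = (of_nat a - 2 * of_nat k) / of_nat a * of_nat (a choose k) ^ 2" if "k \<le> a" for k
  proof -
    have 1: "pochhammer (- of_nat a) k / fact k = ((-1) ^ k * of_nat (a choose k) :: 'p padic)"
      using that by (simp add: pochhammer_minus_of_nat binomial_fact)
    have 2: "w k = (- of_nat a / 2 + of_nat k) / (- of_nat a / 2) * (pochhammer (- of_nat a) k /
        fact k) ^ 2"
      unfolding w_def by (subst vwp_weight_eq) (use a0 in \<open>auto simp: power2_eq_square\<close>)
    have 3: "(- of_nat a / 2 + of_nat k) / (- of_nat a / 2) =
        (of_nat a - 2 * of_nat k) / (of_nat a :: 'p padic)"
      using a0 by (simp add: field_simps)
    have "((-1) ^ k * of_nat (a choose k)) ^ 2 = (of_nat (a choose k) ^ 2 :: 'p padic)"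
      by (simp add: power_mult_distrib flip: power_mult)
    thus ?thesis unfolding 2 3 1 by simp
  qed
  have w': "w (a - k) = - w k"
  proof -
    have b: "a choose (a - k) = a choose k" using assms(1) by (rule binomial_symmetric[symmetric])
    have n: "of_nat a - 2 * (of_nat a - of_nat k) = - (of_nat a - 2 * of_nat k :: 'p padic)" by simp
    have "w (a - k) = (of_nat a - 2 * (of_nat a - of_nat k)) / of_nat a * of_nat (a choose k) ^ 2"
      using w[of "a - k"] by (simp add: b ka)
    thus ?thesis unfolding n w[OF assms(1)] using a0 by (simp add: field_simps)
  qed
  \<comment> \<open>Up to sign, (-a - x + 1)_a is (x)_a read backwards, so its being a unit yields
    the nonvanishing that \<open>pochhammer_ratio_reflect\<close> requires.\<close>
  have r: "r x (a - k) = s * r x k" if "padic_unit (pochhammer (- of_nat a - x + 1) a)" for x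
  proof -
    have "pochhammer x a * 1 = s * pochhammer (1 - of_nat a - x) a"
      using pochhammer_reflect[of a a x] by (simp add: s_def flip: power_mult_distrib)
    hence "pochhammer x a \<noteq> 0" using padic_unit_nonzero[OF that] by (simp add: s_def algebra_simps)
    from pochhammer_ratio_reflect[OF assms(1) this] show ?thesis
      unfolding r_def s_def by (simp add: algebra_simps)
  qed
  have R: "regular_part (a - k) v = - (s * s * s) * regular_part k v"
  proof -
    have "r (C v) (a - k) = s * r (C v) k" "r (D v) (a - k) = s * r (D v) k" "r E (a - k) = s * r E k"
      by (rule r, use units(2,3,4)[of a v] less_p in \<open>simp add: A\<close>)+
    moreover have "regular_part k v = w k * (r (C v) k * r (D v) k * r E k)" for k
      by (simp add: regular_part_def w_def r_def A)
    ultimately show ?thesis by (simp add: w' mult_ac)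
  qed
  have P: "polar_part (a - k) v = s * polar_part k v"
  proof -
    define K :: "'p padic" where "K = (1 - to_fract \<kappa>) * pochhammer (1 - of_nat (a - b)) (a - b - 1)"
    have AB: "A v - B v + 1 = 1 - of_nat (a - b)" unfolding A B using b_less_a by (simp add: of_nat_diff)
    \<comment> \<open>Below a - b the numerator p x is 0, and above b the symbol (-b)_k is 0. The
      range in between and the product (b - k)! (k - (a - b))! are invariant under k -> a -
      k.\<close>
    have pol: "polar_part k v =
        (if a - b \<le> k \<and> k \<le> b then (-1) ^ k * fact b / (K * fact (b - k) * fact (k - (a - b))) else
        0)" for k
    proof (cases "a - b \<le> k \<and> k \<le> b")
      case True
      thus ?thesis
        unfolding polar_part_def AB
        by (simp add: B K_def pochhammer_minus_of_nat pochhammer_fact[symmetric] mult_ac)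
    next
      case False
      thus ?thesis by (auto simp: polar_part_def A B assms(2) pochhammer_of_nat_eq_0_iff)
    qed
    have sk: "(-1 :: 'p padic) ^ (a - k) = s * (-1) ^ k"
    proof -
      have "s = (-1) ^ (a - k) * (-1) ^ k" unfolding s_def using assms(1) by (simp flip: power_add)
      thus ?thesis by (simp add: mult.assoc flip: power_mult_distrib)
    qed
    show ?thesis
    proof (cases "a - b \<le> k \<and> k \<le> b")
      case True
      hence "a - b \<le> a - k \<and> a - k \<le> b" "b - (a - k) = k - (a - b)" "a - k - (a - b) = b - k"
        using assms(1) b_less_a by auto
      thus ?thesis using True by (simp add: pol sk mult_ac)
    next
      case False
      hence "\<not> (a - b \<le> a - k \<and> a - k \<le> b)" using assms(1) b_less_a by auto
      thus ?thesis using False by (simp only: pol if_False) simp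
    qed
  qed
  have "regular_part (a - k) v * polar_part (a - k) v =
      - ((s * s) * (s * s)) * (regular_part k v * polar_part k v)"
    unfolding R P by (simp add: mult_ac)
  thus ?thesis by (simp add: ss)
qed

lemma sum_parts_eq_0:
  assumes "v 0 = 0"
  shows "(\<Sum>k\<le>a. regular_part k v * polar_part k v) = 0"
proof -
  let ?f = "\<lambda>k. regular_part k v * polar_part k v"
  have "(\<Sum>k\<le>a. ?f k) = (\<Sum>k\<le>a. ?f (a - k))"
    by (rule sum.reindex_bij_witness[of _ "\<lambda>k. a - k" "\<lambda>k. a - k"]) auto
  also have "\<dots> = - (\<Sum>k\<le>a. ?f k)"
    by (simp add: parts_antisymmetric assms sum_negf)
  finally show ?thesis by simp
qed

text \<open>The values at \<open>v 0 = 0\<close> sum to zero, so subtracting them termwise leaves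
  the sum unchanged and makes it exactly divisible by p times \<open>v 0\<close>. The function
  \<open>h\<close> also covers \<open>v 0 = 0\<close>, where denominators of the series
  vanish.\<close>

lemma sum_whipple_7F6_term_p2_affine:
  "\<exists>h. p2_affine h \<and> (\<forall>v. v 0 \<noteq> 0 \<longrightarrow> (\<Sum>k\<le>a. whipple_7F6_term (A v) (B v) (C v) (D v) E k) = h v)"
proof -
  let ?f = "\<lambda>k v. regular_part k v * polar_part k v"
  have "\<forall>k\<in>{..a}. \<exists>h. p2_affine h \<and> (\<forall>v. ?f k v - ?f k (v(0 := 0)) =
      of_nat CARD('p) * to_fract (v 0) * h v)"
    using p2_affine_quot_parts unfolding p2_affine_quot_def by blast
  then obtain h where h: "\<And>k. k \<le> a \<Longrightarrow> p2_affine (h k)"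
      "\<And>k v. k \<le> a \<Longrightarrow> ?f k v - ?f k (v(0 := 0)) = of_nat CARD('p) * to_fract (v 0) * h k v"
    unfolding bchoice_iff by auto
  show ?thesis
  proof (intro exI conjI allI impI)
    show "p2_affine (\<lambda>v. \<Sum>k\<le>a. h k v)" by (intro p2_affine_sum h) auto
    fix v :: "nat \<Rightarrow> 'p padic_int" assume v: "v 0 \<noteq> 0"
    let ?x = "of_nat CARD('p) * to_fract (v 0) :: 'p padic"
    have x: "?x \<noteq> 0" using v by simp
    have "(\<Sum>k\<le>a. whipple_7F6_term (A v) (B v) (C v) (D v) E k) = (\<Sum>k\<le>a. ?f k v) / ?x"
      by (simp add: whipple_7F6_term_split[of v, OF v] sum_divide_distrib)
    also have "(\<Sum>k\<le>a. ?f k v) = (\<Sum>k\<le>a. ?f k v - ?f k (v(0 := 0)))"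
      using sum_parts_eq_0[of "v(0 := 0)"] by (simp add: sum_subtractf)
    also have "\<dots> = ?x * (\<Sum>k\<le>a. h k v)"
      unfolding sum_distrib_left by (intro sum.cong refl h(2)) auto
    finally show "(\<Sum>k\<le>a. whipple_7F6_term (A v) (B v) (C v) (D v) E k) = (\<Sum>k\<le>a. h k v)" using x by simp
  qed
qed

lemma congruence:
  assumes "v 0 \<noteq> 0"
  shows "(\<Sum>k\<le>a. whipple_7F6_term (A v) (B v) (C v) (D v) E k) -
     Gamma_factor a b (alpha v) (beta v) (gamma v) (delta v) *
         (\<Sum>k\<le>min c d. whipple_4F3_term (A v) (B v) (C v) (D v) E k) \<in> padic_ideal 2"
proof -
  obtain h where h: "p2_affine h" "\<And>v. v 0 \<noteq> 0 \<Longrightarrow>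
      (\<Sum>k\<le>a. whipple_7F6_term (A v) (B v) (C v) (D v) E k) = h v"
    using sum_whipple_7F6_term_p2_affine by blast
  let ?R = "\<lambda>v. Gamma_factor a b (alpha v) (beta v) (gamma v) (delta v) *
      (\<Sum>k\<le>min c d. whipple_4F3_term (A v) (B v) (C v) (D v) E k)"
  \<comment> \<open>\<open>h\<close> stands in for the series, so that the difference is affine on
    all arguments and not only where \<open>v 0\<close> is nonzero.\<close>
  have affine: "p2_affine (\<lambda>v. h v - ?R v)"
    by (intro p2_affine_diff p2_affine_mult p2_affine_sum h p2_affine_Gamma_factor
        p2_affine_whipple_4F3_term) auto
  \<comment> \<open>The four points of \<open>p2_affine_zero_criterion\<close> have this form; y = 0
    makes \<gamma> the terminating parameter and z = 0 makes it \<delta>.\<close>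
  have *: "h v - ?R v \<in> padic_ideal 2" if "v 0 = 1 \<or> v 0 = 2" "v 1 = 0 \<or> v 2 = 0" for v
  proof -
    have v0: "v 0 \<noteq> 0" using that(1) by auto
    have dv: "of_nat CARD('p) dvd gamma v + of_nat c" "of_nat CARD('p) dvd delta v + of_nat d"
      by (simp_all add: gamma_def delta_def)
    show ?thesis
    proof (cases "v 1 = 0")
      case True
      hence "gamma v = - of_nat c" by (simp add: gamma_def)
      from congruence_gamma_terminating[OF that(1) alpha_def[of v] beta_def[of v] this dv(2)]
      show ?thesis by (simp only: h(2)[of v, OF v0])
    next
      case False
      hence "delta v = - of_nat d" using that(2) by (simp add: delta_def)
      from congruence_delta_terminating[OF that(1) alpha_def[of v] beta_def[of v] this dv(1)]
      show ?thesis by (simp only: h(2)[of v, OF v0])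
    qed
  qed
  have "h v - ?R v \<in> padic_ideal 2"
    by (rule p2_affine_zero_criterion[OF affine]; rule *) simp_all
  thus ?thesis by (simp only: h(2)[of v, OF assms])
qed

end

section \<open>Reduction of the theorem to the normalized parameters\<close>

lemma p_divide_pochhammer_if_not_p_square_dvd:
  fixes x :: "'p :: prime_card padic_int"
  assumes "\<not> of_nat CARD('p) ^ 2 dvd pochhammer x n" "k \<le> n"
  shows "of_nat CARD('p) / pochhammer (to_fract x) k \<in> padic_ideal 0" "pochhammer (to_fract x) k \<noteq> 0"
proof -
  \<comment> \<open>A shorter symbol divides a longer one, so the hypothesis at length n covers all
    k \<le> n.\<close>
  have dvd: "pochhammer x k dvd pochhammer x n"
    using pochhammer_split[OF assms(2), of x] by simp
  hence "\<not> of_nat CARD('p) ^ 2 dvd pochhammer x k"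
    using assms(1) dvd_trans[OF _ dvd] by metis
  from dvd_p_if_not_p_square_dvd[OF this] obtain y where y: "of_nat CARD('p) = pochhammer x k * y" ..
  have "to_fract (of_nat CARD('p)) = to_fract (pochhammer x k * y)" using y by (rule arg_cong)
  hence *: "of_nat CARD('p) = pochhammer (to_fract x) k * to_fract y" by (simp add: to_fract_pochhammer)
  moreover have "(of_nat CARD('p) :: 'p padic) \<noteq> 0" by simp
  ultimately show nz: "pochhammer (to_fract x) k \<noteq> 0" by auto
  show "of_nat CARD('p) / pochhammer (to_fract x) k \<in> padic_ideal 0"
    unfolding * using nz by simp
qed

theorem theorem2p16:
  fixes \<alpha> \<beta> \<gamma> \<delta> \<epsilon> :: "'p :: prime_card padic_int" and p :: nat
  assumes "p = CARD('p)" and "odd p"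
  assumes "padic_residue (-\<beta>) < padic_residue (-\<alpha>)"
    and "padic_residue (-\<alpha>) \<le>
           Min {padic_residue (-\<gamma>), padic_residue (-\<delta>), padic_residue (-\<epsilon>)}"
  assumes "int p + padic_residue (-\<alpha>) >
             Max {padic_residue (-\<gamma>) + padic_residue (-\<epsilon>),
                  padic_residue (-\<delta>) + padic_residue (-\<epsilon>),
                  padic_residue (-\<beta>) + padic_residue (-\<gamma>) + padic_residue (-\<delta>)}"
  assumes "of_int (padic_residue (-\<alpha>)) / to_fract \<alpha> = of_int (padic_residue (-\<beta>)) / to_fract \<beta>"
  assumes "\<not> of_nat p ^ 2 dvd pochhammer (\<alpha> - \<beta> + 1) (p - 1)"
    and "\<not> of_nat p ^ 2 dvd pochhammer (\<alpha> - \<gamma> + 1) (p - 1)"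
    and "\<not> of_nat p ^ 2 dvd pochhammer (\<alpha> - \<delta> + 1) (p - 1)"
    and "\<not> of_nat p ^ 2 dvd pochhammer (\<alpha> - \<epsilon> + 1) (p - 1)"
    and "\<not> of_nat p ^ 2 dvd pochhammer (\<beta> + \<gamma> + \<delta> - \<alpha>) (p - 1)"
  shows "padic_cong 2
    (vwp_trunc_hypergeom (to_fract \<alpha>)
       (map to_fract [\<alpha>, \<alpha>, \<beta>, \<gamma>, \<delta>, \<epsilon>])
       (map to_fract [1, \<alpha> - \<beta> + 1, \<alpha> - \<gamma> + 1, \<alpha> - \<delta> + 1, \<alpha> - \<epsilon> + 1]) 1 (p - 1))
    (of_int (padic_residue (-\<alpha>)) / of_int (padic_residue (-\<alpha>) - padic_residue (-\<beta>)) *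
     (to_fract (morita_Gamma (\<alpha> - \<beta> + 1) * morita_Gamma (\<alpha> - \<gamma> + 1) *
                morita_Gamma (\<alpha> - \<delta> + 1) * morita_Gamma (\<alpha> - \<beta> - \<gamma> - \<delta> + 1)) /
      to_fract (morita_Gamma (\<alpha> + 1) * morita_Gamma (\<alpha> - \<beta> - \<gamma> + 1) *
                morita_Gamma (\<alpha> - \<beta> - \<delta> + 1) * morita_Gamma (\<alpha> - \<gamma> - \<delta> + 1))) *
     trunc_hypergeom
       (map to_fract [1 - \<epsilon>, \<beta>, \<gamma>, \<delta>])
       (map to_fract [1, \<alpha> - \<epsilon> + 1, \<beta> + \<gamma> + \<delta> - \<alpha>]) 1 (p - 1))"
proof -
  let ?r = "\<lambda>x :: 'p padic_int. nat (padic_residue (- x))"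
  define a b c d e where "a = ?r \<alpha>" and "b = ?r \<beta>" and "c = ?r \<gamma>" and "d = ?r \<delta>" and "e = ?r \<epsilon>"
  have r: "padic_residue (- x) = int (?r x)" "?r x < CARD('p)" for x :: "'p padic_int"
    using padic_residue_bounds[of "- x"] by auto
  note ra = r(1)[of \<alpha>, folded a_def] and rb = r(1)[of \<beta>, folded b_def] and rc = r(1)[of \<gamma>, folded c_def]
    and rd = r(1)[of \<delta>, folded d_def] and re = r(1)[of \<epsilon>, folded e_def]
  have ex: "\<exists>z. x = - of_nat (?r x) + of_nat CARD('p) * z" for x :: "'p padic_int"
  proof -
    define m where "m = ?r x"
    have "of_nat m = (of_int (padic_residue (- x)) :: 'p padic_int)"
      using padic_residue_bounds[of "- x"] by (simp add: m_def)
    hence "of_nat CARD('p) dvd - x - of_nat m" by (simp only: padic_residue_dvd)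
    then obtain z where z: "- x - of_nat m = of_nat CARD('p) * z" ..
    have "x = - of_nat m - (- x - of_nat m)" by simp
    also have "\<dots> = - of_nat m + of_nat CARD('p) * (- z)" unfolding z by simp
    finally show ?thesis unfolding m_def ..
  qed
  obtain x where x: "\<alpha> = - of_nat a + of_nat CARD('p) * x" using ex[of \<alpha>] unfolding a_def by blast
  obtain y where y: "\<gamma> = - of_nat c + of_nat CARD('p) * y" using ex[of \<gamma>] unfolding c_def by blast
  obtain z where z: "\<delta> = - of_nat d + of_nat CARD('p) * z" using ex[of \<delta>] unfolding d_def by blast
  obtain w where w: "\<epsilon> = - of_nat e + of_nat CARD('p) * w" using ex[of \<epsilon>] unfolding e_def by blast
  have less: "a < CARD('p)" "b < CARD('p)" "c < CARD('p)" "d < CARD('p)" "e < CARD('p)"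
    unfolding a_def b_def c_def d_def e_def by (rule r)+
  have ba: "b < a" using assms(3) by (simp add: ra rb)
  have ac: "a \<le> c" "a \<le> d" "a \<le> e" using assms(4) by (simp_all add: ra rc rd re)
  have sums: "c + e < CARD('p) + a" "d + e < CARD('p) + a" "b + c + d < CARD('p) + a"
    using assms(5) by (simp_all add: ra rb rc rd re assms(1))
  have nd: "\<not> of_nat CARD('p) dvd (of_nat n :: 'p padic_int)" if "0 < n" "n < CARD('p)" for n
  proof -
    have "\<not> int CARD('p) dvd int n" using that by (auto dest: zdvd_imp_le)
    thus ?thesis using p_dvd_of_int_iff[of "int n", where 'p = 'p] by simp
  qed
  have \<alpha>0: "\<alpha> \<noteq> 0"
  proof
    assume "\<alpha> = 0"
    hence "(of_nat a :: 'p padic_int) = of_nat CARD('p) * x" using x by simp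
    thus False using nd[of a] ba less by simp
  qed
  have a0: "(of_nat a :: 'p padic) \<noteq> 0" using ba by simp
  have ratio: "of_nat a / to_fract \<alpha> = of_nat b / to_fract \<beta>" using assms(6) by (simp add: ra rb)
  \<comment> \<open>If b or \<beta> were 0, the right-hand side of (iii) would be 0, division by
    zero being 0 in HOL, whereas the left-hand side is nonzero.\<close>
  have \<beta>0: "\<beta> \<noteq> 0" and b0: "0 < b"
    using ratio a0 \<alpha>0 by (auto intro!: Nat.gr0I)
  have "of_nat a * to_fract \<beta> = of_nat b * to_fract \<alpha>"
    using ratio \<alpha>0 \<beta>0 by (simp add: field_simps)
  hence "to_fract (of_nat a * \<beta>) = to_fract (of_nat b * \<alpha>)" by simp
  hence ab: "of_nat a * \<beta> = of_nat b * \<alpha>" by (simp only: to_fract_eq_iff)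
  obtain i where i: "of_nat a * i = (1 :: 'p padic_int)"
    using padic_int_unitI[OF nd[of a]] ba less by (metis dvdE not_gr0 less_nat_zero_code)
  \<comment> \<open>The quotient b/a is a p-adic integer because 0 < a < p makes a
    invertible.\<close>
  define \<kappa> where "\<kappa> = i * of_nat b"
  have \<kappa>: "of_nat a * \<kappa> = of_nat b" using i by (simp add: \<kappa>_def flip: mult.assoc)
  have "of_nat a * \<beta> = of_nat a * (\<kappa> * \<alpha>)" by (simp add: ab \<kappa> flip: mult.assoc)
  hence "\<beta> = \<kappa> * \<alpha>" using ba by simp
  hence \<beta>: "\<beta> = - of_nat b + of_nat CARD('p) * (\<kappa> * x)"
    using \<kappa> by (simp add: x algebra_simps)
  have odd: "odd CARD('p)" using assms(1,2) by simp
  interpret whipple_residues a b c d e \<kappa> \<epsilon>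
    using odd b0 ba ac less sums \<kappa> by unfold_locales (simp_all add: w)
  define v :: "nat \<Rightarrow> 'p padic_int" where "v = (\<lambda>_. 0)(0 := x, 1 := y, 2 := z)"
  have params: "alpha v = \<alpha>" "beta v = \<beta>" "gamma v = \<gamma>" "delta v = \<delta>"
    by (simp_all add: alpha_def beta_def gamma_def delta_def v_def x y z \<beta>)
  note pc = param_v_cong[of v, unfolded params]
  define n where "n = p - 1"
  have n: "k < CARD('p)" if "k \<le> n" for k using that less(1) unfolding n_def assms(1) by linarith
  have n': "a \<le> n" "min c d \<le> n" using less unfolding n_def assms(1) by auto
  \<comment> \<open>For x = 0 the number \<alpha> - \<beta> + 1 would be the nonpositive integer -(a
    - b - 1), and its Pochhammer symbol of length p - 1 would vanish, against (iv).\<close>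
  have x0: "x \<noteq> 0"
  proof
    assume "x = 0"
    hence *: "\<alpha> - \<beta> + 1 = - of_nat (a - b - 1)" using ba x \<beta> by (simp add: of_nat_diff)
    have "pochhammer (\<alpha> - \<beta> + 1) (p - 1) = 0"
      unfolding * pochhammer_of_nat_eq_0_iff using ba n' unfolding n_def by linarith
    thus False using assms(7) by simp
  qed
  have q: "of_nat CARD('p) / pochhammer (to_fract u) k \<in> padic_ideal 0"
    if "\<not> of_nat p ^ 2 dvd pochhammer u (p - 1)" "k \<le> n" for u :: "'p padic_int" and k
    using p_divide_pochhammer_if_not_p_square_dvd(1)[of u n k] that assms(1) by (simp add: n_def)
  let ?A = "to_fract \<alpha>" and ?B = "to_fract \<beta>" and ?C = "to_fract \<gamma>" and ?D = "to_fract \<delta>"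
  have tail7: "(\<Sum>k\<le>n. whipple_7F6_term ?A ?B ?C ?D E k) - (\<Sum>k\<le>a. whipple_7F6_term ?A ?B ?C ?D E k) \<in>
      padic_ideal 2"
  proof -
    have "(\<Sum>k\<le>n. whipple_7F6_term ?A ?B ?C ?D E k) - (\<Sum>k\<le>a. whipple_7F6_term ?A ?B ?C ?D E k) =
        (\<Sum>k\<in>{..n} - {..a}. whipple_7F6_term ?A ?B ?C ?D E k)"
      using n' by (subst sum_diff) auto
    also have "\<dots> \<in> padic_ideal 2"
    proof (rule padic_ideal_sum)
      fix k assume k: "k \<in> {..n} - {..a}"
      show "whipple_7F6_term ?A ?B ?C ?D E k \<in> padic_ideal 2"
        by (rule whipple_7F6_term_tail[OF pc])
           (use k n[of k] q[OF assms(7), of k] q[OF assms(8), of k] q[OF assms(9), of k]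
               q[OF assms(10), of k] in simp_all)
    qed
    finally show ?thesis .
  qed
  have tail4: "(\<Sum>k\<le>n. whipple_4F3_term ?A ?B ?C ?D E k) -
      (\<Sum>k\<le>min c d. whipple_4F3_term ?A ?B ?C ?D E k) \<in> padic_ideal 2"
  proof -
    have "(\<Sum>k\<le>n. whipple_4F3_term ?A ?B ?C ?D E k) - (\<Sum>k\<le>min c d. whipple_4F3_term ?A ?B ?C ?D E k) =
        (\<Sum>k\<in>{..n} - {..min c d}. whipple_4F3_term ?A ?B ?C ?D E k)"
      using n' by (subst sum_diff) auto
    also have "\<dots> \<in> padic_ideal 2"
    proof (rule padic_ideal_sum)
      fix k assume k: "k \<in> {..n} - {..min c d}"
      show "whipple_4F3_term ?A ?B ?C ?D E k \<in> padic_ideal 2"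
        by (rule whipple_4F3_term_tail[OF pc])
           (use k n[of k] q[OF assms(10), of k] q[OF assms(11), of k] in auto)
    qed
    finally show ?thesis .
  qed
  let ?G = "Gamma_factor a b \<alpha> \<beta> \<gamma> \<delta>"
  have main: "(\<Sum>k\<le>a. whipple_7F6_term ?A ?B ?C ?D E k) -
      ?G * (\<Sum>k\<le>min c d. whipple_4F3_term ?A ?B ?C ?D E k) \<in> padic_ideal 2"
  proof -
    have "v 0 \<noteq> 0" using x0 by (simp add: v_def)
    from congruence[of v, OF this] show ?thesis by (simp only: params)
  qed
  \<comment> \<open>The full difference is the truncated one plus the 7F6 tail minus the gamma
    factor times the 4F3 tail; the gamma factor is a unit and hence integral.\<close>
  have "((\<Sum>k\<le>n. whipple_7F6_term ?A ?B ?C ?D E k) - (\<Sum>k\<le>a. whipple_7F6_term ?A ?B ?C ?D E k))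
      + ((\<Sum>k\<le>a. whipple_7F6_term ?A ?B ?C ?D E k) - ?G * (\<Sum>k\<le>min c d. whipple_4F3_term ?A ?B ?C ?D E k))
      - ?G * ((\<Sum>k\<le>n. whipple_4F3_term ?A ?B ?C ?D E k) -
          (\<Sum>k\<le>min c d. whipple_4F3_term ?A ?B ?C ?D E k)) \<in> padic_ideal 2"
    by (intro padic_ideal_diff[OF padic_ideal_add[OF tail7 main]
        padic_ideal_mult_left[OF padic_unit_integral[OF Gamma_factor_unit] tail4]])
  hence "padic_cong 2 (\<Sum>k\<le>n. whipple_7F6_term ?A ?B ?C ?D E k)
      (?G * (\<Sum>k\<le>n. whipple_4F3_term ?A ?B ?C ?D E k))"
    by (simp add: padic_cong_iff algebra_simps)
  moreover have "vwp_trunc_hypergeom ?A (map to_fract [\<alpha>, \<alpha>, \<beta>, \<gamma>, \<delta>, \<epsilon>])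
       (map to_fract [1, \<alpha> - \<beta> + 1, \<alpha> - \<gamma> + 1, \<alpha> - \<delta> + 1, \<alpha> - \<epsilon> + 1]) 1 (p - 1) =
     (\<Sum>k\<le>n. whipple_7F6_term ?A ?B ?C ?D E k)"
  proof -
    have "?A \<noteq> 0" using \<alpha>0 by simp
    thus ?thesis unfolding vwp_trunc_hypergeom_def n_def[symmetric] whipple_7F6_term_def
        vwp_weight_eq[OF \<open>?A \<noteq> 0\<close>]
      by (intro sum.cong refl) (simp add: pochhammer_fact[symmetric] power2_eq_square mult_ac)
  qed
  moreover have "trunc_hypergeom (map to_fract [1 - \<epsilon>, \<beta>, \<gamma>, \<delta>])
       (map to_fract [1, \<alpha> - \<epsilon> + 1, \<beta> + \<gamma> + \<delta> - \<alpha>]) 1 (p - 1) = (\<Sum>k\<le>n. whipple_4F3_term ?A ?B ?C ?D E k)"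
    unfolding trunc_hypergeom_def n_def[symmetric] whipple_4F3_term_def
    by (intro sum.cong refl) (simp add: pochhammer_fact[symmetric] power2_eq_square mult_ac)
  ultimately show ?thesis
    unfolding ra rb Gamma_factor_def by (simp only:)
qed

end
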